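(* Let $X=\mathbb{C}$, let $\mathcal{W}_{\mathrm{bnr}}\subset X$ be the spectral network of the Berk–Nevins–Roberts spectral curve $p^3-3p+x=0$, and let $\mathcal{W}^{\mathrm{ext}}_{\mathrm{bnr}}$ be the extended spectral network, obtained as the union of $\mathcal{W}_{\mathrm{bnr}}$ with the "backward collision line" (the vertical segment joining the two collision points). Let $h^\phi:X\to\mathcal{B}^\phi$ be the universal harmonic $\phi$-map to a building. Then: 1. the inverse image under $h^\phi$ of the singular set of $\mathcal{B}^\phi$ contains $\mathcal{W}_{\mathrm{bnr}}$; 2. the inverse image under $h^\phi$ of the singular set of $\mathcal{B}^\phi$ equals $\mathcal{W}^{\mathrm{ext}}_{\mathrm{bnr}}$.
   Context: Spectral network. Let $\phi_i=p_i\,dx$, $i=1,2,3$, with $p_i$ the roots of $p^3-3p+x=0$; the branch points are $b_l=-2$, $b_r=2$. From each branch point $b$ emanate three maximal curves along which $\mathrm{Re}\int_b^x(\phi_i-\phi_j)=0$, where $\phi_i,\phi_j$ are the two sheets meeting at $b$ (from $b_r$: the real ray $[2,\infty)$ and two curves going up-left and down-left; from $b_l$: the mirror images). The curves from $b_l$ and $b_r$ going upward cross at a collision point $c_u$ on the positive imaginary axis, and those going downward at $c_l=\overline{c_u}$. The collision lines are the vertical rays along the imaginary axis from $c_u$ upward and from $c_l$ downward. $\mathcal{W}_{\mathrm{bnr}}$ is the union of these six curves and two collision lines. The backward collision line is the segment $[c_l,c_u]$. The complement of $\mathcal{W}^{\mathrm{ext}}_{\mathrm{bnr}}$ has ten components: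 eight unbounded regions, separated cyclically by eight boundary curves going to infinity (right real, up-right, up, up-left, left real, down-left, down, down-right), and two bounded ones, the left and right halves of the central square with vertices $b_l,c_u,b_r,c_l$. Buildings. Buildings are affine $\mathbb{R}$-buildings modelled on $\mathbb{A}=\{x\in\mathbb{R}^3:\sum x_i=0\}$ with $W_{\mathrm{aff}}=S_3\ltimes\mathbb{A}$. A point of a building is singular if no neighbourhood of it is contained in a single apartment; the singular set is the set of singular points. The building $\mathcal{B}^\phi$. Let $G_0$ be an octagon ($8$-cycle) viewed as a bipartite graph; inductively $G_n$ is obtained from $G_{n-1}$ by adding, for every non-backtracking path of four edges in $G_{n-1}$ not contained in a hexagon, a new path of two edges joining its endpoints (completing it to a hexagon), with at most one new pair of edges added between any two vertices. $\mathcal{B}^8=\bigcup_nG_n$ is a spherical building of type $A_2$ (apartments are the hexagons), and $\mathcal{B}^\phi=\mathrm{Cone}(\mathcal{B}^8)$ is the affine building which is the cone over it: each edge of $\mathcal{B}^8$ gives a sector, each vertex a ray (panel), based at the cone vertex $o$. The map $h^\phi$. $h^\phi$ is the harmonic $\phi$-map (i.e. in apartment coordinates $d(x_i\circ h^\phi)=\mathrm{Re}\,\phi_i$ up to numbering, away from the branch points) which sends $c_u,c_l$ to $o$; sends the closures of the eight unbounded regions, in cyclic order, to the eight sectors given by the edges of $G_0$ (so that the eight boundary curves going to infinity are sent to the rays given by the vertices of $G_0$); and sends the closures of the left and right halves of the central square into the two sectors given by the pair of edges added in $G_1$ between the two opposite vertices of $G_0$ corresponding to the left and right real rays. It is universal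 among harmonic $\phi$-maps from $X$ to buildings. *)

theory Defs
  imports "HOL-Analysis.Analysis" "HOL-Library.Uprod"
begin

section \<open>The spectral curve and its (extended) spectral network\<close>

definition sheets :: "complex \<Rightarrow> complex set" where
  "sheets x = {p. p ^ 3 - 3 * p + x = 0}"

definition b_left :: complex where "b_left = -2"

definition b_right :: complex where "b_right = 2"

text \<open>
  A path issuing from the branch point \<open>b\<close>, together with a continuous choice of two sheets
  that meet at \<open>b\<close>, along which the real part of the integral of the difference of the two
  forms vanishes.  Only the values of the path on nonnegative reals matter.
\<close>

definition spectral_trajectory :: "complex \<Rightarrow> (real \<Rightarrow> complex) \<Rightarrow> bool" where
  "spectral_trajectory b \<gamma> \<longleftrightarrow>
     \<gamma> 0 = b \<and> (\<forall>T\<ge>0. \<gamma> piecewise_C1_differentiable_on {0..T}) \<and>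
     (\<exists>p q. continuous_on {0..} p \<and> continuous_on {0..} q \<and>
        (\<forall>t\<ge>0. p t \<in> sheets (\<gamma> t) \<and> q t \<in> sheets (\<gamma> t)) \<and>
        p 0 = q 0 \<and> (\<forall>t>0. p t \<noteq> q t) \<and>
        (\<forall>t\<ge>0. Re (integral {0..t} (\<lambda>s. (p s - q s) * vector_derivative \<gamma> (at s))) = 0))"

definition trajectory_images :: "complex \<Rightarrow> complex set set" where
  "trajectory_images b = {\<gamma> ` {0..} | \<gamma>. spectral_trajectory b \<gamma>}"

text \<open>The maximal curves emanating from \<open>b\<close>, as subsets of the plane.\<close>

definition spectral_curves :: "complex \<Rightarrow> complex set set" where
  "spectral_curves b =
     {K \<in> trajectory_images b. \<forall>K' \<in> trajectory_images b. K \<subseteq> K' \<longrightarrow> K' = K}"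

definition c_upper :: complex where
  "c_upper = (THE c. Re c = 0 \<and> Im c > 0 \<and>
     (\<exists>K \<in> spectral_curves b_left. \<exists>K' \<in> spectral_curves b_right. c \<in> K \<inter> K'))"

definition c_lower :: complex where "c_lower = cnj c_upper"

definition upper_collision_line :: "complex set" where
  "upper_collision_line = {x. Re x = 0 \<and> Im x \<ge> Im c_upper}"

definition lower_collision_line :: "complex set" where
  "lower_collision_line = {x. Re x = 0 \<and> Im x \<le> Im c_lower}"

definition W_bnr :: "complex set" where
  "W_bnr = \<Union> (spectral_curves b_left) \<union> \<Union> (spectral_curves b_right)
             \<union> upper_collision_line \<union> lower_collision_line"

definition W_bnr_ext :: "complex set" where
  "W_bnr_ext = W_bnr \<union> closed_segment c_lower c_upper"

text \<open>
  The eight boundary curves going to infinity, counterclockwise from the right real ray.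
  The curves leaving \<open>b_left\<close> upward and downward cross the imaginary axis at the
  collision points, so their parts beyond these points are the parts in the right half plane;
  symmetrically for \<open>b_right\<close>.
\<close>

definition boundary_curve :: "nat \<Rightarrow> complex set" where
  "boundary_curve k =
     [{x. Im x = 0 \<and> Re x \<ge> 2},
      {x \<in> \<Union> (spectral_curves b_left). Re x \<ge> 0 \<and> Im x > 0},
      upper_collision_line,
      {x \<in> \<Union> (spectral_curves b_right). Re x \<le> 0 \<and> Im x > 0},
      {x. Im x = 0 \<and> Re x \<le> -2},
      {x \<in> \<Union> (spectral_curves b_right). Re x \<le> 0 \<and> Im x < 0},
      lower_collision_line,
      {x \<in> \<Union> (spectral_curves b_left). Re x \<ge> 0 \<and> Im x < 0}] ! (k mod 8)"

text \<open>\<open>C\<close> is the unbounded region between the \<open>k\<close>-th boundary curve and the next one.\<close>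

definition is_outer_region :: "nat \<Rightarrow> complex set \<Rightarrow> bool" where
  "is_outer_region k C \<longleftrightarrow> C \<in> components (- W_bnr_ext) \<and> \<not> bounded C \<and>
     boundary_curve k \<subseteq> frontier C \<and> boundary_curve (Suc k) \<subseteq> frontier C"

definition is_left_half :: "complex set \<Rightarrow> bool" where
  "is_left_half C \<longleftrightarrow> C \<in> components (- W_bnr_ext) \<and> bounded C \<and> C \<subseteq> {x. Re x < 0}"

definition is_right_half :: "complex set \<Rightarrow> bool" where
  "is_right_half C \<longleftrightarrow> C \<in> components (- W_bnr_ext) \<and> bounded C \<and> C \<subseteq> {x. Re x > 0}"


section \<open>Spaces with an atlas of apartments\<close>

text \<open>
  A building is given by its set of points \<open>B\<close> and its atlas \<open>\<A>\<close> of charts.  A chart is a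
  function whose values are only relevant on the model plane; apartments are the images of the
  model plane under charts.
\<close>

definition model_plane :: "(real ^ 3) set" where
  "model_plane = {a. (\<Sum>i\<in>UNIV. a $ i) = 0}"

definition W_aff :: "(real ^ 3 \<Rightarrow> real ^ 3) set" where
  "W_aff = {\<lambda>a. (\<chi> i. a $ (\<sigma> i)) + c | \<sigma> c. bij \<sigma> \<and> c \<in> model_plane}"

text \<open>
  Balls for the building metric: the distance of two points is their Euclidean distance in
  any apartment containing both.
\<close>

definition building_ball :: "(real ^ 3 \<Rightarrow> 'b) set \<Rightarrow> 'b \<Rightarrow> real \<Rightarrow> 'b set" where
  "building_ball \<A> x \<epsilon> =
     {f b | f a b. f \<in> \<A> \<and> a \<in> model_plane \<and> b \<in> model_plane \<and> f a = x \<and> dist a b < \<epsilon>}"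

definition singular_set :: "'b set \<Rightarrow> (real ^ 3 \<Rightarrow> 'b) set \<Rightarrow> 'b set" where
  "singular_set B \<A> =
     {x \<in> B. \<not> (\<exists>\<epsilon>>0. \<exists>f\<in>\<A>. building_ball \<A> x \<epsilon> \<subseteq> f ` model_plane)}"

text \<open>
  Near every point that is not a branch point, the map goes into one apartment, and
  its coordinates there have the real parts of the three forms as differentials, for some
  holomorphic numbering \<open>p\<close> of the sheets.
\<close>

definition harmonic_phi_map ::
    "'b set \<Rightarrow> (real ^ 3 \<Rightarrow> 'b) set \<Rightarrow> (complex \<Rightarrow> 'b) \<Rightarrow> bool" where
  "harmonic_phi_map B \<A> h \<longleftrightarrow>
     range h \<subseteq> B \<and>
     (\<forall>x. \<forall>\<epsilon>>0. \<exists>\<delta>>0. \<forall>y. dist x y < \<delta> \<longrightarrow> h y \<in> building_ball \<A> (h x) \<epsilon>) \<and>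
     (\<forall>x. x \<notin> {b_left, b_right} \<longrightarrow>
        (\<exists>U f g. \<exists>p :: 3 \<Rightarrow> complex \<Rightarrow> complex.
           open U \<and> x \<in> U \<and> f \<in> \<A> \<and>
           (\<forall>y\<in>U. g y \<in> model_plane \<and> f (g y) = h y) \<and>
           (\<forall>i. p i holomorphic_on U) \<and>
           (\<forall>y\<in>U. range (\<lambda>i. p i y) = sheets y) \<and>
           (\<forall>i. \<forall>y\<in>U. ((\<lambda>z. g z $ i) has_derivative (\<lambda>v. Re (p i y * v))) (at y))))"


section \<open>The spherical building generated by an octagon\<close>

text \<open>
  \<open>Oct 0, \<dots>, Oct 7\<close> are the vertices of the octagon, and \<open>Mid (Upair u v)\<close> is the middle
  vertex of the path of two edges added between \<open>u\<close> and \<open>v\<close>.  Graphs are given by their sets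
  of edges, and edges are two-element sets.
\<close>

datatype vert = Oct nat | Mid "vert uprod"

definition is_path4 :: "vert set set \<Rightarrow> (nat \<Rightarrow> vert) \<Rightarrow> bool" where
  "is_path4 E v \<longleftrightarrow> (\<forall>i<4. {v i, v (Suc i)} \<in> E) \<and> (\<forall>i<3. v i \<noteq> v (Suc (Suc i)))"

definition is_hexagon :: "vert set set \<Rightarrow> (nat \<Rightarrow> vert) \<Rightarrow> bool" where
  "is_hexagon E w \<longleftrightarrow> inj_on w {..<6} \<and> (\<forall>i<6. {w i, w (Suc i mod 6)} \<in> E)"

definition in_hexagon :: "vert set set \<Rightarrow> (nat \<Rightarrow> vert) \<Rightarrow> bool" where
  "in_hexagon E v \<longleftrightarrow> (\<exists>w. is_hexagon E w \<and>
     (\<forall>i<4. {v i, v (Suc i)} \<in> {{w j, w (Suc j mod 6)} | j. j < 6}))"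

text \<open>
  As the new middle vertex depends only on the unordered pair of end points, at most one new
  pair of edges is added between any two vertices.
\<close>

primrec G :: "nat \<Rightarrow> vert set set" where
  "G 0 = {{Oct i, Oct (Suc i mod 8)} | i. i < 8}"
| "G (Suc n) = G n \<union>
     \<Union> {{{v 0, Mid (Upair (v 0) (v 4))}, {Mid (Upair (v 0) (v 4)), v 4}} | v.
           is_path4 (G n) v \<and> \<not> in_hexagon (G n) v}"

definition B8 :: "vert set set" where
  "B8 = (\<Union>n. G n)"

text \<open>The class of the bipartition that contains \<open>Oct 0\<close>.\<close>

definition even_vertex :: "vert \<Rightarrow> bool" where
  "even_vertex v \<longleftrightarrow> (\<exists>k. (Oct 0, v) \<in> {(u, w). {u, w} \<in> B8} ^^ (2 * k))"


section \<open>The cone over the spherical building\<close>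

text \<open>
  A point of the cone is the function giving its nonnegative coordinates along the rays
  of the vertices; its support lies in an edge.  The cone vertex is the zero function.
\<close>

definition sector :: "vert \<Rightarrow> vert \<Rightarrow> (vert \<Rightarrow> real) set" where
  "sector u v = {z. (\<forall>w. z w \<ge> 0) \<and> {w. z w \<noteq> 0} \<subseteq> {u, v}}"

definition cone_vertex :: "vert \<Rightarrow> real" where
  "cone_vertex = (\<lambda>_. 0)"

definition B_phi :: "(vert \<Rightarrow> real) set" where
  "B_phi = \<Union> {sector u v | u v. {u, v} \<in> B8}"

text \<open>
  The six rays of the Weyl fan in cyclic order.  Those with even index form one
  Weyl orbit, those with odd index the other one.
\<close>

definition fan_ray :: "nat \<Rightarrow> real ^ 3" where
  "fan_ray k =
     [vector [1, 1, -2], vector [2, -1, -1], vector [1, -2, 1],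
      vector [-1, -1, 2], vector [-2, 1, 1], vector [-1, 2, -1]] ! (k mod 6)"

text \<open>
  The charts are the identifications of the model plane with the cones over hexagons, up to
  the affine Weyl group.  The Weyl group does not exchange the two types of rays, so the
  hexagon has to start at a vertex of the right type: on the right real ray two coordinates
  of the harmonic map are equal and exceed the third one, hence the vertices in the class of
  \<open>Oct 0\<close> correspond to the rays in the orbit of \<open>(1, 1, -2)\<close>.
\<close>

definition B_phi_atlas :: "(real ^ 3 \<Rightarrow> (vert \<Rightarrow> real)) set" where
  "B_phi_atlas = {f. \<exists>w. \<exists>\<tau>\<in>W_aff. is_hexagon B8 w \<and> even_vertex (w 0) \<and>
     (\<forall>i<6. \<forall>s\<ge>0. \<forall>t\<ge>0.
        f (\<tau> (s *\<^sub>R fan_ray i + t *\<^sub>R fan_ray (Suc i))) =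
        cone_vertex (w i := s, w (Suc i mod 6) := t))}"


section \<open>The harmonic map\<close>

text \<open>
  \<open>Oct 0\<close> and \<open>Oct 4\<close> are the vertices of the right and left real rays.  These
  conditions pin the map down; its universality among harmonic maps to buildings is a property
  of it and is not part of the definition.
\<close>

definition is_h_phi :: "(complex \<Rightarrow> (vert \<Rightarrow> real)) \<Rightarrow> bool" where
  "is_h_phi h \<longleftrightarrow>
     harmonic_phi_map B_phi B_phi_atlas h \<and>
     h c_upper = cone_vertex \<and> h c_lower = cone_vertex \<and>
     (\<forall>k<8. \<forall>C. is_outer_region k C \<longrightarrow>
        h ` closure C \<subseteq> sector (Oct k) (Oct (Suc k mod 8))) \<and>
     (\<forall>C. is_left_half C \<longrightarrow>
        h ` closure C \<subseteq> sector (Oct 4) (Mid (Upair (Oct 0) (Oct 4)))) \<and>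
     (\<forall>C. is_right_half C \<longrightarrow>
        h ` closure C \<subseteq> sector (Oct 0) (Mid (Upair (Oct 0) (Oct 4))))"

end

theory Submission
  imports Defs
begin

text \<open>
  The sheets over \<open>x = 2 cos 3v\<close> are \<open>2 cos (v \<plusminus> pi/3)\<close> and \<open>-2 cos v\<close>, and \<open>p dx\<close> is the differential
  of the polynomial \<open>3 p\<^sup>2 / 2 - 3 p\<^sup>4 / 4\<close> in \<open>p\<close>.  Hence the trajectories issuing from \<open>2\<close> are arcs
  of the explicit level set \<open>Re (sin v ^ 3 * cos v) = 0\<close>, and those issuing from \<open>-2\<close> are their
  negatives.  In confocal coordinates the extended network consists of graphs, so that its
  complement splits into ten bands, whose closures are mapped into given sectors.  A point of the
  network lies in the closures of two cells whose sectors share a single ray, and a ray whose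
  vertex has three neighbours is singular, because a hexagon contains only two edges at a vertex.
  Inside a cell the coordinates of the map along the two rays of its sector are nonnegative
  harmonic functions without critical points, so they are positive, and the interior of a sector
  has no singular points.
\<close>

section \<open>Spectral trajectories\<close>

text \<open>A trajectory may pause or turn back, so its image cannot be read off from a differential
  equation. What works pointwise is the conic \<open>p^2 + p * q + q^2 = 3\<close> of pairs of
  distinct sheets: the angle \<open>v\<close> parametrises it, and on it the integral condition
  becomes a quartic equation in \<open>p\<close> and \<open>q\<close>. Continuity serves only to
  select one branch, and two estimates make this possible: \<open>Re (cos v)\<close> never equals
  1/2 on the level set, which shuts off the branch \<open>cos (Re v) = 0\<close>, and
  \<open>level_angle\<close> stays below pi/4 in absolute value. The second estimate also keeps the
  curves at angles below 3 pi/4 in confocal coordinates, so a single strip and comparisons with pi/2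
  settle all adjacencies of cells. The map \<open>h\<close> is never computed: on the network only
  its membership in two closed sectors counts, off the network only its local charts. Of the
  infinite graph only the octagon, its diagonals and one vertex born in \<open>G 2\<close> are
  examined.\<close>

lemma has_vector_derivative_iff_tendsto:
  fixes f :: "real \<Rightarrow> 'a::real_normed_vector"
  shows "(f has_vector_derivative D) (at t within S) \<longleftrightarrow>
    ((\<lambda>s. (f s - f t) /\<^sub>R (s - t)) \<longlongrightarrow> D) (at t within S)"
proof -
  have "(f has_vector_derivative D) (at t within S) \<longleftrightarrow>
    ((\<lambda>s. norm (f s - f t - (s - t) *\<^sub>R D) / norm (s - t)) \<longlongrightarrow> 0) (at t within S)"
    by (simp add: has_vector_derivative_def has_derivative_iff_norm bounded_linear_scaleR_left)
  also have "\<dots> \<longleftrightarrow> ((\<lambda>s. norm ((f s - f t) /\<^sub>R (s - t) - D)) \<longlongrightarrow> 0) (at t within S)"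
  proof (rule filterlim_cong[OF refl refl])
    show "\<forall>\<^sub>F s in at t within S. norm (f s - f t - (s - t) *\<^sub>R D) / norm (s - t) =
        norm ((f s - f t) /\<^sub>R (s - t) - D)"
      unfolding eventually_at_filter
    proof (intro always_eventually allI impI)
      fix s assume "s \<noteq> t"
      then have "(f s - f t) /\<^sub>R (s - t) - D = (f s - f t - (s - t) *\<^sub>R D) /\<^sub>R (s - t)"
        by (simp add: scaleR_diff_right)
      then show "norm (f s - f t - (s - t) *\<^sub>R D) / norm (s - t) =
        norm ((f s - f t) /\<^sub>R (s - t) - D)"
        by (simp add: divide_inverse mult.commute)
    qed
  qed
  also have "\<dots> \<longleftrightarrow> ((\<lambda>s. (f s - f t) /\<^sub>R (s - t)) \<longlongrightarrow> D) (at t within S)"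
    by (simp only: tendsto_norm_zero_iff LIM_zero_iff)
  finally show ?thesis .
qed

section \<open>A primitive of the form \<open>p dx\<close> on the spectral curve\<close>

definition potential :: "complex \<Rightarrow> complex" where
  "potential p = 3 * p^2 / 2 - 3 * p^4 / 4"

text \<open>On the curve \<open>x = 3 * p - p^3\<close>, so
  \<open>p dx = 3 * p * (1 - p^2) dp\<close>, and increments of both \<open>x\<close> and the
  potential are polynomials in the increment \<open>e\<close> of the sheet. The last hypothesis
  excludes a jump to another sheet over the same point, the only way to have \<open>y = x\<close>
  with \<open>e\<close> nonzero.\<close>

lemma potential_difference_quotient:
  fixes p x e y :: complex
  assumes "p \<in> sheets x" "p + e \<in> sheets y"
    and "e * (3 * (1 - p^2) - 3 * p * e - e^2) = 0 \<Longrightarrow> e = 0"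
  shows "potential (p + e) - potential p =
    (p + e * ((3/2) * (1 - p^2) - 2 * p * e - (3/4) * e^2) / (3 * (1 - p^2) - 3 * p * e - e^2))
      * (y - x)"
proof -
  have x: "x = 3 * p - p^3" and y: "y = 3 * (p + e) - (p + e)^3"
    using assms by (auto simp: sheets_def algebra_simps eq_neg_iff_add_eq_0)
  define d where "d = 3 * (1 - p^2) - 3 * p * e - e^2"
  define n where "n = (3/2) * (1 - p^2) - 2 * p * e - (3/4) * e^2"
  have yx: "y - x = e * d" unfolding x y d_def
    by (simp add: algebra_simps power2_eq_square power3_eq_cube)
  have pot: "potential (p + e) - potential p = p * (e * d) + e * e * n"
    unfolding potential_def d_def n_def
    by (simp add: field_simps power2_eq_square power4_eq_xxxx)
  show ?thesis
  proof (cases "e = 0")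
    case False
    then have "d \<noteq> 0" using assms(3) unfolding d_def by auto
    then show ?thesis unfolding d_def[symmetric] n_def[symmetric] yx pot
      by (simp add: field_simps)
  qed (simp add: yx pot)
qed

text \<open>
  At a branch point the sheet is not differentiable, but \<open>p dx\<close> still is the differential of
  the potential, because \<open>e\<close> tends to 0 while the fraction multiplying it stays bounded.
\<close>

lemma potential_has_vector_derivative:
  fixes \<gamma> p :: "real \<Rightarrow> complex"
  assumes \<gamma>: "(\<gamma> has_vector_derivative \<gamma>') (at t within S)"
    and p: "continuous (at t within S) p"
    and sh: "\<And>s. s \<in> S \<Longrightarrow> p s \<in> sheets (\<gamma> s)" and t: "t \<in> S"
  shows "((\<lambda>s. potential (p s)) has_vector_derivative p t * \<gamma>') (at t within S)"
proof -
  define e where "e = (\<lambda>s. p s - p t)"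
  define d where "d = (\<lambda>s. 3 * (1 - (p t)^2) - 3 * p t * e s - (e s)^2)"
  define n where "n = (\<lambda>s. (3/2) * (1 - (p t)^2) - 2 * p t * e s - (3/4) * (e s)^2)"
  have e0: "(e \<longlongrightarrow> 0) (at t within S)"
    using p unfolding e_def continuous_within by (simp add: LIM_zero)
  have dn: "(\<forall>\<^sub>F s in at t within S. e s * d s = 0 \<longrightarrow> e s = 0) \<and>
     ((\<lambda>s. e s * n s / d s) \<longlongrightarrow> 0) (at t within S)"
  proof (cases "(p t)^2 = 1")
    case False
    have dl: "(d \<longlongrightarrow> 3 * (1 - (p t)^2)) (at t within S)"
      unfolding d_def by (auto intro!: tendsto_eq_intros e0)
    then have "\<forall>\<^sub>F s in at t within S. d s \<noteq> 0"
      using False by (intro tendsto_imp_eventually_ne[where c = "3 * (1 - (p t)^2)"]) auto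
    moreover have "((\<lambda>s. e s * n s / d s) \<longlongrightarrow> 0) (at t within S)"
      using False unfolding n_def
      by (auto intro!: tendsto_eq_intros e0 dl)
    ultimately show ?thesis by (auto elim: eventually_mono)
  next
    case True
    \<comment> \<open>At \<open>p t = 1\<close> or \<open>p t = -1\<close>, where sheets meet, both
      polynomials \<open>d\<close> and \<open>n\<close> acquire a factor \<open>e\<close>. It
      cancels in \<open>n / d\<close>, whose denominator then tends to \<open>3 * p t\<close>, which
      is not 0.\<close>
    define d' where "d' = (\<lambda>s. 3 * p t + e s)"
    have ds: "d s = - (e s * d' s)" and ns: "n s = - (e s * (2 * p t + (3/4) * e s))" for s
      unfolding d_def n_def d'_def True by (auto simp: algebra_simps power2_eq_square)
    have pt: "p t \<noteq> 0" using True by auto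
    have dl: "(d' \<longlongrightarrow> 3 * p t) (at t within S)"
      unfolding d'_def by (auto intro!: tendsto_eq_intros e0)
    then have ev: "\<forall>\<^sub>F s in at t within S. d' s \<noteq> 0"
      using pt by (intro tendsto_imp_eventually_ne[where c = "3 * p t"]) auto
    have "((\<lambda>s. e s * (2 * p t + (3/4) * e s) / d' s) \<longlongrightarrow> 0) (at t within S)"
      using pt by (auto intro!: tendsto_eq_intros e0 dl)
    moreover have "e s * n s / d s = e s * (2 * p t + (3/4) * e s) / d' s" for s
      unfolding ds ns by (cases "e s = 0") auto
    ultimately have "((\<lambda>s. e s * n s / d s) \<longlongrightarrow> 0) (at t within S)" by simp
    then show ?thesis using ev by (auto elim!: eventually_mono simp: ds)
  qed
  have "((\<lambda>s. (p t + e s * n s / d s) * ((\<gamma> s - \<gamma> t) /\<^sub>R (s - t))) \<longlongrightarrow> p t * \<gamma>') (at t within S)"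
    using tendsto_mult[OF tendsto_add[OF tendsto_const conjunct2[OF dn], of "p t"]
        \<gamma>[unfolded has_vector_derivative_iff_tendsto]] by simp
  moreover have "\<forall>\<^sub>F s in at t within S. (p t + e s * n s / d s) * ((\<gamma> s - \<gamma> t) /\<^sub>R (s - t)) =
     (potential (p s) - potential (p t)) /\<^sub>R (s - t)"
  proof -
    have "\<forall>\<^sub>F s in at t within S. (e s * d s = 0 \<longrightarrow> e s = 0) \<and> s \<in> S"
      using dn by (auto simp: eventually_at_filter elim: eventually_mono)
    then show ?thesis
    proof (rule eventually_mono)
      fix s assume s: "(e s * d s = 0 \<longrightarrow> e s = 0) \<and> s \<in> S"
      have ps: "p s = p t + e s" by (simp add: e_def)
      have "potential (p s) - potential (p t) = (p t + e s * n s / d s) * (\<gamma> s - \<gamma> t)"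
        unfolding ps n_def d_def
        by (rule potential_difference_quotient)
          (use s sh[OF t] sh[of s] in \<open>auto simp: d_def ps[symmetric]\<close>)
      then show "(p t + e s * n s / d s) * ((\<gamma> s - \<gamma> t) /\<^sub>R (s - t)) =
        (potential (p s) - potential (p t)) /\<^sub>R (s - t)" by simp
    qed
  qed
  ultimately show ?thesis
    unfolding has_vector_derivative_iff_tendsto by (rule Lim_transform_eventually)
qed

text \<open>The potential along \<open>p\<close> is continuous, and differentiable off the finitely
  many corners of \<open>\<gamma>\<close> even where the path meets a branch point, so the
  fundamental theorem of calculus applies with a finite exceptional set.\<close>

lemma integral_along_sheet:
  fixes \<gamma> p :: "real \<Rightarrow> complex"
  assumes \<gamma>: "\<gamma> piecewise_C1_differentiable_on {0..T}" and p: "continuous_on {0..T} p"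
    and sh: "\<And>s. s \<in> {0..T} \<Longrightarrow> p s \<in> sheets (\<gamma> s)" and "0 \<le> T"
  shows "((\<lambda>s. p s * vector_derivative \<gamma> (at s)) has_integral
           (potential (p T) - potential (p 0))) {0..T}"
proof -
  obtain S where S: "finite S" "\<gamma> C1_differentiable_on ({0..T} - S)"
    using \<gamma> by (auto simp: piecewise_C1_differentiable_on_def)
  show ?thesis
  proof (rule fundamental_theorem_of_calculus_interior_strong[OF S(1) \<open>0 \<le> T\<close>])
    fix s assume s: "s \<in> {0<..<T} - S"
    then have "(\<gamma> has_vector_derivative vector_derivative \<gamma> (at s)) (at s)"
      using S(2) by (auto simp: C1_differentiable_on_eq vector_derivative_works)
    then have "(\<gamma> has_vector_derivative vector_derivative \<gamma> (at s)) (at s within {0<..<T})"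
      by (rule has_vector_derivative_at_within)
    moreover have "continuous (at s within {0<..<T}) p"
      using continuous_on_subset[OF p, of "{0<..<T}"] s
      unfolding continuous_on_eq_continuous_within by fastforce
    ultimately have "((\<lambda>s. potential (p s)) has_vector_derivative
       p s * vector_derivative \<gamma> (at s)) (at s within {0<..<T})"
      by (rule potential_has_vector_derivative) (use s sh in auto)
    then show "((\<lambda>s. potential (p s)) has_vector_derivative
       p s * vector_derivative \<gamma> (at s)) (at s)"
      using s by (simp add: at_within_open[OF _ open_greaterThanLessThan])
  next
    show "continuous_on {0..T} (\<lambda>s. potential (p s))"
      unfolding potential_def by (intro continuous_intros p) auto
  qed
qed

section \<open>The algebraic form of the trajectory condition\<close>

lemma sheets_distinct:
  assumes "p \<in> sheets x" "q \<in> sheets x" "p \<noteq> q"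
  shows "p^2 + p * q + q^2 = 3"
proof -
  have "(p - q) * (p^2 + p * q + q^2 - 3) = 0"
  proof -
    have "(p - q) * (p^2 + p * q + q^2 - 3) = (p^3 - 3 * p + x) - (q^3 - 3 * q + x)"
      by (simp add: algebra_simps power2_eq_square power3_eq_cube)
    also have "\<dots> = 0" using assms(1,2) by (simp only: sheets_def mem_Collect_eq diff_self)
    finally show ?thesis .
  qed
  then show ?thesis using assms(3) by simp
qed

text \<open>The difference has the factor \<open>p^2 - q^2\<close>; the conic relation turns the
  remaining factor \<open>3 * (2 - (p^2 + q^2))\<close> into \<open>- (p - q)^2\<close>.\<close>

lemma potential_difference:
  assumes "p^2 + p * q + q^2 = 3"
  shows "potential p - potential q = - ((p + q) * (p - q)^3 / 4)"
proof -
  have pq: "p^2 + q^2 = 3 - p * q" using assms by (simp add: algebra_simps)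
  have "potential p - potential q = (p + q) * (p - q) * (3 * (2 - (p^2 + q^2))) / 4"
    unfolding potential_def by (simp add: field_simps power2_eq_square power4_eq_xxxx)
  also have "3 * (2 - (p^2 + q^2)) = - ((p - q)^2)"
    using pq by (simp add: power2_diff)
  finally show ?thesis by (simp add: power2_eq_square power3_eq_cube)
qed

text \<open>At the starting point the two sheets may coincide, and the factor \<open>p - q\<close>
  cannot be cancelled there. The relation reaches \<open>t = 0\<close> by continuity from positive
  times.\<close>

lemma sheets_pair_relation:
  fixes \<gamma> p q :: "real \<Rightarrow> complex"
  assumes "continuous_on {0..} p" "continuous_on {0..} q"
    and "\<And>t. t \<ge> 0 \<Longrightarrow> p t \<in> sheets (\<gamma> t) \<and> q t \<in> sheets (\<gamma> t)"
    and "\<And>t. t > 0 \<Longrightarrow> p t \<noteq> q t" and "t \<ge> 0"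
  shows "(p t)^2 + p t * q t + (q t)^2 = 3"
proof -
  have "closure {0<..} = {0::real..}" by (rule closure_greaterThan)
  then have "continuous_on (closure {0<..}) (\<lambda>t. (p t)^2 + p t * q t + (q t)^2)"
    by (simp add: continuous_intros assms(1,2))
  moreover have "t \<in> closure {0<..}" using \<open>t \<ge> 0\<close> by (simp add: closure_greaterThan)
  moreover have "(p s)^2 + p s * q s + (q s)^2 = 3" if "s \<in> {0<..}" for s
    using that assms(3)[of s] assms(4)[of s] by (auto intro: sheets_distinct)
  ultimately show ?thesis
    by (intro continuous_constant_on_closure[of "{0<..}" "\<lambda>t. (p t)^2 + p t * q t + (q t)^2" 3 t])
qed

text \<open>Since \<open>p 0 = q 0\<close>, the potentials at the branch point cancel, and the
  integral is the difference of the two potentials at time \<open>t\<close>. The condition thereby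
  becomes one on the pair of sheets alone.\<close>

lemma spectral_trajectory_iff:
  "spectral_trajectory b \<gamma> \<longleftrightarrow>
     \<gamma> 0 = b \<and> (\<forall>T\<ge>0. \<gamma> piecewise_C1_differentiable_on {0..T}) \<and>
     (\<exists>p q. continuous_on {0..} p \<and> continuous_on {0..} q \<and>
        (\<forall>t\<ge>0. p t \<in> sheets (\<gamma> t) \<and> q t \<in> sheets (\<gamma> t)) \<and>
        p 0 = q 0 \<and> (\<forall>t>0. p t \<noteq> q t) \<and>
        (\<forall>t\<ge>0. Re ((p t + q t) * (p t - q t)^3) = 0))"
proof -
  have "Re (integral {0..t} (\<lambda>s. (p s - q s) * vector_derivative \<gamma> (at s))) = 0 \<longleftrightarrow>
      Re ((p t + q t) * (p t - q t)^3) = 0"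
    if \<gamma>: "\<forall>T\<ge>0. \<gamma> piecewise_C1_differentiable_on {0..T}"
      and p: "continuous_on {0..} p" and q: "continuous_on {0..} q"
      and sh: "\<forall>t\<ge>0. p t \<in> sheets (\<gamma> t) \<and> q t \<in> sheets (\<gamma> t)"
      and "p 0 = q 0" "\<forall>t>0. p t \<noteq> q t" and t: "t \<ge> 0" for p q :: "real \<Rightarrow> complex" and t
  proof -
    have "((\<lambda>s. p s * vector_derivative \<gamma> (at s) - q s * vector_derivative \<gamma> (at s)) has_integral
       (potential (p t) - potential (p 0)) - (potential (q t) - potential (q 0))) {0..t}"
      by (intro has_integral_diff integral_along_sheet)
        (use \<gamma> sh t continuous_on_subset[OF p] continuous_on_subset[OF q] in auto)
    moreover have "(p t)^2 + p t * q t + (q t)^2 = 3"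
      using sheets_pair_relation[OF p q, of \<gamma> t] that by blast
    ultimately have "((\<lambda>s. (p s - q s) * vector_derivative \<gamma> (at s)) has_integral
       - ((p t + q t) * (p t - q t)^3 / 4)) {0..t}"
      using potential_difference[of "p t" "q t"] \<open>p 0 = q 0\<close> by (simp add: left_diff_distrib)
    then have "integral {0..t} (\<lambda>s. (p s - q s) * vector_derivative \<gamma> (at s)) =
       - ((p t + q t) * (p t - q t)^3 / 4)" by (simp add: integral_unique)
    then show ?thesis by (simp only: uminus_complex.sel Re_divide_numeral)
        (simp del: times_complex.sel)
  qed
  then show ?thesis
    unfolding spectral_trajectory_def
    by (intro conj_cong refl ex_cong1 all_cong1 imp_cong) blast
qed

section \<open>The symmetry exchanging the two branch points\<close>

lemma sheets_uminus: "- p \<in> sheets (- x) \<longleftrightarrow> p \<in> sheets x"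
proof -
  have "(- p)^3 - 3 * (- p) + (- x) = - (p^3 - 3 * p + x)" by (simp add: algebra_simps)
  then show ?thesis unfolding sheets_def mem_Collect_eq by (metis neg_equal_0_iff_equal)
qed

lemma piecewise_C1_uminus:
  assumes "\<gamma> piecewise_C1_differentiable_on S"
  shows "(\<lambda>t. - \<gamma> t :: complex) piecewise_C1_differentiable_on S"
  using piecewise_C1_differentiable_diff[OF piecewise_C1_differentiable_const[of 0 S] assms]
  by (simp)

text \<open>Negating \<open>x\<close> and \<open>p\<close> together preserves the curve, and the
  quartic in the trajectory condition is even.\<close>

lemma spectral_trajectory_uminus:
  assumes "spectral_trajectory b \<gamma>"
  shows "spectral_trajectory (- b) (\<lambda>t. - \<gamma> t)"
proof -
  obtain p q where pq: "continuous_on {0..} p" "continuous_on {0..} q"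
    "\<forall>t\<ge>0. p t \<in> sheets (\<gamma> t) \<and> q t \<in> sheets (\<gamma> t)"
    "p 0 = q 0" "\<forall>t>0. p t \<noteq> q t" "\<forall>t\<ge>0. Re ((p t + q t) * (p t - q t)^3) = 0"
    using assms unfolding spectral_trajectory_iff by blast
  have eq: "(- p + - q) * (- p - - q)^3 = (p + q) * (p - q)^3" for p q :: complex
    by (simp add: algebra_simps power3_eq_cube)
  show ?thesis unfolding spectral_trajectory_iff
  proof (rule conjI, use assms in \<open>simp add: spectral_trajectory_iff\<close>, rule conjI,
      use assms in \<open>simp add: spectral_trajectory_iff piecewise_C1_uminus\<close>,
      rule exI[of _ "\<lambda>t. - p t"], rule exI[of _ "\<lambda>t. - q t"], intro conjI)
    show "continuous_on {0..} (\<lambda>t. - p t)" "continuous_on {0..} (\<lambda>t. - q t)"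
      using pq by (auto intro: continuous_intros)
    show "\<forall>t\<ge>0. Re ((- p t + - q t) * (- p t - - q t)^3) = 0"
      unfolding eq using pq by blast
  qed (use pq in \<open>auto simp: sheets_uminus\<close>)
qed

lemma trajectory_images_uminus: "trajectory_images (- b) = (`) uminus ` trajectory_images b"
proof -
  have "uminus ` K \<in> trajectory_images (- b)" if "K \<in> trajectory_images b" for b K
    using that spectral_trajectory_uminus unfolding trajectory_images_def
    by (force simp: image_image)
  moreover have "uminus ` uminus ` K = K" for K :: "complex set" by (simp add: image_image)
  ultimately show ?thesis
    by (metis (no_types, lifting) image_eqI image_subsetI minus_minus subsetI subset_antisym)
qed

lemma spectral_curves_uminus: "spectral_curves (- b) = (`) uminus ` spectral_curves b"
proof -
  have inv: "uminus ` uminus ` K = K" for K :: "complex set" by (simp add: image_image)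
  have sub: "uminus ` K \<subseteq> uminus ` K' \<longleftrightarrow> K \<subseteq> K'" for K K' :: "complex set"
    by (simp add: inj_image_subset_iff)
  have eq: "uminus ` K = uminus ` K' \<longleftrightarrow> K = K'" for K K' :: "complex set"
    by (simp add: inj_image_eq_iff)
  have "{K \<in> f ` T. \<forall>K' \<in> f ` T. K \<subseteq> K' \<longrightarrow> K' = K} =
      f ` {K \<in> T. \<forall>K' \<in> T. K \<subseteq> K' \<longrightarrow> K' = K}"
    if "\<And>K K'. f K \<subseteq> f K' \<longleftrightarrow> K \<subseteq> K'" "\<And>K K'. f K = f K' \<longleftrightarrow> K = K'"
    for f :: "complex set \<Rightarrow> complex set" and T :: "complex set set"
    using that by auto
  from this[OF sub eq] show ?thesis unfolding spectral_curves_def trajectory_images_uminus .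
qed

text \<open>
  Over \<open>x = 2 cos 3v\<close> two of the sheets are \<open>2 cos (v \<plusminus> pi/3)\<close>, and the trajectory condition
  becomes \<open>Re (sin v ^ 3 * cos v) = 0\<close>.  For \<open>v = a + i b\<close> this says that \<open>sin (2 a) = 0\<close> or that
  \<open>cos (2 a) = cosh (2 b) / cosh (4 b)\<close>.  The next function solves the latter equation for \<open>a\<close>;
  it is written with \<open>arcsin\<close> because this branch is odd and smooth at \<open>b = 0\<close>.
\<close>

definition level_angle :: "real \<Rightarrow> real" where
  "level_angle b = arcsin (sinh b *
     sqrt ((4 * (sinh b)^2 + 3) / (8 * (sinh b)^4 + 8 * (sinh b)^2 + 1)))"

text \<open>For \<open>d = sinh b\<close> this is \<open>cosh (4 * b)\<close>, while
  \<open>d^2 * (4 * d^2 + 3)\<close> is \<open>(cosh (4 * b) - cosh (2 * b)) / 2\<close>. The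
  radicand in \<open>level_angle\<close>, times \<open>(sinh b)^2\<close>, is therefore
  \<open>(1 - cos (2 * a)) / 2\<close>, that is \<open>(sin a)^2\<close>.\<close>

lemma level_denominator_pos: "8 * d^4 + 8 * d^2 + 1 > (0::real)"
proof -
  have "d^4 \<ge> 0" "d^2 \<ge> 0" by simp_all
  then show ?thesis by linarith
qed

text \<open>The numerator \<open>4 * d^4 + 3 * d^2\<close> stays below half of the denominator. The
  bound 1/2 is the limit for large \<open>d\<close>; it yields the bound pi/4 for
  \<open>level_angle\<close>.\<close>

lemma level_argument_less:
  fixes d :: real
  shows "(d * sqrt ((4 * d^2 + 3) / (8 * d^4 + 8 * d^2 + 1)))^2 < 1 / 2"
proof -
  have "(d * sqrt ((4 * d^2 + 3) / (8 * d^4 + 8 * d^2 + 1)))^2 =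
      d^2 * ((4 * d^2 + 3) / (8 * d^4 + 8 * d^2 + 1))"
    using level_denominator_pos[of d] by (simp add: power_mult_distrib)
  also have "\<dots> = (4 * d^4 + 3 * d^2) / (8 * d^4 + 8 * d^2 + 1)"
    by (simp add: distrib_left power4_eq_xxxx power2_eq_square)
  also have "\<dots> < 1 / 2"
  proof -
    have "d^2 \<ge> 0" by simp
    then have "4 * d^4 + 3 * d^2 < 1 / 2 * (8 * d^4 + 8 * d^2 + 1)"
      unfolding distrib_left by linarith
    then show ?thesis using level_denominator_pos[of d] by (subst pos_divide_less_eq)
  qed
  finally show ?thesis .
qed

lemma level_argument_abs_less:
  fixes d :: real
  shows "\<bar>d * sqrt ((4 * d^2 + 3) / (8 * d^4 + 8 * d^2 + 1))\<bar> < sqrt 2 / 2"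
proof (rule power2_less_imp_less)
  show "\<bar>d * sqrt ((4 * d^2 + 3) / (8 * d^4 + 8 * d^2 + 1))\<bar>^2 < (sqrt 2 / 2)^2"
    using level_argument_less[of d] by (simp add: power_divide)
qed simp

lemma sqrt2_half_less_1: "sqrt 2 / 2 < (1::real)"
  by (simp add: real_less_lsqrt)

lemma sin_level_angle:
  "sin (level_angle b) = sinh b *
     sqrt ((4 * (sinh b)^2 + 3) / (8 * (sinh b)^4 + 8 * (sinh b)^2 + 1))"
  unfolding level_angle_def
  using level_argument_abs_less[of "sinh b"] sqrt2_half_less_1 by (intro sin_arcsin) linarith+

lemma sin_level_angle_squared:
  "(sin (level_angle b))^2 * (8 * (sinh b)^4 + 8 * (sinh b)^2 + 1) =
     (sinh b)^2 * (4 * (sinh b)^2 + 3)"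
  using level_denominator_pos[of "sinh b"] by (simp add: sin_level_angle power_mult_distrib)

lemma level_angle_bounds: "\<bar>level_angle b\<bar> < pi / 4"
proof -
  have *: "arcsin (sqrt 2 / 2) = pi / 4"
    using arcsin_sin[of "pi / 4"] by (simp add: sin_45)
  have "level_angle b < arcsin (sqrt 2 / 2)" "arcsin (- (sqrt 2 / 2)) < level_angle b"
    unfolding level_angle_def
    using level_argument_abs_less[of "sinh b"] sqrt2_half_less_1
    by (auto intro!: arcsin_less_arcsin)
  moreover have "arcsin (- (sqrt 2 / 2)) = - arcsin (sqrt 2 / 2)"
    using sqrt2_half_less_1 by (intro arcsin_minus order.trans[of "- 1" 0 "sqrt 2 / 2"]) simp_all
  ultimately show ?thesis using * by linarith
qed

lemma level_angle_0 [simp]: "level_angle 0 = 0"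
  by (simp add: level_angle_def)

lemma level_angle_minus [simp]: "level_angle (- b) = - level_angle b"
  using level_argument_abs_less[of "sinh b"] sqrt2_half_less_1
  by (simp add: level_angle_def arcsin_minus)

lemma level_angle_pos: assumes "b > 0" shows "level_angle b > 0"
proof -
  have "sin (level_angle b) > 0"
    unfolding sin_level_angle using assms level_denominator_pos[of "sinh b"]
    by (intro mult_pos_pos) (auto intro!: divide_pos_pos add_nonneg_pos)
  then show ?thesis
    using level_angle_bounds[of b] sin_ge_zero[of "- level_angle b"] pi_gt_zero
    by (cases "level_angle b > 0") (auto )
qed

lemma level_angle_eq_0_iff [simp]: "level_angle b = 0 \<longleftrightarrow> b = 0"
  using level_angle_pos[of b] level_angle_pos[of "- b"] by (cases b "0::real" rule: linorder_cases) auto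

lemma level_angle_abs: "level_angle \<bar>b\<bar> = \<bar>level_angle b\<bar>"
  using level_angle_pos[of b] level_angle_pos[of "- b"] by (cases b "0::real" rule: linorder_cases) auto

text \<open>With \<open>sinh\<close> pulled out of the root the radicand is positive everywhere, and
  the argument of \<open>arcsin\<close> stays off 1 and -1, so nothing singular occurs. This is what
  makes the level curves admissible as C1 paths.\<close>

lemma level_angle_has_continuous_derivative:
  obtains L where "\<And>t. (level_angle has_real_derivative L t) (at t)" "continuous_on UNIV L"
proof -
  define w where "w = (\<lambda>t::real. sinh t *
     sqrt ((4 * (sinh t)^2 + 3) / (8 * (sinh t)^4 + 8 * (sinh t)^2 + 1)))"
  define n d :: "real \<Rightarrow> real" where "n = (\<lambda>t. 4 * (sinh t)^2 + 3)"
    and "d = (\<lambda>t. 8 * (sinh t)^4 + 8 * (sinh t)^2 + 1)"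
  define n' d' :: "real \<Rightarrow> real" where "n' = (\<lambda>t. 8 * sinh t * cosh t)"
    and "d' = (\<lambda>t. 32 * (sinh t)^3 * cosh t + 16 * sinh t * cosh t)"
  define w' where "w' = (\<lambda>t. cosh t * sqrt (n t / d t) +
     sinh t * ((n' t * d t - n t * d' t) / (d t * d t) * (inverse (sqrt (n t / d t)) / 2)))"
  have d: "d t > 0" for t using level_denominator_pos[of "sinh t"] by (simp add: d_def)
  have n: "n t > 0" for t by (simp add: n_def add_nonneg_pos)
  have dn: "n t / d t > 0" for t using d n by simp
  have Dn: "(n has_real_derivative n' t) (at t)" for t
    unfolding n_def n'_def by (auto intro!: derivative_eq_intros)
  have Dd: "(d has_real_derivative d' t) (at t)" for t
    unfolding d_def d'_def by (auto intro!: derivative_eq_intros)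
  have Dw: "(w has_real_derivative w' t) (at t)" for t
  proof -
    have "((\<lambda>t. n t / d t) has_real_derivative (n' t * d t - n t * d' t) / (d t * d t)) (at t)"
      using d[of t] by (intro DERIV_divide Dn Dd) auto
    from DERIV_chain2[where f = sqrt, OF DERIV_real_sqrt[OF dn[of t]] this]
    have "((\<lambda>t. sqrt (n t / d t)) has_real_derivative
        (n' t * d t - n t * d' t) / (d t * d t) * (inverse (sqrt (n t / d t)) / 2)) (at t)"
      by (simp only: mult.commute)
    moreover have "((\<lambda>t. sinh t * r t) has_real_derivative cosh t * r t + sinh t * r') (at t)"
      if "(r has_real_derivative r') (at t)" for r r'
      using that by (auto intro!: derivative_eq_intros)
    ultimately have "((\<lambda>t. sinh t * sqrt (n t / d t)) has_real_derivative w' t) (at t)"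
      unfolding w'_def by blast
    then show ?thesis by (simp add: w_def n_def d_def)
  qed
  have w1: "-1 < w t" "w t < 1" for t
    using level_argument_abs_less[of "sinh t"] sqrt2_half_less_1 unfolding w_def by linarith+
  have la: "level_angle = (\<lambda>t. arcsin (w t))" by (simp add: level_angle_def w_def fun_eq_iff)
  show ?thesis
  proof
    fix t
    show "(level_angle has_real_derivative inverse (sqrt (1 - (w t)^2)) * w' t) (at t)"
      unfolding la by (rule DERIV_chain2[OF DERIV_arcsin Dw]) (use w1[of t] in auto)
  next
    have "continuous_on UNIV w" "continuous_on UNIV n" "continuous_on UNIV d"
      using Dw Dn Dd by (auto intro!: DERIV_continuous_on)
    moreover have "(w t)^2 < 1" for t
      using w1[of t] by (simp add: abs_square_less_1 abs_less_iff)
    ultimately show "continuous_on UNIV (\<lambda>t. inverse (sqrt (1 - (w t)^2)) * w' t)"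
      unfolding w'_def n'_def d'_def using d n
      by (intro continuous_intros) (auto simp: less_imp_neq[symmetric] order.strict_implies_order
        intro: less_imp_neq)
  qed
qed

lemma continuous_on_level_angle [continuous_intros]:
  assumes "continuous_on S f" shows "continuous_on S (\<lambda>x. level_angle (f x))"
proof -
  obtain L where "\<And>t. (level_angle has_real_derivative L t) (at t)"
    using level_angle_has_continuous_derivative by blast
  then have "continuous_on UNIV level_angle" by (intro DERIV_continuous_on)
  then show ?thesis using assms by (rule continuous_on_compose2) auto
qed

section \<open>The level set in the angle coordinate\<close>

lemma Complex_has_vector_derivative:
  assumes "(a has_real_derivative a') (at t)" "(b has_real_derivative b') (at t)"
  shows "((\<lambda>t. Complex (a t) (b t)) has_vector_derivative Complex a' b') (at t)"
  unfolding Complex_eq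
  by (intro has_vector_derivative_add has_vector_derivative_mult_right
      has_vector_derivative_of_real assms)

lemma sin_cos_Complex:
  "sin (Complex a b) = Complex (sin a * cosh b) (cos a * sinh b)"
  "cos (Complex a b) = Complex (cos a * cosh b) (- (sin a * sinh b))"
  by (auto simp: complex_eq_iff Re_sin Im_sin Re_cos Im_cos cosh_def sinh_def algebra_simps
      diff_divide_distrib add_divide_distrib)

lemma sin_eq_0_imp_Im_eq_0:
  assumes "sin z = (0::complex)" shows "Im z = 0"
proof -
  have "Complex (sin (Re z) * cosh (Im z)) (cos (Re z) * sinh (Im z)) = 0"
    using assms sin_cos_Complex(1)[of "Re z" "Im z"] by simp
  then have "sin (Re z) = 0" "cos (Re z) * sinh (Im z) = 0" by (simp_all add: complex_eq_iff)
  then show ?thesis using sin_zero_abs_cos_one[of "Re z"] by auto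
qed

lemma level_function:
  "Re ((sin (Complex a b))^3 * cos (Complex a b)) = sin a * cos a *
     ((sin a)^2 * (8 * (sinh b)^4 + 8 * (sinh b)^2 + 1) - (sinh b)^2 * (4 * (sinh b)^2 + 3))"
proof -
  define S K C D where "S = sin a" and "K = cos a" and "C = cosh b" and "D = sinh b"
  have K: "K^2 = 1 - S^2" unfolding S_def K_def by (simp add: cos_squared_eq)
  have C: "C^2 = 1 + D^2" unfolding C_def D_def by (simp add: cosh_square_eq)
  have "Re ((Complex (S * C) (K * D))^3 * Complex (K * C) (- (S * D))) =
     S * K * (S^2 * (C^2)^2 - 3 * K^2 * D^2 * C^2 + 3 * S^2 * C^2 * D^2 - K^2 * (D^2)^2)"
    by (simp add: power3_eq_cube power2_eq_square algebra_simps)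
  also have "\<dots> = S * K * (S^2 * (8 * D^4 + 8 * D^2 + 1) - D^2 * (4 * D^2 + 3))"
    unfolding K C by (simp add: power4_eq_xxxx power2_eq_square algebra_simps)
  finally show ?thesis unfolding sin_cos_Complex S_def K_def C_def D_def .
qed

text \<open>By \<open>sin_level_angle_squared\<close>, the last factor in
  \<open>level_function\<close> is a positive number times the difference of the two squared
  sines.\<close>

lemma level_set:
  assumes "Re ((sin v)^3 * cos v) = 0"
  shows "sin (Re v) = 0 \<or> cos (Re v) = 0 \<or> (sin (Re v))^2 = (sin (level_angle (Im v)))^2"
proof -
  have "sin (Re v) * cos (Re v) *
     ((sin (Re v))^2 * (8 * (sinh (Im v))^4 + 8 * (sinh (Im v))^2 + 1)
        - (sinh (Im v))^2 * (4 * (sinh (Im v))^2 + 3)) = 0"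
    using assms level_function[of "Re v" "Im v"] by simp
  then show ?thesis
    using sin_level_angle_squared[of "Im v"] level_denominator_pos[of "sinh (Im v)"]
    by (metis (no_types, lifting) mult_eq_0_iff mult_right_cancel order_less_irrefl right_minus_eq)
qed

text \<open>A forbidden value for an intermediate value argument. The branch
  \<open>cos (Re v) = 0\<close> gives \<open>Re (cos v) = 0\<close>; on the other branches
  \<open>(cos (Re v))^2 > 1/2\<close>, and \<open>cosh\<close> is at least 1, so the square of
  \<open>Re (cos v)\<close> exceeds 1/2 and cannot be 1/4.\<close>

lemma level_set_Re_cos:
  assumes "Re ((sin v)^3 * cos v) = 0"
  shows "Re (cos v) \<noteq> 1 / 2"
proof
  assume half: "Re (cos v) = 1 / 2"
  have Rc: "Re (cos v) = cos (Re v) * cosh (Im v)"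
    using sin_cos_Complex(2)[of "Re v" "Im v"] by (simp del: Re_cos)
  have "(sin (Re v))^2 < 1 / 2"
    using level_set[OF assms]
  proof (elim disjE)
    assume "cos (Re v) = 0" then show ?thesis using half Rc by simp
  next
    assume "(sin (Re v))^2 = (sin (level_angle (Im v)))^2"
    then show ?thesis using level_argument_less by (simp add: sin_level_angle)
  qed simp
  then have c: "(cos (Re v))^2 > 1 / 2" by (simp add: cos_squared_eq)
  have "1 / 4 = (cos (Re v))^2 * (cosh (Im v))^2"
    using half Rc by (metis power_mult_distrib power_one_over power2_eq_square num_double numeral_times_numeral mult_2)
  moreover have "(cosh (Im v))^2 \<ge> 1" by (simp add: cosh_square_eq)
  ultimately show False using c mult_mono[of "1/2" "(cos (Re v))^2" 1 "(cosh (Im v))^2"] by simp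
qed

text \<open>For \<open>t \<ge> 0\<close> the values 0, -1 and 1 of \<open>\<sigma>\<close> give the
  real ray and the curves leaving 2 upward and downward.\<close>

definition level_curve :: "real \<Rightarrow> real \<Rightarrow> complex" where
  "level_curve \<sigma> t = 2 * cos (3 * Complex (\<sigma> * level_angle t) t)"

definition level_arc :: "real \<Rightarrow> complex set" where
  "level_arc \<sigma> = level_curve \<sigma> ` {0..}"

lemma level_curve_minus [simp]: "level_curve \<sigma> (- t) = level_curve \<sigma> t"
proof -
  have "3 * Complex (\<sigma> * level_angle (- t)) (- t) = - (3 * Complex (\<sigma> * level_angle t) t)"
    by (simp add: complex_eq_iff)
  then show ?thesis unfolding level_curve_def by (simp only: cos_minus)
qed

text \<open>Both signs of the parameter occur: exchanging the two sheets of a trajectory replaces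
  \<open>v\<close> by \<open>- v\<close>, hence changes the sign of \<open>Im v\<close>.\<close>

lemma level_curve_in_arc: "level_curve \<sigma> t \<in> level_arc \<sigma>"
proof (cases "t \<ge> 0")
  case False
  then have "level_curve \<sigma> (- t) \<in> level_arc \<sigma>" unfolding level_arc_def by (intro imageI) simp
  then show ?thesis by simp
qed (simp add: level_arc_def)

lemma Re_of_real_mult: "Re (complex_of_real r * z) = r * Re z"
  by simp

text \<open>This is the triple angle formula: \<open>p = 2 * cos u\<close> satisfies
  \<open>p^3 - 3 * p = 2 * cos (3 * u)\<close>.\<close>

lemma two_cos_in_sheets: "2 * cos u \<in> sheets (- 2 * cos (3 * u))"
  unfolding sheets_def cos_treble_cos by (simp add: power_mult_distrib)

lemma spectral_trajectory_level_curve: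
  assumes "\<sigma> \<in> {0, 1, -1}"
  shows "spectral_trajectory 2 (level_curve \<sigma>)"
  unfolding spectral_trajectory_iff
proof (intro conjI)
  define v where "v = (\<lambda>t. Complex (\<sigma> * level_angle t) t)"
  have lc: "level_curve \<sigma> t = 2 * cos (3 * v t)" for t by (simp add: level_curve_def v_def)
  have cv: "continuous_on UNIV v"
    unfolding v_def Complex_eq by (intro continuous_intros)
  obtain L where L: "\<And>t. (level_angle has_real_derivative L t) (at t)" "continuous_on UNIV L"
    by (rule level_angle_has_continuous_derivative) blast
  have "(level_curve \<sigma> has_vector_derivative
      (2 * (- sin (3 * v t) * (3 * Complex (\<sigma> * L t) 1)))) (at t)" for t
  proof -
    have "(v has_vector_derivative Complex (\<sigma> * L t) 1) (at t)"
      unfolding v_def by (intro Complex_has_vector_derivative) (auto intro!: derivative_eq_intros L)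
    then have "((\<lambda>t. 3 * v t) has_vector_derivative 3 * Complex (\<sigma> * L t) 1) (at t)"
      by (rule has_vector_derivative_mult_right)
    then have "((\<lambda>t. cos (3 * v t)) has_vector_derivative
        3 * Complex (\<sigma> * L t) 1 * (- sin (3 * v t))) (at t)"
      using field_vector_diff_chain_at[of "\<lambda>t. 3 * v t" _ t cos, OF _ DERIV_cos] by (simp add: o_def)
    then have "((\<lambda>t. 2 * cos (3 * v t)) has_vector_derivative
        2 * (3 * Complex (\<sigma> * L t) 1 * (- sin (3 * v t)))) (at t)"
      by (rule has_vector_derivative_mult_right)
    then show ?thesis by (simp add: level_curve_def[abs_def] v_def mult_ac)
  qed
  moreover have "continuous_on UNIV (\<lambda>t. 2 * (- sin (3 * v t) * (3 * Complex (\<sigma> * L t) 1)))"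
    unfolding Complex_eq by (intro continuous_intros cv L)
  ultimately have "level_curve \<sigma> C1_differentiable_on {0..T}" for T
    unfolding C1_differentiable_on_def
    by (intro exI[of _ "\<lambda>t. 2 * (- sin (3 * v t) * (3 * Complex (\<sigma> * L t) 1))"])
      (auto intro: continuous_on_subset)
  then show "\<forall>T\<ge>0. level_curve \<sigma> piecewise_C1_differentiable_on {0..T}"
    by (auto intro: C1_differentiable_imp_piecewise)
  show "level_curve \<sigma> 0 = 2" by (simp add: level_curve_def Complex_eq)
  \<comment> \<open>Shifting by pi/3 changes \<open>3 * u\<close> by pi and so corrects the sign in
    \<open>two_cos_in_sheets\<close>. Sum and difference are multiples of \<open>cos v\<close> and
    \<open>sin v\<close>, which makes the quartic a real multiple of
    \<open>(sin v)^3 * cos v\<close>.\<close>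
  define p q where "p = (\<lambda>t. 2 * cos (v t + pi / 3))" and "q = (\<lambda>t. 2 * cos (v t - pi / 3))"
  have c60: "cos (complex_of_real (pi / 3)) = 1 / 2" "sin (complex_of_real (pi / 3)) = sqrt 3 / 2"
    by (simp_all only: cos_of_real sin_of_real cos_60 sin_60) simp
  have sum: "p t + q t = 2 * cos (v t)" and diff: "p t - q t = - 2 * sqrt 3 * sin (v t)" for t
    unfolding p_def q_def cos_add cos_diff c60 by simp_all
  show "\<exists>p q. continuous_on {0..} p \<and> continuous_on {0..} q \<and>
        (\<forall>t\<ge>0. p t \<in> sheets (level_curve \<sigma> t) \<and> q t \<in> sheets (level_curve \<sigma> t)) \<and>
        p 0 = q 0 \<and> (\<forall>t>0. p t \<noteq> q t) \<and>
        (\<forall>t\<ge>0. Re ((p t + q t) * (p t - q t)^3) = 0)"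
  proof (rule exI[of _ p], rule exI[of _ q], intro conjI allI impI)
    show "continuous_on {0..} p" "continuous_on {0..} q"
      unfolding p_def q_def
      by (intro continuous_intros continuous_on_subset[OF cv] subset_UNIV)+
    have c3: "cos (3 * v t + pi) = - cos (3 * v t)" "cos (3 * v t - pi) = - cos (3 * v t)" for t
      by (simp_all only: cos_add cos_diff cos_of_real sin_of_real cos_pi sin_pi) simp_all
    show "p t \<in> sheets (level_curve \<sigma> t)" for t
      using two_cos_in_sheets[of "v t + pi / 3"] c3(1)[of t]
      by (simp add: p_def lc distrib_left)
    show "q t \<in> sheets (level_curve \<sigma> t)" for t
      using two_cos_in_sheets[of "v t - pi / 3"] c3(2)[of t]
      by (simp add: q_def lc right_diff_distrib)
    show "p 0 = q 0" using diff[of 0] by (simp add: v_def Complex_eq)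
    show "p t \<noteq> q t" if "t > 0" for t
    proof
      assume "p t = q t"
      then have "sin (v t) = 0" using diff[of t] by simp
      then have "Im (v t) = 0" by (rule sin_eq_0_imp_Im_eq_0)
      then show False using that by (simp add: v_def)
    qed
    show "Re ((p t + q t) * (p t - q t)^3) = 0" for t
    proof -
      have "Re ((sin (v t))^3 * cos (v t)) = 0"
      proof -
        have "sin (\<sigma> * level_angle t) = 0 \<or> (sin (\<sigma> * level_angle t))^2 = (sin (level_angle t))^2"
          using assms by auto
        then show ?thesis unfolding v_def level_function using sin_level_angle_squared[of t] by auto
      qed
      moreover have "(p t + q t) * (p t - q t)^3 =
          complex_of_real (- 16 * (sqrt 3)^3) * ((sin (v t))^3 * cos (v t))"
        unfolding sum diff by (simp add: power_mult_distrib)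
      ultimately show ?thesis by (simp only: Re_of_real_mult mult_zero_right)
    qed
  qed
qed

text \<open>The number \<open>c + \<i> * s\<close> has inverse \<open>c - \<i> * s\<close>, so its
  logarithm divided by \<open>\<i>\<close> is an angle. The principal branch is fixed in order that
  continuity along a path can be checked against its cut.\<close>

lemma angle_of_point_on_circle:
  assumes "c^2 + s^2 = (1::complex)"
  defines "v \<equiv> - \<i> * Ln (c + \<i> * s)"
  shows "cos v = c" "sin v = s" "- pi < Re v" "Re v \<le> pi"
proof -
  have prod: "(c + \<i> * s) * (c - \<i> * s) = 1"
    using assms(1) by (simp add: algebra_simps power2_eq_square)
  then have nz: "c + \<i> * s \<noteq> 0" by auto
  have e: "exp (\<i> * v) = c + \<i> * s" using nz by (simp add: v_def)
  then have e': "exp (- (\<i> * v)) = c - \<i> * s"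
    using prod nz by (simp add: exp_minus inverse_eq_divide field_simps)
  show "cos v = c" "sin v = s"
    by (simp_all add: cos_exp_eq sin_exp_eq e e')
  show "- pi < Re v" "Re v \<le> pi"
    using nz mpi_less_Im_Ln[of "c + \<i> * s"] Im_Ln_le_pi[of "c + \<i> * s"] by (auto simp: v_def)
qed

lemma sin_squared_eq_imp:
  assumes "(sin x)^2 = (sin y)^2" "\<bar>x\<bar> < pi / 2" "\<bar>y\<bar> < pi / 2"
  shows "x = y \<or> x = - (y::real)"
proof -
  have "sin x = sin y \<or> sin x = sin (- y)" using assms(1) by (simp add: power2_eq_iff)
  moreover have "- (pi / 2) \<le> x" "x \<le> pi / 2" "- (pi / 2) \<le> y" "y \<le> pi / 2"
    using assms(2,3) by linarith+
  ultimately show ?thesis using sin_inj_pi[of x y] sin_inj_pi[of x "- y"] by auto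
qed

text \<open>The pair of sheets determines an angle \<open>v\<close> whose real part is 0 or plus or
  minus \<open>level_angle (Im v)\<close>. The three branches meet only at \<open>v = 0\<close>,
  which is excluded after the start, so a path cannot change branch, although it may cover only part
  of an arc or run back.\<close>

lemma spectral_trajectory_in_level_arc:
  assumes "spectral_trajectory 2 \<gamma>"
  shows "\<exists>\<sigma>\<in>{0, 1, -1}. \<gamma> ` {0..} \<subseteq> level_arc \<sigma>"
proof -
  obtain p q where \<gamma>0: "\<gamma> 0 = 2"
    and cont: "continuous_on {0..} p" "continuous_on {0..} q"
    and sh: "\<And>t. t \<ge> 0 \<Longrightarrow> p t \<in> sheets (\<gamma> t) \<and> q t \<in> sheets (\<gamma> t)"
    and pq0: "p 0 = q 0" and pq: "\<And>t. t > 0 \<Longrightarrow> p t \<noteq> q t"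
    and level: "\<And>t. t \<ge> 0 \<Longrightarrow> Re ((p t + q t) * (p t - q t)^3) = 0"
    using assms unfolding spectral_trajectory_iff by blast
  have circ: "(p t)^2 + p t * q t + (q t)^2 = 3" if "t \<ge> 0" for t
    using sheets_pair_relation[OF cont sh pq that] by blast
  have \<gamma>: "\<gamma> t = p t * q t * (p t + q t)" if "t \<ge> 0" for t
  proof -
    have "(p t)^3 - 3 * p t + \<gamma> t = 0" using sh[OF that] by (simp add: sheets_def)
    then have "\<gamma> t = 3 * p t - (p t)^3" by (simp add: algebra_simps eq_neg_iff_add_eq_0)
    then show ?thesis unfolding circ[OF that, symmetric]
      by (simp add: algebra_simps power2_eq_square power3_eq_cube)
  qed
  \<comment> \<open>The inverse of \<open>p = 2 * cos (v + pi/3)\<close>,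
    \<open>q = 2 * cos (v - pi/3)\<close>: these are the future \<open>cos v\<close> and
    \<open>sin v\<close>.\<close>
  define c s where "c = (\<lambda>t. (p t + q t) / 2)" and "s = (\<lambda>t. (q t - p t) / (2 * sqrt 3))"
  have r3: "complex_of_real (sqrt 3) * complex_of_real (sqrt 3) = 3"
    by (simp flip: of_real_mult)
  have p_eq: "p t + q t = 2 * c t" and q_eq: "p t - q t = - (2 * sqrt 3 * s t)" for t
    by (simp_all add: c_def s_def)
  have cs: "(c t)^2 + (s t)^2 = 1" if "t \<ge> 0" for t
  proof -
    have "(c t)^2 + (s t)^2 = (p t + q t)^2 / 4 + (q t - p t)^2 / 12"
      by (simp add: c_def s_def power2_eq_square r3 mult.assoc mult.left_commute[of "complex_of_real (sqrt 3)"])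
    also have "\<dots> = ((p t)^2 + p t * q t + (q t)^2) / 3"
      by (simp add: field_simps power2_eq_square)
    finally show ?thesis using circ[OF that] by simp
  qed
  define v where "v = (\<lambda>t. - \<i> * Ln (c t + \<i> * s t))"
  have v: "cos (v t) = c t" "sin (v t) = s t" "- pi < Re (v t)" "Re (v t) \<le> pi" if "t \<ge> 0" for t
    using angle_of_point_on_circle[OF cs[OF that]] unfolding v_def by auto
  have lev: "Re ((sin (v t))^3 * cos (v t)) = 0" if "t \<ge> 0" for t
  proof -
    have "(p t + q t) * (p t - q t)^3 = complex_of_real (- 16 * (sqrt 3)^3) * ((s t)^3 * c t)"
      unfolding p_eq q_eq by (simp add: power_mult_distrib)
    then have "Re (complex_of_real (- 16 * (sqrt 3)^3) * ((s t)^3 * c t)) = 0"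
      using level[OF that] by simp
    then show ?thesis using v(1,2)[OF that] by (simp only: Re_of_real_mult) simp
  qed
  have cont_cs: "continuous_on {0..} c" "continuous_on {0..} s"
    unfolding c_def s_def by (auto intro!: continuous_intros cont)
  \<comment> \<open>The common initial sheet has square 1, and twice its cube is 2, so it is 1; the
    angle starts at 0 and not at pi.\<close>
  have c0: "c 0 = 1"
  proof -
    have "(p 0)^2 = 1" using circ[of 0] pq0 by (simp add: power2_eq_square)
    moreover have "2 * (p 0 * p 0^2) = 2" using \<gamma>[of 0] \<gamma>0 pq0 by (simp add: power2_eq_square)
    ultimately show ?thesis using pq0 by (simp add: c_def)
  qed
  \<comment> \<open>Starting from 1, a nonpositive value of \<open>Re (c t)\<close> would force the
    forbidden value 1/2 on the way.\<close>
  have Rec: "Re (c t) > 0" if t: "t \<ge> 0" for t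
  proof (rule ccontr)
    assume "\<not> Re (c t) > 0"
    then have "\<exists>x\<ge>0. x \<le> t \<and> Re (c x) = 1 / 2"
      using t c0
      by (intro IVT2') (auto intro!: continuous_intros continuous_on_subset[OF cont_cs(1)])
    then show False using level_set_Re_cos lev v(1) by metis
  qed
  have cosv: "cos (Re (v t)) > 0" if t: "t \<ge> 0" for t
  proof -
    have "Re (c t) = cos (Re (v t)) * cosh (Im (v t))"
      using v(1)[OF t] sin_cos_Complex(2)[of "Re (v t)" "Im (v t)"] by (metis complex.sel(1) complex_surj)
    then show ?thesis using Rec[OF t] cosh_real_pos[of "Im (v t)"] by (metis zero_less_mult_pos2)
  qed
  have Rev: "\<bar>Re (v t)\<bar> < pi / 2" if t: "t \<ge> 0" for t
  proof (rule ccontr)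
    assume "\<not> ?thesis"
    then have "cos \<bar>Re (v t)\<bar> \<le> 0"
      using v(3,4)[OF t] cos_monotone_0_pi_le[of "pi / 2" "\<bar>Re (v t)\<bar>"] by (auto simp: abs_le_iff)
    then show False using cosv[OF t] by simp
  qed
  have cases: "Re (v t) = 0 \<or> Re (v t) = level_angle (Im (v t)) \<or> Re (v t) = - level_angle (Im (v t))"
    if t: "t \<ge> 0" for t
    using level_set[OF lev[OF t]]
  proof (elim disjE)
    assume "sin (Re (v t)) = 0"
    then have "Re (v t) = 0" using sin_squared_eq_imp[of "Re (v t)" 0] Rev[OF t] by auto
    then show ?thesis by simp
  next
    assume "cos (Re (v t)) = 0" then show ?thesis using cosv[OF t] by simp
  next
    assume "(sin (Re (v t)))^2 = (sin (level_angle (Im (v t))))^2"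
    then show ?thesis
      using sin_squared_eq_imp Rev[OF t] level_angle_bounds[of "Im (v t)"] by fastforce
  qed
  \<comment> \<open>On each of the three branches \<open>Im v = 0\<close> leaves only
    \<open>v = 0\<close>, where the two sheets agree.\<close>
  have Imv: "Im (v t) \<noteq> 0" if t: "t > 0" for t
  proof
    assume "Im (v t) = 0"
    then have "v t = 0" using cases[of t] t by (auto simp: complex_eq_iff)
    then have "s t = 0" using v(2)[of t] t by simp
    then show False using pq[OF t] by (simp add: s_def)
  qed
  \<comment> \<open>A positive \<open>cos (Re v)\<close> keeps \<open>exp (\<i> * v)\<close> in the
    right half plane, away from the cut of the logarithm.\<close>
  have cont_v: "continuous_on {0..} v"
    unfolding v_def
  proof (intro continuous_intros cont_cs)
    fix t :: real assume t: "t \<in> {0..}"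
    have "c t + \<i> * s t = exp (\<i> * v t)"
      using v(1,2)[of t] t exp_Euler[of "v t"] by simp
    then have "Re (c t + \<i> * s t) > 0"
      using cosv[of t] t by (simp add: Re_exp)
    then show "c t + \<i> * s t \<notin> \<real>\<^sub>\<le>\<^sub>0" by (auto simp: complex_nonpos_Reals_iff)
  qed
  \<comment> \<open>The branch number: continuous for positive times, with values in a three-element
    set, hence constant.\<close>
  define k where "k = (\<lambda>t. Re (v t) / level_angle (Im (v t)))"
  have k: "k t \<in> {0, 1, -1}" if "t > 0" for t
    using cases[of t] Imv[of t] that by (auto simp: k_def)
  have "k constant_on {0<..}"
  proof (rule continuous_finite_range_constant)
    show "continuous_on {0<..} k"
      unfolding k_def using Imv
      by (intro continuous_intros continuous_on_subset[OF cont_v]) auto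
    have "k ` {0<..} \<subseteq> {0, 1, -1}" using k by (intro image_subsetI) simp
    then show "finite (k ` {0<..})" by (rule finite_subset) simp
  qed (simp add: convex_connected)
  then obtain \<sigma> where \<sigma>: "\<And>t. t > 0 \<Longrightarrow> k t = \<sigma>" by (auto simp: constant_on_def)
  have "\<sigma> \<in> {0, 1, -1}" using \<sigma>[of 1] k[of 1] by simp
  moreover have "\<gamma> t \<in> level_arc \<sigma>" if t: "t \<ge> 0" for t
  proof (cases "t = 0")
    case True
    have "level_curve \<sigma> 0 = 2" by (simp add: level_curve_def Complex_eq)
    then show ?thesis using level_curve_in_arc[of \<sigma> 0] \<gamma>0 True by simp
  next
    case False
    have "Complex (\<sigma> * level_angle (Im (v t))) (Im (v t)) = v t"
      using \<sigma>[of t] Imv[of t] t False by (simp add: k_def complex_eq_iff field_simps)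
    \<comment> \<open>The conic relation replaces the constant 3 in the triple angle formula by a
      quadratic form in the sheets, leaving \<open>p * q * (p + q)\<close>.\<close>
    moreover have "\<gamma> t = 2 * cos (3 * v t)"
    proof -
      have "2 * cos (3 * v t) = (2 * c t) * ((2 * c t)^2 - 3)"
        unfolding cos_treble_cos v(1)[OF t]
        by (simp add: algebra_simps power2_eq_square power3_eq_cube)
      also have "\<dots> = (p t + q t) * ((p t + q t)^2 - ((p t)^2 + p t * q t + (q t)^2))"
        using circ[OF t] p_eq by simp
      also have "\<dots> = \<gamma> t"
        unfolding \<gamma>[OF t] by (simp add: algebra_simps power2_eq_square)
      finally show ?thesis by simp
    qed
    ultimately show ?thesis using level_curve_in_arc[of \<sigma> "Im (v t)"]
      by (simp add: level_curve_def)
  qed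
  ultimately show ?thesis by auto
qed

lemma level_curve_coordinates:
  "level_curve \<sigma> t =
     Complex (2 * cos (3 * (\<sigma> * level_angle t)) * cosh (3 * t))
             (- 2 * sin (3 * (\<sigma> * level_angle t)) * sinh (3 * t))"
proof -
  have "3 * Complex a b = Complex (3 * a) (3 * b)" for a b by (simp add: complex_eq_iff)
  then show ?thesis unfolding level_curve_def by (simp only: sin_cos_Complex) (simp add: complex_eq_iff)
qed

text \<open>Away from the point 2 the imaginary part on an arc has sign \<open>- \<sigma>\<close>,
  so a single sample point at parameter 1 tells the arcs apart.\<close>

lemma level_arc_subset_imp_eq:
  assumes "level_arc \<sigma> \<subseteq> level_arc \<tau>" "\<sigma> \<in> {0, 1, -1}" "\<tau> \<in> {0, 1, -1}"
  shows "\<sigma> = \<tau>"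
proof -
  have sgn: "sgn (Im (level_curve \<rho> t)) = - \<rho>" if "\<rho> \<in> {0, 1, -1}" "t > 0" for \<rho> t
  proof -
    have "sin (3 * level_angle t) > 0"
      using level_angle_pos[OF \<open>t > 0\<close>] level_angle_bounds[of t] pi_gt_zero
      by (intro sin_gt_zero) auto
    then show ?thesis using that by (auto simp: level_curve_coordinates sgn_mult)
  qed
  have "level_curve \<sigma> 1 \<in> level_arc \<tau>" using assms(1) level_curve_in_arc by blast
  then obtain t where t: "t \<ge> 0" "level_curve \<sigma> 1 = level_curve \<tau> t" by (auto simp: level_arc_def)
  have "t \<noteq> 0"
  proof
    assume "t = 0"
    then have "level_curve \<sigma> 1 = 2" using t by (simp add: level_curve_def Complex_eq)
    then have *: "Im (level_curve \<sigma> 1) = 0" "Re (level_curve \<sigma> 1) = 2" by simp_all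
    then have "\<sigma> = 0" using sgn[OF assms(2), of 1] by simp
    then have "cosh 3 = (1::real)" using *(2) by (simp add: level_curve_coordinates)
    then show False using cosh_real_one_iff[of 3] by simp
  qed
  then show ?thesis using sgn[OF assms(2), of 1] sgn[OF assms(3), of t] t by simp
qed

text \<open>Each arc is the image of a trajectory, each image lies inside some arc, and no arc
  contains another; so the maximal images are exactly the arcs.\<close>

lemma spectral_curves_right: "spectral_curves b_right = level_arc ` {0, 1, -1}"
proof -
  have arc: "level_arc \<sigma> \<in> trajectory_images 2" if "\<sigma> \<in> {0, 1, -1}" for \<sigma>
    using spectral_trajectory_level_curve[OF that] by (auto simp: trajectory_images_def level_arc_def)
  have sub: "\<exists>\<sigma>\<in>{0, 1, -1}. K \<subseteq> level_arc \<sigma>" if "K \<in> trajectory_images 2" for K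
    using that spectral_trajectory_in_level_arc by (auto simp: trajectory_images_def)
  have max: "K' = level_arc \<sigma>"
    if \<sigma>: "\<sigma> \<in> {0, 1, -1}" and K': "K' \<in> trajectory_images 2" "level_arc \<sigma> \<subseteq> K'" for \<sigma> K'
  proof -
    obtain \<tau> where "\<tau> \<in> {0, 1, -1}" "K' \<subseteq> level_arc \<tau>" using sub[OF K'(1)] by blast
    then show ?thesis using \<sigma> K' level_arc_subset_imp_eq[of \<sigma> \<tau>] by blast
  qed
  show ?thesis unfolding spectral_curves_def b_right_def
  proof (rule set_eqI, rule iffI)
    fix K assume "K \<in> {K \<in> trajectory_images 2. \<forall>K'\<in>trajectory_images 2. K \<subseteq> K' \<longrightarrow> K' = K}"
    then show "K \<in> level_arc ` {0, 1, -1}" 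
    proof -
      assume K: "K \<in> {K \<in> trajectory_images 2. \<forall>K'\<in>trajectory_images 2. K \<subseteq> K' \<longrightarrow> K' = K}"
      then have "\<exists>\<sigma>\<in>{0, 1, -1}. K \<subseteq> level_arc \<sigma>" by (intro sub) simp
      then obtain \<sigma> where \<sigma>: "\<sigma> \<in> {0, 1, -1}" "K \<subseteq> level_arc \<sigma>" by (rule bexE)
      have "level_arc \<sigma> = K" using K arc[OF \<sigma>(1)] \<sigma>(2) by simp
      then show ?thesis using imageI[OF \<sigma>(1), of level_arc] by simp
    qed
  next
    fix K assume "K \<in> level_arc ` {0, 1, -1}"
    then obtain \<sigma> where \<sigma>: "K = level_arc \<sigma>" "\<sigma> \<in> {0, 1, -1}" by (rule imageE)
    show "K \<in> {K \<in> trajectory_images 2. \<forall>K'\<in>trajectory_images 2. K \<subseteq> K' \<longrightarrow> K' = K}"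
      unfolding \<sigma>(1) using arc[OF \<sigma>(2)] max[OF \<sigma>(2)] by simp
  qed
qed

lemma spectral_curves_left: "spectral_curves b_left = (\<lambda>\<sigma>. uminus ` level_arc \<sigma>) ` {0, 1, -1}"
proof -
  have "b_left = - b_right" by (simp add: b_left_def b_right_def)
  then have "spectral_curves b_left = (`) uminus ` spectral_curves b_right"
    using spectral_curves_uminus by metis
  then show ?thesis by (simp only: spectral_curves_right image_image)
qed

section \<open>Confocal coordinates\<close>

text \<open>
  Confocal elliptic coordinates with foci \<open>\<plusminus>2\<close>.  With \<open>\<rho>\<close> allowed to be negative they map the
  strip \<open>0 < \<theta> < pi\<close> homeomorphically onto the plane without the two real rays of the network,
  and the segment between the branch points is \<open>\<rho> = 0\<close>.
\<close>

definition confocal :: "real \<Rightarrow> real \<Rightarrow> complex" where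
  "confocal \<rho> \<theta> = 2 * cos (Complex \<theta> (- \<rho>))"

lemma confocal_eq: "confocal \<rho> \<theta> = Complex (2 * cos \<theta> * cosh \<rho>) (2 * sin \<theta> * sinh \<rho>)"
  unfolding confocal_def sin_cos_Complex by (simp add: complex_eq_iff)

lemma Re_confocal [simp]: "Re (confocal \<rho> \<theta>) = 2 * cos \<theta> * cosh \<rho>"
  and Im_confocal [simp]: "Im (confocal \<rho> \<theta>) = 2 * sin \<theta> * sinh \<rho>"
  by (simp_all add: confocal_eq)

lemma confocal_uminus: "- confocal \<rho> \<theta> = confocal (- \<rho>) (pi - \<theta>)"
  by (simp add: complex_eq_iff)

lemma confocal_surj: obtains \<rho> \<theta> where "x = confocal \<rho> \<theta>" "0 \<le> \<theta>" "\<theta> \<le> pi"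
proof (cases "Re (Arccos (x / 2)) \<ge> 0")
  case True
  show ?thesis
    using that[of "- Im (Arccos (x / 2))" "Re (Arccos (x / 2))"] True Re_Arccos_bounds[of "x / 2"]
    by (simp add: confocal_def)
next
  case False
  have "Complex (- Re (Arccos (x / 2))) (- Im (Arccos (x / 2))) = - Arccos (x / 2)"
    by (simp add: complex_eq_iff)
  then show ?thesis
    using that[of "Im (Arccos (x / 2))" "- Re (Arccos (x / 2))"] False Re_Arccos_bounds[of "x / 2"]
    by (simp add: confocal_def)
qed

text \<open>On the open strip \<open>Arccos\<close> recovers both coordinates, which makes them
  continuous functions on \<open>slit_plane\<close>; openness of the bands rests on this.\<close>

lemma Arccos_confocal:
  assumes "0 < \<theta>" "\<theta> < pi" shows "Arccos (confocal \<rho> \<theta> / 2) = Complex \<theta> (- \<rho>)"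
  using assms Arccos_cos[of "Complex \<theta> (- \<rho>)"] by (simp add: confocal_def)

definition slit_plane :: "complex set" where
  "slit_plane = {x. Im x = 0 \<longrightarrow> \<bar>Re x\<bar> < 2}"

lemma confocal_in_slit_plane:
  assumes "0 < \<theta>" "\<theta> < pi" shows "confocal \<rho> \<theta> \<in> slit_plane"
proof -
  have "sin \<theta> > 0" using assms by (rule sin_gt_zero)
  moreover have "\<bar>cos \<theta>\<bar> < 1"
  proof (rule ccontr)
    assume "\<not> \<bar>cos \<theta>\<bar> < 1"
    then have "\<bar>cos \<theta>\<bar> = 1" using abs_cos_le_one[of \<theta>] by linarith
    then have "(cos \<theta>)^2 = 1" by (metis power2_abs power_one)
    then show False using sin_cos_squared_add[of \<theta>] \<open>sin \<theta> > 0\<close> by simp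
  qed
  ultimately show ?thesis by (auto simp: slit_plane_def)
qed

lemma confocal_notin_slit_plane: "confocal \<rho> 0 \<notin> slit_plane" "confocal \<rho> pi \<notin> slit_plane"
  using cosh_real_ge_1[of \<rho>] by (auto simp: slit_plane_def)

lemma slit_plane_confocal:
  assumes "x \<in> slit_plane"
  obtains \<rho> \<theta> where "x = confocal \<rho> \<theta>" "0 < \<theta>" "\<theta> < pi"
proof -
  obtain \<rho> \<theta> where x: "x = confocal \<rho> \<theta>" "0 \<le> \<theta>" "\<theta> \<le> pi" by (rule confocal_surj)
  then have "\<theta> \<noteq> 0" "\<theta> \<noteq> pi" using assms confocal_notin_slit_plane by auto
  then show ?thesis using that x by simp
qed

lemma open_slit_plane: "open slit_plane"
proof -
  have "slit_plane = {x. Im x \<noteq> 0} \<union> {x. \<bar>Re x\<bar> < 2}" by (auto simp: slit_plane_def)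
  moreover have "open {x. Im x \<noteq> 0}" "open {x. \<bar>Re x\<bar> < 2}"
    by (intro open_Collect_neq open_Collect_less continuous_intros)+
  ultimately show ?thesis using open_Un by metis
qed

lemma continuous_on_Arccos_half: "continuous_on slit_plane (\<lambda>x. Arccos (x / 2))"
proof (rule continuous_on_compose2[of "(\<lambda>x. x / 2) ` slit_plane" Arccos])
  show "continuous_on ((\<lambda>x. x / 2) ` slit_plane) Arccos"
    by (intro continuous_on_Arccos) (auto simp: slit_plane_def)
  show "continuous_on slit_plane (\<lambda>x. x / 2)" by (intro continuous_intros) simp
qed (rule subset_refl)

lemma confocal_inj:
  assumes "confocal \<rho> \<theta> = confocal \<rho>' \<theta>'" "0 < \<theta>" "\<theta> < pi" "0 < \<theta>'" "\<theta>' < pi"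
  shows "\<rho> = \<rho>'" "\<theta> = \<theta>'"
proof -
  have "Complex \<theta> (- \<rho>) = Complex \<theta>' (- \<rho>')"
    unfolding Arccos_confocal[OF assms(2,3), symmetric] Arccos_confocal[OF assms(4,5), symmetric] assms(1) ..
  then show "\<rho> = \<rho>'" "\<theta> = \<theta>'" by simp_all
qed

section \<open>Bands between two graphs in confocal coordinates\<close>

definition band :: "real set \<Rightarrow> (real \<Rightarrow> real) \<Rightarrow> (real \<Rightarrow> real) \<Rightarrow> complex set" where
  "band I l u = {confocal \<rho> \<theta> | \<rho> \<theta>. \<rho> \<in> I \<and> l \<rho> < \<theta> \<and> \<theta> < u \<rho>}"

text \<open>The angle is rescaled to the unit interval, so that a band is the continuous image of a
  product; connectedness and statements on closures come from this product.\<close>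

definition band_param :: "(real \<Rightarrow> real) \<Rightarrow> (real \<Rightarrow> real) \<Rightarrow> real \<times> real \<Rightarrow> complex" where
  "band_param l u = (\<lambda>(\<rho>, s). confocal \<rho> (l \<rho> + s * (u \<rho> - l \<rho>)))"

lemma continuous_on_confocal [continuous_intros]:
  fixes f g :: "'a::t2_space \<Rightarrow> real"
  assumes "continuous_on S f" "continuous_on S g"
  shows "continuous_on S (\<lambda>x. confocal (f x) (g x))"
  unfolding confocal_def Complex_eq by (intro continuous_intros assms)

lemma continuous_on_band_param:
  assumes "continuous_on UNIV l" "continuous_on UNIV u"
  shows "continuous_on S (band_param l u)"
proof -
  have "continuous_on S (\<lambda>z. l (fst z))" "continuous_on S (\<lambda>z. u (fst z))" for S :: "(real \<times> real) set"
    by (rule continuous_on_compose2[OF assms(1)] continuous_on_compose2[OF assms(2)];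
        auto intro: continuous_intros)+
  then show ?thesis
    unfolding band_param_def case_prod_unfold by (intro continuous_intros)
qed

lemma band_eq_image:
  assumes "\<And>\<rho>. \<rho> \<in> I \<Longrightarrow> l \<rho> < u \<rho>"
  shows "band I l u = band_param l u ` (I \<times> {0<..<1})"
proof (intro equalityI subsetI)
  fix x assume "x \<in> band I l u"
  then obtain \<rho> \<theta> where x: "x = confocal \<rho> \<theta>" "\<rho> \<in> I" "l \<rho> < \<theta>" "\<theta> < u \<rho>"
    by (auto simp: band_def)
  then have "x = band_param l u (\<rho>, (\<theta> - l \<rho>) / (u \<rho> - l \<rho>))" by (simp add: band_param_def)
  moreover have "(\<theta> - l \<rho>) / (u \<rho> - l \<rho>) \<in> {0<..<1}" using x by (auto simp: field_simps)
  ultimately show "x \<in> band_param l u ` (I \<times> {0<..<1})" using x(2) by blast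
next
  fix x assume "x \<in> band_param l u ` (I \<times> {0<..<1})"
  then obtain \<rho> s where x: "x = confocal \<rho> (l \<rho> + s * (u \<rho> - l \<rho>))" "\<rho> \<in> I" "0 < s" "s < 1"
    by (auto simp: band_param_def)
  have "s * (u \<rho> - l \<rho>) < 1 * (u \<rho> - l \<rho>)"
    using assms[OF x(2)] x(4) by (intro mult_strict_right_mono) auto
  moreover have "s * (u \<rho> - l \<rho>) > 0" using assms[OF x(2)] x(3) by simp
  ultimately show "x \<in> band I l u" unfolding band_def using x(1,2) by force
qed

lemma connected_band:
  assumes "continuous_on UNIV l" "continuous_on UNIV u" "\<And>\<rho>. \<rho> \<in> I \<Longrightarrow> l \<rho> < u \<rho>" "connected I"
  shows "connected (band I l u)"
proof -
  have "band I l u = band_param l u ` (I \<times> {0<..<1})" by (rule band_eq_image) (rule assms(3))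
  moreover have "connected (band_param l u ` (I \<times> {0<..<1}))"
    by (intro connected_continuous_image continuous_on_band_param connected_Times assms) simp
  ultimately show ?thesis by simp
qed

text \<open>A continuous map sends the closure of the parameter domain into the closure of the band.
  This brings in both bounding graphs, also over the endpoints of \<open>I\<close>.\<close>

lemma closure_band:
  assumes "continuous_on UNIV l" "continuous_on UNIV u" "\<And>\<rho>. \<rho> \<in> I \<Longrightarrow> l \<rho> < u \<rho>"
    and "\<rho> \<in> closure I" "l \<rho> \<le> \<theta>" "\<theta> \<le> u \<rho>"
  shows "confocal \<rho> \<theta> \<in> closure (band I l u)"
proof -
  obtain s where s: "s \<in> {0..1}" "\<theta> = l \<rho> + s * (u \<rho> - l \<rho>)"
  proof (cases "l \<rho> = u \<rho>")
    \<comment> \<open>Over an endpoint of \<open>I\<close> the band may be pinched to a point, as at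
      a branch point or a collision point.\<close>
    case True
    show ?thesis by (rule that[of 0]) (use True assms(5,6) in auto)
  next
    case False
    show ?thesis
      by (rule that[of "(\<theta> - l \<rho>) / (u \<rho> - l \<rho>)"]) (use False assms(5,6) in \<open>auto simp: field_simps\<close>)
  qed
  have "band_param l u ` closure (I \<times> {0<..<1}) \<subseteq> closure (band_param l u ` (I \<times> {0<..<1}))"
    by (intro image_closure_subset continuous_on_band_param assms closed_closure closure_subset)
  moreover have "(\<rho>, s) \<in> closure (I \<times> {0<..<1})"
    using s assms(4) by (simp add: closure_Times)
  moreover have "band_param l u (\<rho>, s) = confocal \<rho> \<theta>" by (simp add: band_param_def s)
  moreover have "band I l u = band_param l u ` (I \<times> {0<..<1})"
    by (rule band_eq_image) (rule assms(3))
  ultimately show ?thesis by (metis image_eqI subsetD)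
qed

lemma band_Arccos:
  assumes "\<And>\<rho>. \<rho> \<in> I \<Longrightarrow> 0 \<le> l \<rho> \<and> u \<rho> \<le> pi"
  shows "band I l u = {x \<in> slit_plane. - Im (Arccos (x / 2)) \<in> I \<and>
      l (- Im (Arccos (x / 2))) < Re (Arccos (x / 2)) \<and>
      Re (Arccos (x / 2)) < u (- Im (Arccos (x / 2)))}"
proof (intro equalityI subsetI)
  fix x assume "x \<in> band I l u"
  then obtain \<rho> \<theta> where x: "x = confocal \<rho> \<theta>" "\<rho> \<in> I" "l \<rho> < \<theta>" "\<theta> < u \<rho>"
    by (auto simp: band_def)
  then have "0 < \<theta>" "\<theta> < pi" using assms[OF x(2)] by auto
  then show "x \<in> {x \<in> slit_plane. - Im (Arccos (x / 2)) \<in> I \<and>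
      l (- Im (Arccos (x / 2))) < Re (Arccos (x / 2)) \<and>
      Re (Arccos (x / 2)) < u (- Im (Arccos (x / 2)))}"
    using x by (simp add: confocal_in_slit_plane Arccos_confocal)
next
  fix x assume x: "x \<in> {x \<in> slit_plane. - Im (Arccos (x / 2)) \<in> I \<and>
      l (- Im (Arccos (x / 2))) < Re (Arccos (x / 2)) \<and>
      Re (Arccos (x / 2)) < u (- Im (Arccos (x / 2)))}"
  then obtain \<rho> \<theta> where x': "x = confocal \<rho> \<theta>" "0 < \<theta>" "\<theta> < pi"
    by (auto elim: slit_plane_confocal)
  then show "x \<in> band I l u" using x by (auto simp: Arccos_confocal band_def)
qed

lemma open_band:
  assumes "continuous_on UNIV l" "continuous_on UNIV u" "open I"
    and "\<And>\<rho>. \<rho> \<in> I \<Longrightarrow> 0 \<le> l \<rho> \<and> u \<rho> \<le> pi"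
  shows "open (band I l u)"
proof -
  define \<rho> \<theta> where "\<rho> = (\<lambda>x. - Im (Arccos (x / 2)))" and "\<theta> = (\<lambda>x. Re (Arccos (x / 2)))"
  have cont: "continuous_on slit_plane \<rho>" "continuous_on slit_plane \<theta>"
    unfolding \<rho>_def \<theta>_def by (intro continuous_intros continuous_on_Arccos_half)+
  then have "continuous_on slit_plane (\<lambda>x. (\<rho> x, \<theta> x - l (\<rho> x), u (\<rho> x) - \<theta> x))"
    by (intro continuous_intros continuous_on_compose2[OF assms(1)] continuous_on_compose2[OF assms(2)]) auto
  then have "open (slit_plane \<inter> (\<lambda>x. (\<rho> x, \<theta> x - l (\<rho> x), u (\<rho> x) - \<theta> x)) -` (I \<times> {0<..} \<times> {0<..}))"
    by (intro continuous_open_preimage open_slit_plane open_Times assms(3)) auto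
  also have "slit_plane \<inter> (\<lambda>x. (\<rho> x, \<theta> x - l (\<rho> x), u (\<rho> x) - \<theta> x)) -` (I \<times> {0<..} \<times> {0<..})
      = band I l u"
    by (subst band_Arccos) (auto simp: \<rho>_def \<theta>_def dest: assms(4))
  finally show ?thesis .
qed

text \<open>The point is \<open>2 * cos (3 * v)\<close> and also
  \<open>2 * cos (Complex \<theta> (- \<rho>))\<close>, so \<open>\<theta>\<close> and
  \<open>\<rho>\<close> are three times the coordinates of \<open>v\<close> up to sign. The absolute
  value puts both nonreal curves from 2 on one graph over all real \<open>\<rho>\<close>.\<close>

definition curve_angle :: "real \<Rightarrow> real" where
  "curve_angle \<rho> = 3 * \<bar>level_angle (\<rho> / 3)\<bar>"

lemma continuous_on_curve_angle: "continuous_on S curve_angle"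
  unfolding curve_angle_def[abs_def] by (intro continuous_intros) auto

lemma curve_angle_minus [simp]: "curve_angle (- \<rho>) = curve_angle \<rho>"
  by (simp add: curve_angle_def)

lemma curve_angle_0 [simp]: "curve_angle 0 = 0"
  by (simp add: curve_angle_def)

lemma curve_angle_bounds: "0 \<le> curve_angle \<rho>" "curve_angle \<rho> < pi"
  using level_angle_bounds[of "\<rho> / 3"] pi_gt_zero by (simp_all add: curve_angle_def)

lemma curve_angle_pos: "\<rho> \<noteq> 0 \<Longrightarrow> 0 < curve_angle \<rho>"
  by (simp add: curve_angle_def)

text \<open>The curves cross the imaginary axis at angle pi/2, that is where
  \<open>level_angle\<close> is pi/6 and its squared sine 1/4. For \<open>y = (sinh b)^2\<close>
  this reads \<open>8 * y^2 + 4 * y = 1\<close>, with positive root \<open>(sqrt 3 - 1) / 4\<close>;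
  the factor 3 passes from \<open>b\<close> to \<open>\<rho>\<close>.\<close>

definition collision_rho :: real where
  "collision_rho = 3 * arsinh (sqrt ((sqrt 3 - 1) / 4))"

lemma collision_rho_pos: "collision_rho > 0"
  by (simp add: collision_rho_def)

lemma power2_less_iff_nonneg:
  fixes a b :: real
  assumes "0 \<le> a" "0 \<le> b" shows "a^2 < b^2 \<longleftrightarrow> a < b"
  using power_mono_iff[OF assms(2,1), of 2] by (metis linorder_not_le zero_less_numeral)

lemma sinh_squared_collision:
  "(sinh b)^2 < (sqrt 3 - 1) / 4 \<longleftrightarrow> \<bar>3 * b\<bar> < collision_rho"
  "(sinh b)^2 = (sqrt 3 - 1) / 4 \<longleftrightarrow> \<bar>3 * b\<bar> = collision_rho"
proof -
  define y where "y = sqrt ((sqrt 3 - 1) / 4)"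
  have y: "y \<ge> 0" "y^2 = (sqrt 3 - 1) / 4" by (simp_all add: y_def)
  have cr: "collision_rho = 3 * arsinh y" by (simp add: collision_rho_def y_def)
  have s: "(sinh b)^2 = (sinh \<bar>b\<bar>)^2" by (simp add: abs_if)
  have "(sinh \<bar>b\<bar>)^2 < y^2 \<longleftrightarrow> sinh \<bar>b\<bar> < sinh (arsinh y)"
    using y(1) power2_less_iff_nonneg[of "sinh \<bar>b\<bar>" y] by (simp only: sinh_real_nonneg_iff abs_ge_zero sinh_arsinh_real)
  also have "\<dots> \<longleftrightarrow> \<bar>b\<bar> < arsinh y" by (rule sinh_real_less_iff)
  finally show "(sinh b)^2 < (sqrt 3 - 1) / 4 \<longleftrightarrow> \<bar>3 * b\<bar> < collision_rho"
    unfolding s y(2)[symmetric] cr by (simp add: abs_mult)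
  have "(sinh \<bar>b\<bar>)^2 = y^2 \<longleftrightarrow> sinh \<bar>b\<bar> = sinh (arsinh y)"
    using y(1) power2_eq_iff_nonneg[of "sinh \<bar>b\<bar>" y] by (simp only: sinh_real_nonneg_iff abs_ge_zero sinh_arsinh_real)
  also have "\<dots> \<longleftrightarrow> \<bar>b\<bar> = arsinh y" by (rule sinh_real_eq_iff)
  finally show "(sinh b)^2 = (sqrt 3 - 1) / 4 \<longleftrightarrow> \<bar>3 * b\<bar> = collision_rho"
    unfolding s y(2)[symmetric] cr by (simp add: abs_mult)
qed

text \<open>After clearing the positive denominator the left difference becomes
  \<open>(8 * (y + y0) + 4) * (y - y0)\<close> with positive first factor. Equality of signs
  provides the comparisons \<open><\<close> and \<open>=\<close> at once.\<close>

lemma sgn_sin_squared_level_angle: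
  "sgn ((sin (level_angle b))^2 - 1 / 4) = sgn ((sinh b)^2 - (sqrt 3 - 1) / 4)"
proof -
  define y S y0 where "y = (sinh b)^2" and "S = (sin (level_angle b))^2" and "y0 = (sqrt 3 - 1) / 4"
  have y: "y \<ge> 0" and y0: "y0 > 0" by (simp_all add: y_def y0_def)
  have y0_eq: "8 * y0^2 + 4 * y0 = 1"
    by (simp add: y0_def power2_eq_square field_simps)
  have S: "S * (8 * y^2 + 8 * y + 1) = y * (4 * y + 3)"
    using sin_level_angle_squared[of b] unfolding S_def y_def by simp
  have Q: "8 * y^2 + 8 * y + 1 > 0" using y by (simp add: add_nonneg_pos)
  have "4 * (8 * y^2 + 8 * y + 1) * (S - 1 / 4) = 4 * (y * (4 * y + 3)) - (8 * y^2 + 8 * y + 1)"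
    unfolding S[symmetric] by (simp add: algebra_simps)
  also have "\<dots> = 8 * y^2 + 4 * y - (8 * y0^2 + 4 * y0)"
    unfolding y0_eq by (simp add: algebra_simps power2_eq_square)
  also have "\<dots> = (8 * (y + y0) + 4) * (y - y0)"
    by (simp add: algebra_simps power2_eq_square)
  finally have "sgn (4 * (8 * y^2 + 8 * y + 1) * (S - 1 / 4)) = sgn ((8 * (y + y0) + 4) * (y - y0))"
    by simp
  moreover have "sgn (4 * (8 * y^2 + 8 * y + 1)) = 1" "sgn (8 * (y + y0) + 4) = 1"
    using Q y y0 by (simp_all add: sgn_if)
  ultimately show ?thesis unfolding S_def[symmetric] y_def[symmetric] y0_def[symmetric]
    by (simp only: sgn_mult mult_1)
qed

text \<open>Comparing the angle with pi/2 amounts to comparing a squared sine with 1/4; this locates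
  the crossings without any monotonicity of \<open>curve_angle\<close>.\<close>

lemma curve_angle_right_angle:
  "curve_angle \<rho> < pi / 2 \<longleftrightarrow> \<bar>\<rho>\<bar> < collision_rho"
  "curve_angle \<rho> = pi / 2 \<longleftrightarrow> \<bar>\<rho>\<bar> = collision_rho"
proof -
  define a where "a = \<bar>level_angle (\<rho> / 3)\<bar>"
  have a: "0 \<le> a" "a < pi / 4" using level_angle_bounds by (simp_all add: a_def)
  have s: "(sin (level_angle (\<rho> / 3)))^2 = (sin a)^2" by (simp add: a_def abs_if)
  have s0: "sin a \<ge> 0" using a by (intro sin_ge_zero) auto
  have q: "(1 / 4 :: real) = (sin (pi / 6))^2" by (simp add: sin_30 power_divide)
  have "a < pi / 6 \<longleftrightarrow> sin a < sin (pi / 6)"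
    using a by (subst sin_mono_less_eq) auto
  also have "\<dots> \<longleftrightarrow> (sin a)^2 < 1 / 4"
    unfolding q using s0 by (subst power2_less_iff_nonneg) (simp_all add: sin_30)
  also have "\<dots> \<longleftrightarrow> (sinh (\<rho> / 3))^2 < (sqrt 3 - 1) / 4"
    using sgn_sin_squared_level_angle[of "\<rho> / 3"] unfolding s
    by (metis diff_less_0_iff_less sgn_less)
  also have "\<dots> \<longleftrightarrow> \<bar>\<rho>\<bar> < collision_rho" unfolding sinh_squared_collision by simp
  finally show "curve_angle \<rho> < pi / 2 \<longleftrightarrow> \<bar>\<rho>\<bar> < collision_rho"
    unfolding a_def curve_angle_def by linarith
  have "a = pi / 6 \<longleftrightarrow> sin a = sin (pi / 6)"
  proof
    assume "sin a = sin (pi / 6)"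
    then show "a = pi / 6" using a sin_inj_pi[of a "pi / 6"] by auto
  qed (simp only:)
  also have "\<dots> \<longleftrightarrow> (sin a)^2 = 1 / 4"
    unfolding q using s0 by (subst power2_eq_iff_nonneg) (simp_all add: sin_30)
  also have "\<dots> \<longleftrightarrow> (sinh (\<rho> / 3))^2 = (sqrt 3 - 1) / 4"
    using sgn_sin_squared_level_angle[of "\<rho> / 3"] unfolding s
    by (metis eq_iff_diff_eq_0 sgn_0_0)
  also have "\<dots> \<longleftrightarrow> \<bar>\<rho>\<bar> = collision_rho" unfolding sinh_squared_collision by simp
  finally show "curve_angle \<rho> = pi / 2 \<longleftrightarrow> \<bar>\<rho>\<bar> = collision_rho"
    unfolding a_def curve_angle_def by linarith
qed

section \<open>The cells of the extended network\<close>

lemma level_curve_confocal: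
  "level_curve 0 t = confocal (3 * t) 0"
  "t \<ge> 0 \<Longrightarrow> level_curve (-1) t = confocal (3 * t) (curve_angle (3 * t))"
  "t \<ge> 0 \<Longrightarrow> level_curve 1 t = confocal (- (3 * t)) (curve_angle (3 * t))"
  using level_angle_abs[of t]
  by (simp_all add: complex_eq_iff level_curve_coordinates curve_angle_def)

lemma level_arc_confocal:
  "level_arc 0 = {confocal \<rho> 0 | \<rho>. \<rho> \<ge> 0}"
  "level_arc (-1) = {confocal \<rho> (curve_angle \<rho>) | \<rho>. \<rho> \<ge> 0}"
  "level_arc 1 = {confocal \<rho> (curve_angle \<rho>) | \<rho>. \<rho> \<le> 0}"
proof -
  have *: "(\<exists>t\<ge>0. x = f (3 * t)) \<longleftrightarrow> (\<exists>\<rho>\<ge>0. x = f \<rho>)" for x :: complex and f :: "real \<Rightarrow> complex"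
  proof
    assume "\<exists>\<rho>\<ge>0. x = f \<rho>"
    then obtain \<rho> where "\<rho> \<ge> 0" "x = f \<rho>" by blast
    then show "\<exists>t\<ge>0. x = f (3 * t)" by (intro exI[of _ "\<rho> / 3"]) simp
  next
    assume "\<exists>t\<ge>0. x = f (3 * t)"
    then obtain t where "t \<ge> 0" "x = f (3 * t)" by blast
    then show "\<exists>\<rho>\<ge>0. x = f \<rho>" by (intro exI[of _ "3 * t"]) simp
  qed
  have **: "(\<exists>\<rho>\<ge>0. x = confocal (- \<rho>) (curve_angle \<rho>)) \<longleftrightarrow>
      (\<exists>\<rho>\<le>0. x = confocal \<rho> (curve_angle \<rho>))" for x
  proof
    assume "\<exists>\<rho>\<ge>0. x = confocal (- \<rho>) (curve_angle \<rho>)"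
    then obtain \<rho> where "\<rho> \<ge> 0" "x = confocal (- \<rho>) (curve_angle \<rho>)" by blast
    then show "\<exists>\<rho>\<le>0. x = confocal \<rho> (curve_angle \<rho>)" by (intro exI[of _ "- \<rho>"]) simp
  next
    assume "\<exists>\<rho>\<le>0. x = confocal \<rho> (curve_angle \<rho>)"
    then obtain \<rho> where "\<rho> \<le> 0" "x = confocal \<rho> (curve_angle \<rho>)" by blast
    then show "\<exists>\<rho>\<ge>0. x = confocal (- \<rho>) (curve_angle \<rho>)" by (intro exI[of _ "- \<rho>"]) simp
  qed
  have arc: "x \<in> level_arc \<sigma> \<longleftrightarrow> (\<exists>t\<ge>0. x = level_curve \<sigma> t)" for x \<sigma>
    by (auto simp: level_arc_def)
  show "level_arc 0 = {confocal \<rho> 0 | \<rho>. \<rho> \<ge> 0}"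
    using *[of _ "\<lambda>\<rho>. confocal \<rho> 0"] by (auto simp: set_eq_iff arc level_curve_confocal)
  show "level_arc (-1) = {confocal \<rho> (curve_angle \<rho>) | \<rho>. \<rho> \<ge> 0}"
    using *[of _ "\<lambda>\<rho>. confocal \<rho> (curve_angle \<rho>)"]
    by (auto simp: set_eq_iff arc level_curve_confocal cong: conj_cong)
  show "level_arc 1 = {confocal \<rho> (curve_angle \<rho>) | \<rho>. \<rho> \<le> 0}"
    using *[of _ "\<lambda>\<rho>. confocal (- \<rho>) (curve_angle \<rho>)"] **
    by (auto simp: set_eq_iff arc level_curve_confocal cong: conj_cong)
qed

lemma confocal_0_abs: "confocal \<bar>\<rho>\<bar> 0 = confocal \<rho> 0" "confocal \<bar>\<rho>\<bar> pi = confocal \<rho> pi"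
  by (simp_all add: complex_eq_iff)

section \<open>The network as a union of graphs\<close>

lemma Union_spectral_curves_right:
  "\<Union> (spectral_curves b_right) = range (\<lambda>\<rho>. confocal \<rho> 0) \<union> range (\<lambda>\<rho>. confocal \<rho> (curve_angle \<rho>))"
proof -
  have "\<Union> (spectral_curves b_right) = level_arc 0 \<union> (level_arc (-1) \<union> level_arc 1)"
    unfolding spectral_curves_right by auto
  moreover have "level_arc 0 = range (\<lambda>\<rho>. confocal \<rho> 0)"
  proof (intro equalityI subsetI)
    fix x assume "x \<in> range (\<lambda>\<rho>. confocal \<rho> 0)"
    then obtain \<rho> where "x = confocal \<bar>\<rho>\<bar> 0" using confocal_0_abs(1) by auto
    then show "x \<in> level_arc 0" unfolding level_arc_confocal by force
  qed (auto simp: level_arc_confocal)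
  moreover have "level_arc (-1) \<union> level_arc 1 = range (\<lambda>\<rho>. confocal \<rho> (curve_angle \<rho>))"
    unfolding level_arc_confocal using linear[of 0] by blast
  ultimately show ?thesis by simp
qed

lemma Union_spectral_curves_left:
  "\<Union> (spectral_curves b_left) =
     range (\<lambda>\<rho>. confocal \<rho> pi) \<union> range (\<lambda>\<rho>. confocal \<rho> (pi - curve_angle \<rho>))"
proof -
  have "\<Union> (spectral_curves b_left) = uminus ` \<Union> (spectral_curves b_right)"
    unfolding spectral_curves_left spectral_curves_right by auto
  also have "\<dots> = range (\<lambda>\<rho>. confocal (- \<rho>) pi) \<union> range (\<lambda>\<rho>. confocal (- \<rho>) (pi - curve_angle (- \<rho>)))"
    unfolding Union_spectral_curves_right
    by (simp add: image_Un image_image confocal_uminus)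
  also have "\<dots> = range (\<lambda>\<rho>. confocal \<rho> pi) \<union> range (\<lambda>\<rho>. confocal \<rho> (pi - curve_angle \<rho>))"
  proof -
    have "range (\<lambda>\<rho>. f (- \<rho>)) = range f" for f :: "real \<Rightarrow> complex"
    proof (intro equalityI subsetI)
      fix x assume "x \<in> range f"
      then obtain \<rho> where "x = f (- (- \<rho>))" by auto
      then show "x \<in> range (\<lambda>\<rho>. f (- \<rho>))" by blast
    qed auto
    from this[of "\<lambda>\<rho>. confocal \<rho> pi"] this[of "\<lambda>\<rho>. confocal \<rho> (pi - curve_angle \<rho>)"]
    show ?thesis by simp
  qed
  finally show ?thesis .
qed

lemma imaginary_axis: "Re x = 0 \<longleftrightarrow> (\<exists>\<rho>. x = confocal \<rho> (pi / 2))"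
proof
  assume "Re x = 0"
  then have "x = confocal (arsinh (Im x / 2)) (pi / 2)" by (simp add: complex_eq_iff)
  then show "\<exists>\<rho>. x = confocal \<rho> (pi / 2)" by blast
qed auto

lemma curve_angle_Re:
  assumes "Re (confocal \<rho> (curve_angle \<rho>)) = 0" shows "\<bar>\<rho>\<bar> = collision_rho"
proof -
  have "cos (curve_angle \<rho>) = 0" using assms cosh_real_pos[of \<rho>] by simp
  then have "cos (curve_angle \<rho>) = cos (pi / 2)" by simp
  then have "curve_angle \<rho> = pi / 2"
    using curve_angle_bounds[of \<rho>] cos_inj_pi[of "curve_angle \<rho>" "pi / 2"] by simp
  then show ?thesis using curve_angle_right_angle(2) by blast
qed

text \<open>At angle pi/2 a curve from 2 meets its mirror image. For uniqueness the curves from 2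
  suffice: they reach the imaginary axis only for \<open>\<bar>\<rho>\<bar> = collision_rho\<close>,
  and the sign of the imaginary part decides between the two.\<close>

lemma c_upper_eq: "c_upper = confocal collision_rho (pi / 2)"
  unfolding c_upper_def
proof (rule the_equality)
  have r: "x \<in> \<Union> (spectral_curves b) \<longleftrightarrow> (\<exists>K\<in>spectral_curves b. x \<in> K)" for x b by blast
  have cr: "curve_angle collision_rho = pi / 2"
    using curve_angle_right_angle(2)[of collision_rho] collision_rho_pos by simp
  have "confocal collision_rho (pi / 2) = confocal collision_rho (curve_angle collision_rho)"
    "confocal collision_rho (pi / 2) = confocal collision_rho (pi - curve_angle collision_rho)"
    unfolding cr by simp_all
  then have "confocal collision_rho (pi / 2) \<in> \<Union> (spectral_curves b_right)"
    "confocal collision_rho (pi / 2) \<in> \<Union> (spectral_curves b_left)"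
    unfolding Union_spectral_curves_right Union_spectral_curves_left by blast+
  then show "Re (confocal collision_rho (pi / 2)) = 0 \<and> Im (confocal collision_rho (pi / 2)) > 0 \<and>
     (\<exists>K\<in>spectral_curves b_left. \<exists>K'\<in>spectral_curves b_right. confocal collision_rho (pi / 2) \<in> K \<inter> K')"
    using collision_rho_pos by auto
next
  fix c assume c: "Re c = 0 \<and> Im c > 0 \<and>
     (\<exists>K\<in>spectral_curves b_left. \<exists>K'\<in>spectral_curves b_right. c \<in> K \<inter> K')"
  then have "c \<in> \<Union> (spectral_curves b_right)" by blast
  then consider \<rho> where "c = confocal \<rho> 0" | \<rho> where "c = confocal \<rho> (curve_angle \<rho>)"
    unfolding Union_spectral_curves_right by blast
  then show "c = confocal collision_rho (pi / 2)"
  proof cases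
    case 1
    then show ?thesis using c by simp
  next
    case (2 \<rho>)
    then have \<rho>: "\<bar>\<rho>\<bar> = collision_rho" using curve_angle_Re c by blast
    then have right: "curve_angle \<rho> = pi / 2" using curve_angle_right_angle(2) by blast
    then have "sin (curve_angle \<rho>) > 0" by (simp only: sin_pi_half)
    then have "sinh \<rho> > 0" using c 2 by (simp add: zero_less_mult_iff)
    then have "\<rho> = collision_rho" using \<rho> by simp
    then show ?thesis unfolding 2 right by simp
  qed
qed

lemma Im_c_upper: "Im c_upper = 2 * sinh collision_rho" "Re c_upper = 0"
  by (simp_all add: c_upper_eq)

lemma upper_collision_line_eq:
  "upper_collision_line = {confocal \<rho> (pi / 2) | \<rho>. \<rho> \<ge> collision_rho}"
  unfolding upper_collision_line_def imaginary_axis Im_c_upper by auto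

lemma lower_collision_line_eq:
  "lower_collision_line = {confocal \<rho> (pi / 2) | \<rho>. \<rho> \<le> - collision_rho}"
proof -
  have cl: "Im c_lower = 2 * sinh (- collision_rho)" by (simp add: c_lower_def Im_c_upper)
  have "Im (confocal \<rho> (pi / 2)) \<le> 2 * sinh (- collision_rho) \<longleftrightarrow> \<rho> \<le> - collision_rho" for \<rho>
    using sinh_real_le_iff[of \<rho> "- collision_rho"] by (simp del: sinh_minus sinh_real_le_iff)
  then show ?thesis unfolding lower_collision_line_def imaginary_axis cl by blast
qed

lemma closed_segment_collision:
  "closed_segment c_lower c_upper = {confocal \<rho> (pi / 2) | \<rho>. \<bar>\<rho>\<bar> \<le> collision_rho}"
proof -
  have "closed_segment c_lower c_upper =
    {x. Re x = 0 \<and> Im x \<in> closed_segment (- (2 * sinh collision_rho)) (2 * sinh collision_rho)}"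
    by (subst closed_segment_same_Re) (simp_all add: c_lower_def Im_c_upper)
  also have "\<dots> = {x. Re x = 0 \<and> 2 * sinh (- collision_rho) \<le> Im x \<and> Im x \<le> 2 * sinh collision_rho}"
    using collision_rho_pos by (simp add: closed_segment_eq_real_ivl)
  also have "\<dots> = {confocal \<rho> (pi / 2) | \<rho>. \<bar>\<rho>\<bar> \<le> collision_rho}"
  proof -
    have "2 * sinh (- collision_rho) \<le> Im (confocal \<rho> (pi / 2)) \<and>
        Im (confocal \<rho> (pi / 2)) \<le> 2 * sinh collision_rho \<longleftrightarrow> \<bar>\<rho>\<bar> \<le> collision_rho" for \<rho>
      using sinh_real_le_iff[of "- collision_rho" \<rho>] sinh_real_le_iff[of \<rho> collision_rho]
      by (simp add: abs_le_iff del: sinh_minus sinh_real_le_iff) linarith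
    then show ?thesis unfolding imaginary_axis by blast
  qed
  finally show ?thesis .
qed

text \<open>The backward collision line fills the gap between the two collision lines, so together
  they are the whole imaginary axis and the extended network consists of five full graphs.\<close>

lemma W_bnr_ext_eq:
  "W_bnr_ext = range (\<lambda>\<rho>. confocal \<rho> 0) \<union> range (\<lambda>\<rho>. confocal \<rho> (curve_angle \<rho>)) \<union>
     (range (\<lambda>\<rho>. confocal \<rho> pi) \<union> range (\<lambda>\<rho>. confocal \<rho> (pi - curve_angle \<rho>))) \<union>
     range (\<lambda>\<rho>. confocal \<rho> (pi / 2))"
proof -
  have "upper_collision_line \<union> lower_collision_line \<union> closed_segment c_lower c_upper =
      range (\<lambda>\<rho>. confocal \<rho> (pi / 2))"
  proof -
    have "\<rho> \<ge> collision_rho \<or> \<rho> \<le> - collision_rho \<or> \<bar>\<rho>\<bar> \<le> collision_rho" for \<rho> by linarith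
    then show ?thesis
      unfolding upper_collision_line_eq lower_collision_line_eq closed_segment_collision by blast
  qed
  then show ?thesis
    unfolding W_bnr_ext_def W_bnr_def Union_spectral_curves_right Union_spectral_curves_left by blast
qed

lemma confocal_eq_iff:
  assumes "0 < \<theta>" "\<theta> < pi" "0 \<le> \<theta>'" "\<theta>' \<le> pi"
  shows "confocal \<rho> \<theta> = confocal \<rho>' \<theta>' \<longleftrightarrow> \<rho> = \<rho>' \<and> \<theta> = \<theta>'"
proof (cases "\<theta>' = 0 \<or> \<theta>' = pi")
  case True
  then have "confocal \<rho> \<theta> \<noteq> confocal \<rho>' \<theta>'"
    using confocal_in_slit_plane[OF assms(1,2)] confocal_notin_slit_plane by metis
  then show ?thesis using True assms by auto
next
  case False
  then show ?thesis using confocal_inj[OF _ assms(1,2), of \<rho> \<rho>' \<theta>'] assms by auto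
qed

lemma confocal_notin_W_bnr_ext_iff:
  assumes "0 < \<theta>" "\<theta> < pi"
  shows "confocal \<rho> \<theta> \<notin> W_bnr_ext \<longleftrightarrow>
    \<theta> \<noteq> curve_angle \<rho> \<and> \<theta> \<noteq> pi - curve_angle \<rho> \<and> \<theta> \<noteq> pi / 2"
proof -
  have "confocal \<rho> \<theta> \<in> range (\<lambda>\<rho>. confocal \<rho> (f \<rho>)) \<longleftrightarrow> \<theta> = f \<rho>"
    if "\<And>\<rho>. 0 \<le> f \<rho> \<and> f \<rho> \<le> pi" for f
    using confocal_eq_iff[OF assms] that by auto
  then show ?thesis
    unfolding W_bnr_ext_eq Un_iff
    using assms curve_angle_bounds by (simp add: less_imp_le)
qed

text \<open>The first curve met when turning away from the right real ray: the curve from 2 for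
  \<open>\<bar>\<rho>\<bar>\<close> below \<open>collision_rho\<close>, and beyond it the curve from
  -2, which has crossed the axis.\<close>

definition edge_angle :: "real \<Rightarrow> real" where
  "edge_angle \<rho> = min (curve_angle \<rho>) (pi - curve_angle \<rho>)"

text \<open>
  The cells \<open>0, \<dots>, 7\<close> are the outer regions, numbered like the boundary curves; the
  cells \<open>8\<close> and \<open>9\<close> are the left and the right half of the central square.
\<close>

definition cell_rho :: "nat \<Rightarrow> real set" where
  "cell_rho i = [{0<..}, {collision_rho<..}, {collision_rho<..}, {0<..},
     {..<0}, {..<- collision_rho}, {..<- collision_rho}, {..<0},
     {- collision_rho<..<collision_rho}, {- collision_rho<..<collision_rho}] ! i"

definition cell_low :: "nat \<Rightarrow> real \<Rightarrow> real" where
  "cell_low i = [\<lambda>\<rho>. 0, \<lambda>\<rho>. pi - curve_angle \<rho>, \<lambda>\<rho>. pi / 2, \<lambda>\<rho>. pi - edge_angle \<rho>,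
     \<lambda>\<rho>. pi - edge_angle \<rho>, \<lambda>\<rho>. pi / 2, \<lambda>\<rho>. pi - curve_angle \<rho>, \<lambda>\<rho>. 0,
     \<lambda>\<rho>. pi / 2, curve_angle] ! i"

definition cell_high :: "nat \<Rightarrow> real \<Rightarrow> real" where
  "cell_high i = [edge_angle, \<lambda>\<rho>. pi / 2, curve_angle, \<lambda>\<rho>. pi,
     \<lambda>\<rho>. pi, curve_angle, \<lambda>\<rho>. pi / 2, edge_angle,
     \<lambda>\<rho>. pi - curve_angle \<rho>, \<lambda>\<rho>. pi / 2] ! i"

definition cell :: "nat \<Rightarrow> complex set" where
  "cell i = band (cell_rho i) (cell_low i) (cell_high i)"

section \<open>The ten cells are the components of the complement\<close>

lemma less_10_cases:
  assumes "i < (10::nat)"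
  shows "i = 0 \<or> i = 1 \<or> i = 2 \<or> i = 3 \<or> i = 4 \<or> i = 5 \<or> i = 6 \<or> i = 7 \<or> i = 8 \<or> i = 9"
  using assms by auto

lemmas cell_simps = cell_rho_def cell_low_def cell_high_def

text \<open>Written as case distinctions, so that linear arithmetic settles every comparison between
  the bounding functions of the cells.\<close>

lemma curve_angle_facts:
  "0 \<le> curve_angle \<rho>" "curve_angle \<rho> < pi"
  "\<rho> = 0 \<and> curve_angle \<rho> = 0 \<or> (\<rho> < 0 \<or> \<rho> > 0) \<and> 0 < curve_angle \<rho>"
  "\<bar>\<rho>\<bar> < collision_rho \<and> curve_angle \<rho> < pi / 2 \<or>
   \<bar>\<rho>\<bar> = collision_rho \<and> curve_angle \<rho> = pi / 2 \<or>
   \<bar>\<rho>\<bar> > collision_rho \<and> curve_angle \<rho> > pi / 2"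
  using curve_angle_bounds[of \<rho>] curve_angle_pos[of \<rho>] curve_angle_right_angle[of \<rho>]
  by (cases \<rho> "0::real" rule: linorder_cases; auto)+

lemma continuous_on_edge_angle: "continuous_on S edge_angle"
  unfolding edge_angle_def[abs_def]
  by (intro continuous_intros continuous_on_curve_angle)

lemma cell_bounds:
  assumes "i < 10" "\<rho> \<in> cell_rho i"
  shows "0 \<le> cell_low i \<rho> \<and> cell_low i \<rho> < cell_high i \<rho> \<and> cell_high i \<rho> \<le> pi"
  using less_10_cases[OF assms(1)]
  by (elim disjE; use assms(2) curve_angle_facts[of \<rho>] collision_rho_pos pi_gt_zero in
      \<open>simp add: cell_simps edge_angle_def; linarith\<close>)

lemma continuous_on_cell:
  assumes "i < 10" shows "continuous_on S (cell_low i)" "continuous_on S (cell_high i)"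
  using less_10_cases[OF assms]
  by (elim disjE; simp add: cell_simps;
      intro continuous_intros continuous_on_edge_angle continuous_on_curve_angle)+

lemma cell_rho_interval:
  assumes "i < 10" shows "open (cell_rho i)" "connected (cell_rho i)" "cell_rho i \<noteq> {}"
  using less_10_cases[OF assms] collision_rho_pos
  by (elim disjE; simp add: cell_rho_def convex_connected)+

text \<open>One decision function yields both disjointness and covering of the cells. At
  \<open>\<rho> = 0\<close> the value of \<open>edge_angle\<close> is 0, so neither of the first two
  tests succeeds inside the strip and the point falls to the central square.\<close>

definition cell_index :: "real \<Rightarrow> real \<Rightarrow> nat" where
  "cell_index \<rho> \<theta> =
     (if \<theta> < edge_angle \<rho> then (if \<rho> > 0 then 0 else 7)
      else if \<theta> > pi - edge_angle \<rho> then (if \<rho> > 0 then 3 else 4)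
      else if \<bar>\<rho>\<bar> < collision_rho then (if \<theta> < pi / 2 then 9 else 8)
      else if \<rho> > 0 then (if \<theta> < pi / 2 then 1 else 2)
      else (if \<theta> < pi / 2 then 6 else 5))"

lemma cell_index_unique:
  assumes "i < 10" "\<rho> \<in> cell_rho i" "cell_low i \<rho> < \<theta>" "\<theta> < cell_high i \<rho>"
  shows "cell_index \<rho> \<theta> = i"
  using less_10_cases[OF assms(1)]
  by (elim disjE; use assms(2-) curve_angle_facts[of \<rho>] collision_rho_pos pi_gt_zero in
      \<open>simp add: cell_simps cell_index_def edge_angle_def; linarith\<close>)

lemma cell_index_works:
  assumes "0 < \<theta>" "\<theta> < pi" "\<theta> \<noteq> curve_angle \<rho>" "\<theta> \<noteq> pi - curve_angle \<rho>" "\<theta> \<noteq> pi / 2"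
  shows "cell_index \<rho> \<theta> < 10 \<and> \<rho> \<in> cell_rho (cell_index \<rho> \<theta>) \<and>
    cell_low (cell_index \<rho> \<theta>) \<rho> < \<theta> \<and> \<theta> < cell_high (cell_index \<rho> \<theta>) \<rho>"
  unfolding cell_index_def edge_angle_def
  by (simp add: cell_simps edge_angle_def; (intro conjI impI)?;
      use assms curve_angle_facts[of \<rho>] collision_rho_pos pi_gt_zero in linarith)

lemma in_cell:
  assumes "i < 10" "x \<in> cell i"
  obtains \<rho> \<theta> where "x = confocal \<rho> \<theta>" "\<rho> \<in> cell_rho i" "cell_low i \<rho> < \<theta>" "\<theta> < cell_high i \<rho>"
    "0 < \<theta>" "\<theta> < pi"
proof -
  obtain \<rho> \<theta> where "x = confocal \<rho> \<theta>" "\<rho> \<in> cell_rho i" "cell_low i \<rho> < \<theta>" "\<theta> < cell_high i \<rho>"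
    using assms(2) by (auto simp: cell_def band_def)
  then show ?thesis using that cell_bounds[OF assms(1), of \<rho>] by fastforce
qed

lemma cells_cover: "(\<Union>i<10. cell i) = - W_bnr_ext"
proof (intro equalityI subsetI)
  fix x assume "x \<in> (\<Union>i<10. cell i)"
  then obtain i where i: "i < 10" "x \<in> cell i" by auto
  then obtain \<rho> \<theta> where x: "x = confocal \<rho> \<theta>" "\<rho> \<in> cell_rho i" "cell_low i \<rho> < \<theta>" "\<theta> < cell_high i \<rho>"
    "0 < \<theta>" "\<theta> < pi" by (rule in_cell)
  have "\<theta> \<noteq> curve_angle \<rho> \<and> \<theta> \<noteq> pi - curve_angle \<rho> \<and> \<theta> \<noteq> pi / 2"
    using less_10_cases[OF i(1)]
    by (elim disjE; use x(2-) curve_angle_facts[of \<rho>] collision_rho_pos pi_gt_zero in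
      \<open>simp add: cell_simps edge_angle_def; linarith\<close>)
  then show "x \<in> - W_bnr_ext" using confocal_notin_W_bnr_ext_iff x by simp
next
  fix x assume x: "x \<in> - W_bnr_ext"
  obtain \<rho> \<theta> where \<rho>: "x = confocal \<rho> \<theta>" "0 \<le> \<theta>" "\<theta> \<le> pi" by (rule confocal_surj)
  moreover have "confocal \<rho> 0 \<in> W_bnr_ext" "confocal \<rho> pi \<in> W_bnr_ext"
    unfolding W_bnr_ext_eq by blast+
  ultimately have "\<theta> \<noteq> 0" "\<theta> \<noteq> pi" using x by auto
  then have \<theta>: "0 < \<theta>" "\<theta> < pi" using \<rho> by auto
  then have "\<theta> \<noteq> curve_angle \<rho> \<and> \<theta> \<noteq> pi - curve_angle \<rho> \<and> \<theta> \<noteq> pi / 2"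
    using confocal_notin_W_bnr_ext_iff x \<rho>(1) by simp
  then have "cell_index \<rho> \<theta> < 10 \<and> x \<in> cell (cell_index \<rho> \<theta>)"
    using cell_index_works[OF \<theta>, of \<rho>] unfolding \<rho>(1) cell_def band_def by blast
  then show "x \<in> (\<Union>i<10. cell i)" by blast
qed

lemma cells_disjoint:
  assumes "i < 10" "j < 10" "x \<in> cell i" "x \<in> cell j" shows "i = j"
proof -
  obtain \<rho> \<theta> where x: "x = confocal \<rho> \<theta>" "\<rho> \<in> cell_rho i" "cell_low i \<rho> < \<theta>" "\<theta> < cell_high i \<rho>"
    "0 < \<theta>" "\<theta> < pi" using assms(1,3) by (rule in_cell)
  obtain \<rho>' \<theta>' where x': "x = confocal \<rho>' \<theta>'" "\<rho>' \<in> cell_rho j" "cell_low j \<rho>' < \<theta>'" "\<theta>' < cell_high j \<rho>'"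
    "0 < \<theta>'" "\<theta>' < pi" using assms(2,4) by (rule in_cell)
  have "\<rho> = \<rho>'" "\<theta> = \<theta>'" using confocal_inj x x' by metis+
  then show ?thesis
    using cell_index_unique[OF assms(1) x(2-4)] cell_index_unique[OF assms(2) x'(2-4)] by simp
qed

lemma open_connected_cell:
  assumes "i < 10" shows "open (cell i)" "connected (cell i)" "cell i \<noteq> {}"
proof -
  show "open (cell i)" unfolding cell_def
    using cell_bounds[OF assms]
    by (intro open_band continuous_on_cell cell_rho_interval assms) (auto intro: order.trans)
  show "connected (cell i)" unfolding cell_def
    using cell_bounds[OF assms]
    by (intro connected_band continuous_on_cell cell_rho_interval assms) auto
  obtain \<rho> where "\<rho> \<in> cell_rho i" using cell_rho_interval(3)[OF assms] by blast
  moreover from this obtain \<theta> where "cell_low i \<rho> < \<theta>" "\<theta> < cell_high i \<rho>"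
    using cell_bounds[OF assms] dense by blast
  ultimately show "cell i \<noteq> {}" unfolding cell_def band_def by blast
qed

text \<open>A partition of an open set into nonempty open connected sets is its set of
  components.\<close>

lemma components_W_bnr_ext: "components (- W_bnr_ext) = cell ` {..<10}"
proof (rule components_open_unique)
  show "pairwise disjnt (cell ` {..<10})"
    unfolding pairwise_def disjnt_def using cells_disjoint by blast
  show "\<Union> (cell ` {..<10}) = - W_bnr_ext" by (rule cells_cover)
  show "open X \<and> connected X \<and> X \<noteq> {}" if "X \<in> cell ` {..<10}" for X
    using that open_connected_cell by auto
qed

section \<open>Closures of cells and the boundary curves\<close>

lemma closure_cell:
  assumes "i < 10" "\<rho> \<in> closure (cell_rho i)" "cell_low i \<rho> \<le> \<theta>" "\<theta> \<le> cell_high i \<rho>"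
  shows "confocal \<rho> \<theta> \<in> closure (cell i)"
  unfolding cell_def using cell_bounds[OF assms(1)] assms
  by (intro closure_band continuous_on_cell) auto

lemma closure_cell_rho:
  "closure (cell_rho i) = [{0..}, {collision_rho..}, {collision_rho..}, {0..},
     {..0}, {..- collision_rho}, {..- collision_rho}, {..0},
     {- collision_rho..collision_rho}, {- collision_rho..collision_rho}] ! i" if "i < 10"
  using less_10_cases[OF that] collision_rho_pos by (elim disjE; simp add: cell_rho_def)

lemma frontier_cell:
  assumes "i < 10" "A \<subseteq> closure (cell i)" "A \<subseteq> W_bnr_ext"
  shows "A \<subseteq> frontier (cell i)"
proof -
  have "cell i \<inter> W_bnr_ext = {}" using cells_cover assms(1) by blast
  then show ?thesis
    using assms open_connected_cell(1)[OF assms(1)] by (auto simp: frontier_def interior_open)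
qed

definition curve_wedge :: "real set \<Rightarrow> (real \<Rightarrow> real) \<Rightarrow> complex set" where
  "curve_wedge I f = {confocal \<rho> (f \<rho>) | \<rho>. \<rho> \<in> I}"

lemma real_ray_right: "{x. Im x = 0 \<and> Re x \<ge> 2} = range (\<lambda>\<rho>. confocal \<rho> 0)"
proof (intro equalityI subsetI)
  fix x assume "x \<in> {x. Im x = 0 \<and> Re x \<ge> 2}"
  then have "x = confocal (arcosh (Re x / 2)) 0" by (simp add: complex_eq_iff)
  then show "x \<in> range (\<lambda>\<rho>. confocal \<rho> 0)" by blast
qed (auto simp: cosh_real_ge_1)

lemma real_ray_left: "{x. Im x = 0 \<and> Re x \<le> -2} = range (\<lambda>\<rho>. confocal \<rho> pi)"
proof (intro equalityI subsetI)
  fix x assume "x \<in> {x. Im x = 0 \<and> Re x \<le> -2}"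
  then have "x = confocal (arcosh (- Re x / 2)) pi" by (simp add: complex_eq_iff)
  then show "x \<in> range (\<lambda>\<rho>. confocal \<rho> pi)" by blast
qed (auto simp: cosh_real_ge_1)

text \<open>The real rays are the two sides of the strip folded at \<open>\<rho> = 0\<close>. Each
  is reached from above with \<open>\<rho> \<ge> 0\<close> and from below with
  \<open>\<rho> \<le> 0\<close>, hence lies in the closures of cells on both sides.\<close>

lemma real_rays_closed_halves:
  "range (\<lambda>\<rho>. confocal \<rho> 0) = {confocal \<rho> 0 | \<rho>. \<rho> \<ge> 0}"
  "range (\<lambda>\<rho>. confocal \<rho> 0) = {confocal \<rho> 0 | \<rho>. \<rho> \<le> 0}"
  "range (\<lambda>\<rho>. confocal \<rho> pi) = {confocal \<rho> pi | \<rho>. \<rho> \<ge> 0}"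
  "range (\<lambda>\<rho>. confocal \<rho> pi) = {confocal \<rho> pi | \<rho>. \<rho> \<le> 0}"
proof -
  have "confocal \<rho> \<theta> \<in> {confocal \<rho> \<theta> | \<rho>. \<rho> \<ge> 0} \<and> confocal \<rho> \<theta> \<in> {confocal \<rho> \<theta> | \<rho>. \<rho> \<le> 0}"
    if "\<theta> = 0 \<or> \<theta> = pi" for \<rho> \<theta>
  proof -
    have "confocal \<rho> \<theta> = confocal (- \<rho>) \<theta>" using that by (auto simp: complex_eq_iff)
    then show ?thesis unfolding mem_Collect_eq by (metis linear neg_0_le_iff_le neg_le_0_iff_le)
  qed
  then show "range (\<lambda>\<rho>. confocal \<rho> 0) = {confocal \<rho> 0 | \<rho>. \<rho> \<ge> 0}"
    "range (\<lambda>\<rho>. confocal \<rho> 0) = {confocal \<rho> 0 | \<rho>. \<rho> \<le> 0}"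
    "range (\<lambda>\<rho>. confocal \<rho> pi) = {confocal \<rho> pi | \<rho>. \<rho> \<ge> 0}"
    "range (\<lambda>\<rho>. confocal \<rho> pi) = {confocal \<rho> pi | \<rho>. \<rho> \<le> 0}"
    by blast+
qed

lemma Re_confocal_curve_nonneg:
  "Re (confocal \<rho> (curve_angle \<rho>)) \<ge> 0 \<longleftrightarrow> \<bar>\<rho>\<bar> \<le> collision_rho"
  "Re (confocal \<rho> (curve_angle \<rho>)) \<le> 0 \<longleftrightarrow> \<bar>\<rho>\<bar> \<ge> collision_rho"
proof -
  have c: "cosh \<rho> > 0" by (rule cosh_real_pos)
  have "cos (curve_angle \<rho>) > 0" if "curve_angle \<rho> < pi / 2"
    using that curve_angle_bounds[of \<rho>] by (intro cos_gt_zero_pi) linarith+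
  moreover have "cos (curve_angle \<rho>) < 0" if "curve_angle \<rho> > pi / 2"
    using that curve_angle_bounds[of \<rho>] cos_monotone_0_pi[of "pi / 2" "curve_angle \<rho>"] by simp
  moreover have "cos (curve_angle \<rho>) = 0" if "curve_angle \<rho> = pi / 2"
    unfolding that by simp
  ultimately have "\<bar>\<rho>\<bar> < collision_rho \<and> cos (curve_angle \<rho>) > 0 \<or>
    \<bar>\<rho>\<bar> = collision_rho \<and> cos (curve_angle \<rho>) = 0 \<or> \<bar>\<rho>\<bar> > collision_rho \<and> cos (curve_angle \<rho>) < 0"
    using curve_angle_facts(4)[of \<rho>] by blast
  moreover have re: "Re (confocal \<rho> (curve_angle \<rho>)) = 2 * (cosh \<rho> * cos (curve_angle \<rho>))" by simp
  moreover have "0 \<le> cosh \<rho> * cos (curve_angle \<rho>) \<longleftrightarrow> 0 \<le> cos (curve_angle \<rho>)"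
    using mult_le_cancel_left_pos[OF c, of 0 "cos (curve_angle \<rho>)"] by (simp only: mult_zero_right)
  moreover have "cosh \<rho> * cos (curve_angle \<rho>) \<le> 0 \<longleftrightarrow> cos (curve_angle \<rho>) \<le> 0"
    using mult_le_cancel_left_pos[OF c, of "cos (curve_angle \<rho>)" 0] by (simp only: mult_zero_right)
  ultimately show "Re (confocal \<rho> (curve_angle \<rho>)) \<ge> 0 \<longleftrightarrow> \<bar>\<rho>\<bar> \<le> collision_rho"
    "Re (confocal \<rho> (curve_angle \<rho>)) \<le> 0 \<longleftrightarrow> \<bar>\<rho>\<bar> \<ge> collision_rho"
    by linarith+
qed

lemma Im_confocal_sgn:
  assumes "0 \<le> \<theta>" "\<theta> \<le> pi"
  shows "Im (confocal \<rho> \<theta>) > 0 \<Longrightarrow> \<rho> > 0" "Im (confocal \<rho> \<theta>) < 0 \<Longrightarrow> \<rho> < 0"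
  using sin_ge_zero[OF assms] by (auto simp: zero_less_mult_iff mult_less_0_iff)

text \<open>The sign of the real part forces \<open>\<rho>\<close> beyond
  \<open>collision_rho\<close> in absolute value, and the sign of the imaginary part is the sign of
  \<open>\<rho>\<close>.\<close>

lemma curve_beyond_collision:
  "x \<in> \<Union> (spectral_curves b_left) \<Longrightarrow> Re x \<ge> 0 \<Longrightarrow> Im x > 0 \<Longrightarrow>
     \<exists>\<rho>\<ge>collision_rho. x = confocal \<rho> (pi - curve_angle \<rho>)"
  "x \<in> \<Union> (spectral_curves b_left) \<Longrightarrow> Re x \<ge> 0 \<Longrightarrow> Im x < 0 \<Longrightarrow>
     \<exists>\<rho>\<le>- collision_rho. x = confocal \<rho> (pi - curve_angle \<rho>)"
  "x \<in> \<Union> (spectral_curves b_right) \<Longrightarrow> Re x \<le> 0 \<Longrightarrow> Im x > 0 \<Longrightarrow>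
     \<exists>\<rho>\<ge>collision_rho. x = confocal \<rho> (curve_angle \<rho>)"
  "x \<in> \<Union> (spectral_curves b_right) \<Longrightarrow> Re x \<le> 0 \<Longrightarrow> Im x < 0 \<Longrightarrow>
     \<exists>\<rho>\<le>- collision_rho. x = confocal \<rho> (curve_angle \<rho>)"
proof -
  have right: "\<exists>\<rho>. x = confocal \<rho> (curve_angle \<rho>) \<and> \<bar>\<rho>\<bar> \<ge> collision_rho \<and>
      (Im x > 0 \<longrightarrow> \<rho> > 0) \<and> (Im x < 0 \<longrightarrow> \<rho> < 0)"
    if x: "x \<in> \<Union> (spectral_curves b_right)" and "Re x \<le> 0" "Im x \<noteq> 0" for x
  proof -
    obtain \<rho> where \<rho>: "x = confocal \<rho> (curve_angle \<rho>)"
      using x \<open>Im x \<noteq> 0\<close> unfolding Union_spectral_curves_right by auto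
    moreover have "\<bar>\<rho>\<bar> \<ge> collision_rho"
      using \<open>Re x \<le> 0\<close> Re_confocal_curve_nonneg(2) unfolding \<rho> by blast
    ultimately show ?thesis
      using Im_confocal_sgn[of "curve_angle \<rho>" \<rho>] curve_angle_bounds[of \<rho>] less_imp_le by blast
  qed
  have left: "\<exists>\<rho>. x = confocal \<rho> (pi - curve_angle \<rho>) \<and> \<bar>\<rho>\<bar> \<ge> collision_rho \<and>
      (Im x > 0 \<longrightarrow> \<rho> > 0) \<and> (Im x < 0 \<longrightarrow> \<rho> < 0)"
    if x: "x \<in> \<Union> (spectral_curves b_left)" and "Re x \<ge> 0" "Im x \<noteq> 0" for x
  proof -
    obtain \<rho> where \<rho>: "x = confocal \<rho> (pi - curve_angle \<rho>)"
      using x \<open>Im x \<noteq> 0\<close> unfolding Union_spectral_curves_left by auto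
    have "Re (confocal \<rho> (curve_angle \<rho>)) \<le> 0" using \<open>Re x \<ge> 0\<close> unfolding \<rho> by simp
    then have "\<bar>\<rho>\<bar> \<ge> collision_rho" using Re_confocal_curve_nonneg(2) by blast
    then show ?thesis
      using \<rho> Im_confocal_sgn[of "pi - curve_angle \<rho>" \<rho>] curve_angle_bounds[of \<rho>]
      by (intro exI[of _ \<rho>]) auto
  qed
  show "\<exists>\<rho>\<ge>collision_rho. x = confocal \<rho> (pi - curve_angle \<rho>)"
    if x: "x \<in> \<Union> (spectral_curves b_left)" "Re x \<ge> 0" "Im x > 0"
  proof -
    obtain \<rho> where "x = confocal \<rho> (pi - curve_angle \<rho>)" "\<bar>\<rho>\<bar> \<ge> collision_rho" "\<rho> > 0"
      using left[OF x(1,2)] x(3) by fastforce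
    then show ?thesis by (intro exI[of _ \<rho>]) auto
  qed
  show "\<exists>\<rho>\<le>- collision_rho. x = confocal \<rho> (pi - curve_angle \<rho>)"
    if x: "x \<in> \<Union> (spectral_curves b_left)" "Re x \<ge> 0" "Im x < 0"
  proof -
    obtain \<rho> where "x = confocal \<rho> (pi - curve_angle \<rho>)" "\<bar>\<rho>\<bar> \<ge> collision_rho" "\<rho> < 0"
      using left[OF x(1,2)] x(3) by fastforce
    then show ?thesis by (intro exI[of _ \<rho>]) auto
  qed
  show "\<exists>\<rho>\<ge>collision_rho. x = confocal \<rho> (curve_angle \<rho>)"
    if x: "x \<in> \<Union> (spectral_curves b_right)" "Re x \<le> 0" "Im x > 0"
  proof -
    obtain \<rho> where "x = confocal \<rho> (curve_angle \<rho>)" "\<bar>\<rho>\<bar> \<ge> collision_rho" "\<rho> > 0"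
      using right[OF x(1,2)] x(3) by fastforce
    then show ?thesis by (intro exI[of _ \<rho>]) auto
  qed
  show "\<exists>\<rho>\<le>- collision_rho. x = confocal \<rho> (curve_angle \<rho>)"
    if x: "x \<in> \<Union> (spectral_curves b_right)" "Re x \<le> 0" "Im x < 0"
  proof -
    obtain \<rho> where "x = confocal \<rho> (curve_angle \<rho>)" "\<bar>\<rho>\<bar> \<ge> collision_rho" "\<rho> < 0"
      using right[OF x(1,2)] x(3) by fastforce
    then show ?thesis by (intro exI[of _ \<rho>]) auto
  qed
qed

text \<open>The facts on \<open>curve_angle\<close> are supplied as premises, so that each concrete
  inclusion reduces to linear inequalities at a single \<open>\<rho>\<close>.\<close>

lemma wedge_subset_closure_cell:
  assumes "i < 10"
    and "\<And>\<rho>. \<rho> \<in> I \<Longrightarrow> 0 \<le> curve_angle \<rho> \<Longrightarrow> curve_angle \<rho> < pi \<Longrightarrow>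
      \<bar>\<rho>\<bar> < collision_rho \<and> curve_angle \<rho> < pi / 2 \<or>
      \<bar>\<rho>\<bar> = collision_rho \<and> curve_angle \<rho> = pi / 2 \<or>
      \<bar>\<rho>\<bar> > collision_rho \<and> curve_angle \<rho> > pi / 2 \<Longrightarrow>
      collision_rho > 0 \<Longrightarrow> pi > 0 \<Longrightarrow>
      \<rho> \<in> [{0..}, {collision_rho..}, {collision_rho..}, {0..},
       {..0}, {..- collision_rho}, {..- collision_rho}, {..0},
       {- collision_rho..collision_rho}, {- collision_rho..collision_rho}] ! i \<and>
      cell_low i \<rho> \<le> f \<rho> \<and> f \<rho> \<le> cell_high i \<rho>"
  shows "curve_wedge I f \<subseteq> closure (cell i)"
proof
  fix x assume "x \<in> curve_wedge I f"
  then obtain \<rho> where "\<rho> \<in> I" and x: "x = confocal \<rho> (f \<rho>)" by (auto simp: curve_wedge_def)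
  note assms(2)[OF this(1) curve_angle_facts(1,2,4) collision_rho_pos pi_gt_zero]
  then show "x \<in> closure (cell i)"
    unfolding x using closure_cell_rho[OF assms(1)] by (intro closure_cell assms(1)) simp_all
qed

text \<open>The real rays appear with both half-lines of \<open>\<rho>\<close>, one for each
  adjacent cell. Index 8 is curve 0 again, met as the successor of curve 7.\<close>

lemma boundary_curve_wedge:
  "boundary_curve 0 = curve_wedge {0..} (\<lambda>_. 0)" "boundary_curve 0 = curve_wedge {..0} (\<lambda>_. 0)"
  "boundary_curve 1 \<subseteq> curve_wedge {collision_rho..} (\<lambda>\<rho>. pi - curve_angle \<rho>)"
  "boundary_curve 2 = curve_wedge {collision_rho..} (\<lambda>_. pi / 2)"
  "boundary_curve 3 \<subseteq> curve_wedge {collision_rho..} curve_angle"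
  "boundary_curve 4 = curve_wedge {0..} (\<lambda>_. pi)" "boundary_curve 4 = curve_wedge {..0} (\<lambda>_. pi)"
  "boundary_curve 5 \<subseteq> curve_wedge {..- collision_rho} curve_angle"
  "boundary_curve 6 = curve_wedge {..- collision_rho} (\<lambda>_. pi / 2)"
  "boundary_curve 7 \<subseteq> curve_wedge {..- collision_rho} (\<lambda>\<rho>. pi - curve_angle \<rho>)"
  "boundary_curve 8 = curve_wedge {..0} (\<lambda>_. 0)"
proof -
  note [simp] = boundary_curve_def curve_wedge_def
  show 1: "boundary_curve 0 = curve_wedge {0..} (\<lambda>_. 0)" "boundary_curve 0 = curve_wedge {..0} (\<lambda>_. 0)"
    using real_ray_right real_rays_closed_halves(1,2) by simp_all
  show "boundary_curve 8 = curve_wedge {..0} (\<lambda>_. 0)" using 1 by simp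
  show "boundary_curve 4 = curve_wedge {0..} (\<lambda>_. pi)" "boundary_curve 4 = curve_wedge {..0} (\<lambda>_. pi)"
    using real_ray_left real_rays_closed_halves(3,4) by simp_all
  show "boundary_curve 2 = curve_wedge {collision_rho..} (\<lambda>_. pi / 2)"
    using upper_collision_line_eq by simp
  show "boundary_curve 6 = curve_wedge {..- collision_rho} (\<lambda>_. pi / 2)"
    using lower_collision_line_eq by simp
  show "boundary_curve 1 \<subseteq> curve_wedge {collision_rho..} (\<lambda>\<rho>. pi - curve_angle \<rho>)"
    using curve_beyond_collision(1) by auto
  show "boundary_curve 7 \<subseteq> curve_wedge {..- collision_rho} (\<lambda>\<rho>. pi - curve_angle \<rho>)"
    using curve_beyond_collision(2) by auto
  show "boundary_curve 3 \<subseteq> curve_wedge {collision_rho..} curve_angle"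
    using curve_beyond_collision(3) by auto
  show "boundary_curve 5 \<subseteq> curve_wedge {..- collision_rho} curve_angle"
    using curve_beyond_collision(4) by auto
qed


lemma curve_wedge_W_bnr_ext:
  "curve_wedge I (\<lambda>_. 0) \<subseteq> W_bnr_ext" "curve_wedge I curve_angle \<subseteq> W_bnr_ext"
  "curve_wedge I (\<lambda>\<rho>. pi - curve_angle \<rho>) \<subseteq> W_bnr_ext" "curve_wedge I (\<lambda>_. pi / 2) \<subseteq> W_bnr_ext"
  "curve_wedge I (\<lambda>_. pi) \<subseteq> W_bnr_ext"
  unfolding curve_wedge_def W_bnr_ext_eq by blast+

lemma less_8_cases:
  assumes "k < (8::nat)"
  shows "k = 0 \<or> k = 1 \<or> k = 2 \<or> k = 3 \<or> k = 4 \<or> k = 5 \<or> k = 6 \<or> k = 7"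
  using assms by auto

lemma boundary_curve_subset_W_bnr_ext:
  "boundary_curve 0 \<subseteq> W_bnr_ext" "boundary_curve 1 \<subseteq> W_bnr_ext" "boundary_curve 2 \<subseteq> W_bnr_ext"
  "boundary_curve 3 \<subseteq> W_bnr_ext" "boundary_curve 4 \<subseteq> W_bnr_ext" "boundary_curve 5 \<subseteq> W_bnr_ext"
  "boundary_curve 6 \<subseteq> W_bnr_ext" "boundary_curve 7 \<subseteq> W_bnr_ext" "boundary_curve 8 \<subseteq> W_bnr_ext"
  unfolding boundary_curve_wedge(1,4,6,9,11)
  by (rule curve_wedge_W_bnr_ext order.trans[OF boundary_curve_wedge(3) curve_wedge_W_bnr_ext(3)]
      order.trans[OF boundary_curve_wedge(5) curve_wedge_W_bnr_ext(2)]
      order.trans[OF boundary_curve_wedge(8) curve_wedge_W_bnr_ext(2)]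
      order.trans[OF boundary_curve_wedge(10) curve_wedge_W_bnr_ext(3)])+

text \<open>The first sixteen items pair each outer cell with its two boundary curves; the last ten
  treat the four sides of the square and the backward collision line, each with the cells on both
  sides.\<close>

lemma wedges_in_closure:
  "curve_wedge {0..} (\<lambda>_. 0) \<subseteq> closure (cell 0)"
  "curve_wedge {collision_rho..} (\<lambda>\<rho>. pi - curve_angle \<rho>) \<subseteq> closure (cell 0)"
  "curve_wedge {collision_rho..} (\<lambda>\<rho>. pi - curve_angle \<rho>) \<subseteq> closure (cell 1)"
  "curve_wedge {collision_rho..} (\<lambda>_. pi / 2) \<subseteq> closure (cell 1)"
  "curve_wedge {collision_rho..} (\<lambda>_. pi / 2) \<subseteq> closure (cell 2)"
  "curve_wedge {collision_rho..} curve_angle \<subseteq> closure (cell 2)"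
  "curve_wedge {collision_rho..} curve_angle \<subseteq> closure (cell 3)"
  "curve_wedge {0..} (\<lambda>_. pi) \<subseteq> closure (cell 3)"
  "curve_wedge {..0} (\<lambda>_. pi) \<subseteq> closure (cell 4)"
  "curve_wedge {..- collision_rho} curve_angle \<subseteq> closure (cell 4)"
  "curve_wedge {..- collision_rho} curve_angle \<subseteq> closure (cell 5)"
  "curve_wedge {..- collision_rho} (\<lambda>_. pi / 2) \<subseteq> closure (cell 5)"
  "curve_wedge {..- collision_rho} (\<lambda>_. pi / 2) \<subseteq> closure (cell 6)"
  "curve_wedge {..- collision_rho} (\<lambda>\<rho>. pi - curve_angle \<rho>) \<subseteq> closure (cell 6)"
  "curve_wedge {..- collision_rho} (\<lambda>\<rho>. pi - curve_angle \<rho>) \<subseteq> closure (cell 7)"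
  "curve_wedge {..0} (\<lambda>_. 0) \<subseteq> closure (cell 7)"
  "curve_wedge {0..collision_rho} curve_angle \<subseteq> closure (cell 0)"
  "curve_wedge {0..collision_rho} curve_angle \<subseteq> closure (cell 9)"
  "curve_wedge {- collision_rho..0} curve_angle \<subseteq> closure (cell 7)"
  "curve_wedge {- collision_rho..0} curve_angle \<subseteq> closure (cell 9)"
  "curve_wedge {0..collision_rho} (\<lambda>\<rho>. pi - curve_angle \<rho>) \<subseteq> closure (cell 3)"
  "curve_wedge {0..collision_rho} (\<lambda>\<rho>. pi - curve_angle \<rho>) \<subseteq> closure (cell 8)"
  "curve_wedge {- collision_rho..0} (\<lambda>\<rho>. pi - curve_angle \<rho>) \<subseteq> closure (cell 4)"
  "curve_wedge {- collision_rho..0} (\<lambda>\<rho>. pi - curve_angle \<rho>) \<subseteq> closure (cell 8)"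
  "curve_wedge {- collision_rho..collision_rho} (\<lambda>_. pi / 2) \<subseteq> closure (cell 8)"
  "curve_wedge {- collision_rho..collision_rho} (\<lambda>_. pi / 2) \<subseteq> closure (cell 9)"
  by (rule wedge_subset_closure_cell; simp add: cell_simps edge_angle_def; (intro conjI)?; linarith)+

lemma cell_unbounded:
  assumes "i < 8" shows "\<not> bounded (cell i)"
proof
  assume "bounded (cell i)"
  then obtain B where B: "\<And>x. x \<in> cell i \<Longrightarrow> norm x \<le> B" by (auto simp: bounded_iff)
  \<comment> \<open>Beyond \<open>collision_rho\<close>, so that \<open>r\<close> or
    \<open>- r\<close> lies in the range of every outer cell, and large enough for
    \<open>sinh r\<close> to exceed the supposed bound. The norm of a confocal point is at least
    \<open>2 * \<bar>sinh \<rho>\<bar>\<close>, whatever its angle.\<close>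
  define r where "r = collision_rho + 1 + \<bar>arsinh (\<bar>B\<bar>)\<bar>"
  have i10: "i < 10" using assms by simp
  obtain \<rho> where \<rho>: "\<rho> \<in> cell_rho i" "\<bar>\<rho>\<bar> = r"
  proof -
    have "r \<in> cell_rho i \<or> - r \<in> cell_rho i"
      using less_8_cases[OF assms] collision_rho_pos by (elim disjE; simp add: cell_rho_def r_def; linarith)
    moreover have "r > 0" using collision_rho_pos by (simp add: r_def add_pos_nonneg)
    ultimately show ?thesis using that[of r] that[of "- r"] by auto
  qed
  obtain \<theta> where "cell_low i \<rho> < \<theta>" "\<theta> < cell_high i \<rho>"
    using cell_bounds[OF i10 \<rho>(1)] dense by blast
  then have "norm (confocal \<rho> \<theta>) \<le> B" using \<rho>(1) by (intro B) (auto simp: cell_def band_def)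
  moreover have "(2 * sinh \<rho>)^2 \<le> (norm (confocal \<rho> \<theta>))^2"
  proof -
    have "(norm (confocal \<rho> \<theta>))^2 = 4 * ((cos \<theta>)^2 * (1 + (sinh \<rho>)^2) + (sin \<theta>)^2 * (sinh \<rho>)^2)"
      by (simp add: cmod_power2 power_mult_distrib cosh_square_eq algebra_simps)
    also have "\<dots> = 4 * ((cos \<theta>)^2 + (sinh \<rho>)^2 * ((sin \<theta>)^2 + (cos \<theta>)^2))"
      by (simp only: algebra_simps)
    also have "\<dots> = 4 * (cos \<theta>)^2 + (2 * sinh \<rho>)^2" by (simp add: power_mult_distrib)
    finally show ?thesis by simp
  qed
  moreover have "sinh r > \<bar>B\<bar>"
  proof -
    have "arsinh \<bar>B\<bar> < r" using collision_rho_pos by (simp add: r_def)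
    then have "sinh (arsinh \<bar>B\<bar>) < sinh r" by (simp only: sinh_real_less_iff)
    then show ?thesis by simp
  qed
  moreover have "\<bar>2 * sinh \<rho>\<bar> = 2 * sinh r"
    using \<rho>(2) by (auto simp: abs_if split: if_splits)
  ultimately show False
    using abs_le_square_iff[of "2 * sinh \<rho>" "norm (confocal \<rho> \<theta>)"] by simp
qed

text \<open>As \<open>is_h_phi\<close> speaks of every region with this property, exhibiting one for
  each \<open>k\<close> gives the sector into which its closure is mapped.\<close>

lemma is_outer_region_cell:
  assumes "k < 8" shows "is_outer_region k (cell k)"
proof -
  have fr: "A \<subseteq> closure (cell k) \<Longrightarrow> A \<subseteq> W_bnr_ext \<Longrightarrow> A \<subseteq> frontier (cell k)" for A
    using frontier_cell[of k A] assms by simp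
  have "boundary_curve k \<subseteq> closure (cell k) \<and> boundary_curve (Suc k) \<subseteq> closure (cell k) \<and>
    boundary_curve k \<subseteq> W_bnr_ext \<and> boundary_curve (Suc k) \<subseteq> W_bnr_ext"
  proof -
    note b = boundary_curve_wedge and w = wedges_in_closure
    note closures = order.trans[OF equalityD1[OF b(1)] w(1)] order.trans[OF b(3) w(2)]
      order.trans[OF b(3) w(3)] order.trans[OF equalityD1[OF b(4)] w(4)]
      order.trans[OF equalityD1[OF b(4)] w(5)] order.trans[OF b(5) w(6)]
      order.trans[OF b(5) w(7)] order.trans[OF equalityD1[OF b(6)] w(8)]
      order.trans[OF equalityD1[OF b(7)] w(9)] order.trans[OF b(8) w(10)]
      order.trans[OF b(8) w(11)] order.trans[OF equalityD1[OF b(9)] w(12)]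
      order.trans[OF equalityD1[OF b(9)] w(13)] order.trans[OF b(10) w(14)]
      order.trans[OF b(10) w(15)] order.trans[OF equalityD1[OF b(11)] w(16)]
    have "Suc 0 = 1" "Suc 1 = 2" "Suc 2 = 3" "Suc 3 = 4" "Suc 4 = 5" "Suc 5 = 6" "Suc 6 = 7" "Suc 7 = 8"
      by simp_all
    then show ?thesis
      using less_8_cases[OF assms] closures boundary_curve_subset_W_bnr_ext by metis
  qed
  moreover have "cell k \<in> components (- W_bnr_ext)"
    unfolding components_W_bnr_ext using assms by simp
  ultimately show ?thesis
    unfolding is_outer_region_def using fr cell_unbounded[OF assms] by blast
qed

lemma inner_cells: "is_left_half (cell 8)" "is_right_half (cell 9)"
proof -
  have "bounded (cell i) \<and> (\<forall>x\<in>cell i. if i = 8 then Re x < 0 else Re x > 0)" if i: "i = 8 \<or> i = 9" for i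
  proof
    have in_strip: "\<bar>\<rho>\<bar> < collision_rho \<and> (if i = 8 then cos \<theta> < 0 else cos \<theta> > 0)"
      if *: "\<rho> \<in> cell_rho i" "cell_low i \<rho> < \<theta>" "\<theta> < cell_high i \<rho>" "0 < \<theta>" "\<theta> < pi" for \<rho> \<theta>
    proof -
      have "\<bar>\<rho>\<bar> < collision_rho" using i *(1) by (auto simp: cell_rho_def)
      moreover have "cos \<theta> < 0" if "i = 8"
        using that *(2-) cos_monotone_0_pi[of "pi / 2" \<theta>] by (simp add: cell_simps)
      moreover have "cos \<theta> > 0" if "i = 9"
        using that *(2-) by (intro cos_gt_zero_pi) (simp_all add: cell_simps)
      ultimately show ?thesis using i by auto
    qed
    have "norm x \<le> 2 * cosh collision_rho + 2 * sinh collision_rho" if x: "x \<in> cell i" for x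
    proof -
      have "i < 10" using i by auto
      from this x obtain \<rho> \<theta> where \<rho>: "x = confocal \<rho> \<theta>" "\<rho> \<in> cell_rho i" "cell_low i \<rho> < \<theta>" "\<theta> < cell_high i \<rho>"
        "0 < \<theta>" "\<theta> < pi" by (rule in_cell)
      have r: "\<bar>\<rho>\<bar> < collision_rho" using in_strip \<rho> by blast
      have "cosh \<rho> = cosh \<bar>\<rho>\<bar>" by (simp add: abs_if)
      also have "\<dots> \<le> cosh collision_rho" using r by (subst cosh_real_nonneg_le_iff) auto
      finally have c: "cosh \<rho> \<le> cosh collision_rho" .
      have "\<bar>sinh \<rho>\<bar> = sinh \<bar>\<rho>\<bar>" by (simp add: abs_if)
      also have "\<dots> \<le> sinh collision_rho" using r by (simp only: sinh_real_le_iff)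
      finally have s: "\<bar>sinh \<rho>\<bar> \<le> sinh collision_rho" .
      have "norm x \<le> \<bar>2 * cos \<theta> * cosh \<rho>\<bar> + \<bar>2 * sin \<theta> * sinh \<rho>\<bar>"
        using cmod_le[of x] by (simp add: \<rho>(1))
      also have "\<bar>2 * cos \<theta> * cosh \<rho>\<bar> \<le> 2 * 1 * cosh collision_rho"
        using c by (simp add: abs_mult cosh_real_nonneg mult_mono)
      also have "\<bar>2 * sin \<theta> * sinh \<rho>\<bar> \<le> 2 * 1 * sinh collision_rho"
        unfolding abs_mult using s by (intro mult_mono) auto
      finally show ?thesis by simp
    qed
    then show "bounded (cell i)" unfolding bounded_iff by blast
    show "\<forall>x\<in>cell i. if i = 8 then Re x < 0 else Re x > 0"
    proof
      fix x assume x: "x \<in> cell i"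
      have "i < 10" using i by auto
      from this x obtain \<rho> \<theta> where \<rho>: "x = confocal \<rho> \<theta>" "\<rho> \<in> cell_rho i" "cell_low i \<rho> < \<theta>" "\<theta> < cell_high i \<rho>"
        "0 < \<theta>" "\<theta> < pi" by (rule in_cell)
      then have "if i = 8 then cos \<theta> < 0 else cos \<theta> > 0" using in_strip by blast
      then show "if i = 8 then Re x < 0 else Re x > 0"
        unfolding \<rho>(1) Re_confocal using cosh_real_pos[of \<rho>]
        by (auto simp: mult_less_0_iff zero_less_mult_iff split: if_splits)
    qed
  qed
  from this[of 8] this[of 9] show "is_left_half (cell 8)" "is_right_half (cell 9)"
    unfolding is_left_half_def is_right_half_def components_W_bnr_ext by auto
qed

text \<open>The thirteen pairs are the cells facing each other across the eight boundary curves, the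
  four sides of the square and the backward collision line.\<close>

lemma W_bnr_ext_closures:
  assumes "x \<in> W_bnr_ext"
  shows "(\<exists>(i, j) \<in> {(7, 0), (0, 1), (1, 2), (2, 3), (3, 4), (4, 5), (5, 6), (6, 7),
      (0, 9), (7, 9), (3, 8), (4, 8), (8, 9)}. x \<in> closure (cell i) \<and> x \<in> closure (cell j))"
proof -
  have wedge: "confocal \<rho> (f \<rho>) \<in> A" if "curve_wedge I f \<subseteq> A" "\<rho> \<in> I" for \<rho> I f A
    using that by (auto simp: curve_wedge_def)
  note w = wedges_in_closure[THEN wedge]
  obtain \<rho> where "x = confocal \<rho> 0 \<or> x = confocal \<rho> pi \<or> x = confocal \<rho> (curve_angle \<rho>) \<or>
      x = confocal \<rho> (pi - curve_angle \<rho>) \<or> x = confocal \<rho> (pi / 2)"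
    using assms unfolding W_bnr_ext_eq by blast
  then show ?thesis
  proof (elim disjE)
    assume x: "x = confocal \<rho> 0"
    have "confocal \<bar>\<rho>\<bar> 0 \<in> closure (cell 0)" "confocal (- \<bar>\<rho>\<bar>) 0 \<in> closure (cell 7)"
      using w(1)[of "\<bar>\<rho>\<bar>"] w(16)[of "- \<bar>\<rho>\<bar>"] by simp_all
    moreover have "confocal \<bar>\<rho>\<bar> 0 = x" "confocal (- \<bar>\<rho>\<bar>) 0 = x" by (simp_all add: x complex_eq_iff)
    ultimately show ?thesis by simp
  next
    assume x: "x = confocal \<rho> pi"
    have "confocal \<bar>\<rho>\<bar> pi \<in> closure (cell 3)" "confocal (- \<bar>\<rho>\<bar>) pi \<in> closure (cell 4)"
      using w(8)[of "\<bar>\<rho>\<bar>"] w(9)[of "- \<bar>\<rho>\<bar>"] by simp_all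
    moreover have "confocal \<bar>\<rho>\<bar> pi = x" "confocal (- \<bar>\<rho>\<bar>) pi = x" by (simp_all add: x complex_eq_iff)
    ultimately show ?thesis by simp
  next
    assume x: "x = confocal \<rho> (curve_angle \<rho>)"
    consider "\<rho> \<ge> collision_rho" | "0 \<le> \<rho>" "\<rho> \<le> collision_rho" | "- collision_rho \<le> \<rho>" "\<rho> \<le> 0"
      | "\<rho> \<le> - collision_rho" by linarith
    then show ?thesis
      unfolding x using w(6,7,10,11,17-20)[of \<rho>] by cases simp_all
  next
    assume x: "x = confocal \<rho> (pi - curve_angle \<rho>)"
    consider "\<rho> \<ge> collision_rho" | "0 \<le> \<rho>" "\<rho> \<le> collision_rho" | "- collision_rho \<le> \<rho>" "\<rho> \<le> 0"
      | "\<rho> \<le> - collision_rho" by linarith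
    then show ?thesis
      unfolding x using w(2,3,14,15,21-24)[of \<rho>] by cases simp_all
  next
    assume x: "x = confocal \<rho> (pi / 2)"
    consider "\<rho> \<ge> collision_rho" | "- collision_rho \<le> \<rho>" "\<rho> \<le> collision_rho"
      | "\<rho> \<le> - collision_rho" by linarith
    then show ?thesis
      unfolding x using w(4,5,12,13,25,26)[of \<rho>] by cases simp_all
  qed
qed

section \<open>Hexagons and charts\<close>

text \<open>A walk on a cycle that does not backtrack keeps its direction; the primed version is for
  the other direction.\<close>

lemma cyclic_step:
  fixes n x y z :: nat
  assumes "x < n" "y < n" "z < n" "x \<noteq> z" "y = Suc x mod n" "z = Suc y mod n \<or> y = Suc z mod n"
  shows "z = Suc y mod n"
  using assms by (auto simp: mod_Suc split: if_splits)

lemma cyclic_step':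
  fixes n x y z :: nat
  assumes "x < n" "y < n" "z < n" "x \<noteq> z" "x = Suc y mod n" "z = Suc y mod n \<or> y = Suc z mod n"
  shows "y = Suc z mod n"
  using assms by (auto simp: mod_Suc split: if_splits)

text \<open>Four edges without backtracking run around a hexagon in one direction, and its two
  remaining edges join the ends through one vertex. The contrapositive is used: if the ends have no
  common neighbour, the construction completes the path.\<close>

lemma in_hexagon_common_neighbour:
  assumes v: "is_path4 E v" and hex: "in_hexagon E v"
  obtains u where "{v 0, u} \<in> E" "{u, v 4} \<in> E"
proof -
  obtain w where w: "is_hexagon E w"
    and e: "\<And>i. i < 4 \<Longrightarrow> {v i, v (Suc i)} \<in> {{w j, w (Suc j mod 6)} | j. j < 6}"
    using hex unfolding in_hexagon_def by blast
  have edge: "\<exists>a b. a < 6 \<and> b < 6 \<and> v i = w a \<and> v (Suc i) = w b \<and> (b = Suc a mod 6 \<or> a = Suc b mod 6)"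
    if i: "i < 4" for i
  proof -
    obtain j where j: "j < 6" "{v i, v (Suc i)} = {w j, w (Suc j mod 6)}" using e[OF i] by blast
    then consider "v i = w j" "v (Suc i) = w (Suc j mod 6)" | "v i = w (Suc j mod 6)" "v (Suc i) = w j"
      by (auto simp: doubleton_eq_iff)
    then show ?thesis
    proof cases
      case 1 then show ?thesis using j(1) by (intro exI[of _ j] exI[of _ "Suc j mod 6"]) simp
    next
      case 2 then show ?thesis using j(1) by (intro exI[of _ "Suc j mod 6"] exI[of _ j]) simp
    qed
  qed
  have inj: "a = b" if "w a = w b" "a < 6" "b < 6" for a b
    using w that by (auto simp: is_hexagon_def inj_on_def)
  define a where "a = (\<lambda>i. THE j. j < 6 \<and> v i = w j)"
  have a: "a i < 6 \<and> v i = w (a i)" if "i \<le> 4" for i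
  proof -
    have "\<exists>j. j < 6 \<and> v i = w j"
      using edge[of i] edge[of 3] that by (cases "i < 4") (auto simp: le_less)
    then have "\<exists>!j. j < 6 \<and> v i = w j" using inj by metis
    then show ?thesis unfolding a_def by (rule theI')
  qed
  have step: "a (Suc i) = Suc (a i) mod 6 \<or> a i = Suc (a (Suc i)) mod 6" if i: "i < 4" for i
  proof -
    obtain b c where "b < 6" "c < 6" "v i = w b" "v (Suc i) = w c" "c = Suc b mod 6 \<or> b = Suc c mod 6"
      using edge[OF i] by blast
    moreover from this have "b = a i" "c = a (Suc i)"
      using a[of i] a[of "Suc i"] i inj[of b "a i"] inj[of c "a (Suc i)"] by simp_all
    ultimately show ?thesis by simp
  qed
  have nb: "a i \<noteq> a (Suc (Suc i))" if "i < 3" for i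
    using v a[of i] a[of "Suc (Suc i)"] that unfolding is_path4_def by force
  have a6: "a i < 6" if "i \<le> 4" for i using a that by blast
  have n: "Suc 0 = 1" "Suc 1 = 2" "Suc 2 = 3" "Suc 3 = 4" by simp_all
  \<comment> \<open>The vertex left over: the successor of the last vertex if the path runs forward,
    otherwise the successor of the first one.\<close>
  define u where "u = (if a 1 = Suc (a 0) mod 6 then Suc (a 4) mod 6 else Suc (a 0) mod 6)"
  have lt: "a 0 < 6" "a 1 < 6" "a 2 < 6" "a 3 < 6" "a 4 < 6" by (simp_all add: a6)
  have nbs: "a 0 \<noteq> a 2" "a 1 \<noteq> a 3" "a 2 \<noteq> a 4"
    using nb[of 0, unfolded n] nb[of 1, unfolded n] nb[of 2, unfolded n] by simp_all
  have st: "a 1 = Suc (a 0) mod 6 \<or> a 0 = Suc (a 1) mod 6" "a 2 = Suc (a 1) mod 6 \<or> a 1 = Suc (a 2) mod 6"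
    "a 3 = Suc (a 2) mod 6 \<or> a 2 = Suc (a 3) mod 6" "a 4 = Suc (a 3) mod 6 \<or> a 3 = Suc (a 4) mod 6"
    using step[of 0, unfolded n] step[of 1, unfolded n] step[of 2, unfolded n] step[of 3, unfolded n]
    by simp_all
  have "(u = Suc (a 4) mod 6 \<and> a 0 = Suc u mod 6) \<or> (u = Suc (a 0) mod 6 \<and> a 4 = Suc u mod 6)"
  proof (cases "a 1 = Suc (a 0) mod 6")
    case True
    then have "a 2 = Suc (a 1) mod 6" using cyclic_step[OF lt(1-3) nbs(1)] st by simp
    moreover from this have "a 3 = Suc (a 2) mod 6" using cyclic_step[OF lt(2-4) nbs(2)] st by simp
    moreover from this have "a 4 = Suc (a 3) mod 6" using cyclic_step[OF lt(3-5) nbs(3)] st by simp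
    ultimately have "a 0 = Suc (Suc (a 4) mod 6) mod 6" using True lt(1) by (auto simp: mod_simps)
    then show ?thesis using True by (simp add: u_def)
  next
    case False
    then have "a 0 = Suc (a 1) mod 6" using st by simp
    moreover from this have "a 1 = Suc (a 2) mod 6" using cyclic_step'[OF lt(1-3) nbs(1)] st by simp
    moreover from this have "a 2 = Suc (a 3) mod 6" using cyclic_step'[OF lt(2-4) nbs(2)] st by simp
    moreover from this have "a 3 = Suc (a 4) mod 6" using cyclic_step'[OF lt(3-5) nbs(3)] st by simp
    ultimately have "a 4 = Suc (Suc (a 0) mod 6) mod 6" using lt(5) by (auto simp: mod_simps)
    then show ?thesis using False by (simp add: u_def)
  qed
  moreover have "u < 6" by (simp add: u_def)
  moreover have hexe: "{w i, w (Suc i mod 6)} \<in> E" if "i < 6" for i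
    using w that by (auto simp: is_hexagon_def)
  ultimately have "{v 0, w u} \<in> E \<and> {w u, v 4} \<in> E"
    using a[of 0] a[of 4] hexe[of u] hexe[of "a 0"] hexe[of "a 4"] by (auto simp: insert_commute)
  then show ?thesis using that by blast
qed

section \<open>The first two steps in the growth of the octagon\<close>

lemma G0_edge: "{x, y} \<in> G 0 \<Longrightarrow> \<exists>i<8. \<exists>j<8. x = Oct i \<and> y = Oct j \<and> (j = Suc i mod 8 \<or> i = Suc j mod 8)"
  by (auto simp: doubleton_eq_iff)

text \<open>The middle vertex between opposite vertices of the octagon; being indexed by an
  unordered pair, it is the same for \<open>k\<close> and \<open>k + 4\<close>. The vertex
  \<open>diagonal 0\<close> carries the two halves of the central square.\<close>

definition diagonal :: "nat \<Rightarrow> vert" where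
  "diagonal k = Mid (Upair (Oct (k mod 8)) (Oct ((k + 4) mod 8)))"

text \<open>Opposite vertices of the octagon have no common neighbour, so the path along half of it
  lies in no hexagon.\<close>

lemma diagonal_edges_G1:
  assumes "k < 8"
  shows "{Oct k, diagonal k} \<in> G 1" "{diagonal k, Oct ((k + 4) mod 8)} \<in> G 1"
proof -
  define v where "v = (\<lambda>i. Oct ((k + i) mod 8))"
  have path: "is_path4 (G 0) v"
  proof -
    have "{v i, v (Suc i)} \<in> G 0" for i
    proof -
      have "{v i, v (Suc i)} = {Oct ((k + i) mod 8), Oct (Suc ((k + i) mod 8) mod 8)}"
        by (simp add: v_def mod_simps)
      then show ?thesis unfolding G.simps by (intro CollectI exI[of _ "(k + i) mod 8"]) simp
    qed
    moreover have "v i \<noteq> v (Suc (Suc i))" for i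
      unfolding v_def by (simp add: mod_Suc)
    ultimately show ?thesis by (simp add: is_path4_def)
  qed
  have "\<not> in_hexagon (G 0) v"
  proof
    assume "in_hexagon (G 0) v"
    then obtain u where "{v 0, u} \<in> G 0" "{u, v 4} \<in> G 0"
      using in_hexagon_common_neighbour[OF path] by blast
    then obtain j where "j < 8" "j = Suc k mod 8 \<or> k = Suc j mod 8"
      "(k + 4) mod 8 = Suc j mod 8 \<or> j = Suc ((k + 4) mod 8) mod 8"
      using G0_edge[of "v 0" u] G0_edge[of u "v 4"] assms by (auto simp: v_def)
    moreover have "(k + 4) mod 8 = (if k < 4 then k + 4 else k - 4)" using assms by (simp add: mod_if)
    ultimately show False using assms by (auto simp: mod_Suc split: if_splits)
  qed
  moreover have "v 0 = Oct k" "v 4 = Oct ((k + 4) mod 8)" "Mid (Upair (v 0) (v 4)) = diagonal k"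
    using assms by (simp_all add: v_def diagonal_def)
  ultimately have "{{Oct k, diagonal k}, {diagonal k, Oct ((k + 4) mod 8)}} \<subseteq>
     \<Union> {{{v 0, Mid (Upair (v 0) (v 4))}, {Mid (Upair (v 0) (v 4)), v 4}} | v.
           is_path4 (G 0) v \<and> \<not> in_hexagon (G 0) v}"
    using path by (intro Union_upper) (force intro!: exI[of _ v])
  then show "{Oct k, diagonal k} \<in> G 1" "{diagonal k, Oct ((k + 4) mod 8)} \<in> G 1"
    unfolding One_nat_def G.simps(2) by blast+
qed

text \<open>In the first step every new edge has one end in the octagon, so a middle vertex still
  has only the two neighbours it was created with.\<close>

lemma G1_Mid_neighbour:
  assumes "{Mid (Upair a b), y} \<in> G 1" shows "y = a \<or> y = b"
proof -
  have "{Mid (Upair a b), y} \<notin> G 0" using G0_edge[of "Mid (Upair a b)" y] by auto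
  then obtain v where v: "is_path4 (G 0) v"
    and e: "{Mid (Upair a b), y} = {v 0, Mid (Upair (v 0) (v 4))} \<or>
      {Mid (Upair a b), y} = {Mid (Upair (v 0) (v 4)), v 4}"
    using assms unfolding One_nat_def G.simps(2) by blast
  have "{v 0, v 1} \<in> G 0" "{v 3, v 4} \<in> G 0"
    using v[unfolded is_path4_def, THEN conjunct1, rule_format, of 0]
      v[unfolded is_path4_def, THEN conjunct1, rule_format, of 3] by (simp_all del: G.simps)
  then have "v 0 \<noteq> Mid (Upair a b)" "v 4 \<noteq> Mid (Upair a b)"
    using G0_edge by (metis vert.distinct(1))+
  then show ?thesis using e by (auto simp: doubleton_eq_iff)
qed

lemma G_mono: "G n \<subseteq> G (Suc n)" by simp

lemma G_subset_B8: "G n \<subseteq> B8" by (auto simp: B8_def)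

text \<open>The octagon gives \<open>diagonal 0\<close> only two neighbours; this is a third one.\<close>

definition second_diagonal :: vert where
  "second_diagonal = Mid (Upair (diagonal 0) (diagonal 2))"

text \<open>The path from \<open>diagonal 0\<close> to \<open>diagonal 2\<close> over three octagon
  vertices lies in no hexagon, since the neighbours of its ends in \<open>G 1\<close>,
  \<open>Oct 0\<close>, \<open>Oct 4\<close> and \<open>Oct 2\<close>, \<open>Oct 6\<close>, form
  disjoint pairs.\<close>

lemma second_diagonal_edges:
  "{diagonal 0, second_diagonal} \<in> G 2" "{second_diagonal, diagonal 2} \<in> G 2"
proof -
  define v where "v = (\<lambda>i::nat. [diagonal 0, Oct 0, Oct 1, Oct 2, diagonal 2] ! i)"
  have "{Oct 0, Oct 1} \<in> G 0" "{Oct 1, Oct 2} \<in> G 0"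
    unfolding G.simps by (intro CollectI exI[of _ 0], simp) (intro CollectI exI[of _ 1], simp add: numeral_2_eq_2)
  then have oct: "{Oct 0, Oct 1} \<in> G 1" "{Oct 1, Oct 2} \<in> G 1"
    using G_mono[of 0] by (simp_all only: One_nat_def subset_iff)
  have path: "is_path4 (G 1) v"
    unfolding is_path4_def
  proof (intro conjI allI impI)
    fix i :: nat assume "i < 4"
    then have "i = 0 \<or> i = 1 \<or> i = 2 \<or> i = 3" by auto
    then show "{v i, v (Suc i)} \<in> G 1"
      using oct diagonal_edges_G1(1)[of 0] diagonal_edges_G1(1)[of 2]
      by (elim disjE) (simp_all add: v_def insert_commute)
  next
    fix i :: nat assume "i < 3"
    then have "i = 0 \<or> i = 1 \<or> i = 2" by auto
    then show "v i \<noteq> v (Suc (Suc i))" by (elim disjE) (simp_all add: v_def diagonal_def)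
  qed
  have "\<not> in_hexagon (G 1) v"
  proof
    assume "in_hexagon (G 1) v"
    then obtain u where "{v 0, u} \<in> G 1" "{u, v 4} \<in> G 1"
      using in_hexagon_common_neighbour[OF path] by blast
    then have "{Mid (Upair (Oct 0) (Oct 4)), u} \<in> G 1" "{Mid (Upair (Oct 2) (Oct 6)), u} \<in> G 1"
      by (simp_all add: v_def diagonal_def insert_commute)
    then have "u = Oct 0 \<or> u = Oct 4" "u = Oct 2 \<or> u = Oct 6" 
      using G1_Mid_neighbour[of "Oct 0" "Oct 4" u] G1_Mid_neighbour[of "Oct 2" "Oct 6" u] by blast+
    then show False by auto
  qed
  moreover have "v 0 = diagonal 0" "v 4 = diagonal 2" "Mid (Upair (v 0) (v 4)) = second_diagonal"
    by (simp_all add: v_def second_diagonal_def)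
  ultimately have "{{diagonal 0, second_diagonal}, {second_diagonal, diagonal 2}} \<subseteq>
     \<Union> {{{v 0, Mid (Upair (v 0) (v 4))}, {Mid (Upair (v 0) (v 4)), v 4}} | v.
           is_path4 (G 1) v \<and> \<not> in_hexagon (G 1) v}"
    using path by (intro Union_upper) (force intro!: exI[of _ v])
  then have "{{diagonal 0, second_diagonal}, {second_diagonal, diagonal 2}} \<subseteq> G (Suc 1)"
    unfolding G.simps(2) by blast
  then show "{diagonal 0, second_diagonal} \<in> G 2" "{second_diagonal, diagonal 2} \<in> G 2"
    by (simp_all add: numeral_2_eq_2 del: G.simps)
qed

lemma Oct_edge_B8: "{Oct (k mod 8), Oct (Suc k mod 8)} \<in> B8"
proof -
  have "{Oct (k mod 8), Oct (Suc (k mod 8) mod 8)} \<in> G 0"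
    unfolding G.simps by (intro CollectI exI[of _ "k mod 8"]) simp
  then show ?thesis using G_subset_B8 by (auto simp: mod_simps simp del: G.simps)
qed

definition outer_hexagon :: "nat \<Rightarrow> nat \<Rightarrow> vert" where
  "outer_hexagon k i = (if i < 5 then Oct ((k + i) mod 8) else diagonal k)"

lemma is_hexagon_outer: assumes "k < 8" shows "is_hexagon B8 (outer_hexagon k)"
  unfolding is_hexagon_def
proof (intro conjI allI impI)
  show "inj_on (outer_hexagon k) {..<6}"
  proof (rule inj_onI)
    fix i j assume "i \<in> {..<6::nat}" "j \<in> {..<6::nat}" "outer_hexagon k i = outer_hexagon k j"
    then show "i = j"
      using assms by (auto simp: outer_hexagon_def diagonal_def mod_if[of "k + _" 8] split: if_splits)
  qed
next
  fix i :: nat assume "i < 6"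
  then consider "i < 4" | "i = 4" | "i = 5" by linarith
  then show "{outer_hexagon k i, outer_hexagon k (Suc i mod 6)} \<in> B8"
  proof cases
    case 1
    then show ?thesis using Oct_edge_B8[of "k + i"] by (simp add: outer_hexagon_def)
  next
    case 2
    then show ?thesis using diagonal_edges_G1(2)[OF assms] G_subset_B8[of 1]
      by (auto simp: outer_hexagon_def insert_commute simp del: G.simps)
  next
    case 3
    then show ?thesis using diagonal_edges_G1(1)[OF assms] G_subset_B8[of 1] assms
      by (auto simp: outer_hexagon_def insert_commute simp del: G.simps)
  qed
qed

text \<open>The hexagon closed by the second step. It provides an apartment containing the edge from
  \<open>diagonal 0\<close> to \<open>second_diagonal\<close>.\<close>

definition inner_hexagon :: "nat \<Rightarrow> vert" where
  "inner_hexagon i = [Oct 0, Oct 1, Oct 2, diagonal 2, second_diagonal, diagonal 0] ! i"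

lemma is_hexagon_inner: "is_hexagon B8 inner_hexagon"
  unfolding is_hexagon_def
proof (intro conjI allI impI)
  have six: "i = 0 \<or> i = 1 \<or> i = 2 \<or> i = 3 \<or> i = 4 \<or> i = 5" if "i < 6" for i :: nat
    using that by auto
  show "inj_on inner_hexagon {..<6}"
  proof (rule inj_onI)
    fix i j assume *: "i \<in> {..<6::nat}" "j \<in> {..<6::nat}" "inner_hexagon i = inner_hexagon j"
    have "distinct [Oct 0, Oct 1, Oct 2, diagonal 2, second_diagonal, diagonal 0]"
      by (simp add: diagonal_def second_diagonal_def)
    then have "([Oct 0, Oct 1, Oct 2, diagonal 2, second_diagonal, diagonal 0] ! i =
        [Oct 0, Oct 1, Oct 2, diagonal 2, second_diagonal, diagonal 0] ! j) = (i = j)"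
      by (rule nth_eq_iff_index_eq) (use * in simp_all)
    then show "i = j" using *(3) by (simp only: inner_hexagon_def)
  qed
  fix i :: nat assume "i < 6"
  have "{Oct 0, Oct 1} \<in> B8" "{Oct 1, Oct 2} \<in> B8"
    using Oct_edge_B8[of 0] Oct_edge_B8[of 1] by (simp_all add: numeral_2_eq_2)
  moreover have "{Oct 2, diagonal 2} \<in> B8" "{Oct 0, diagonal 0} \<in> B8"
    by (rule subsetD[OF G_subset_B8 diagonal_edges_G1(1)], simp)+
  moreover note subsetD[OF G_subset_B8 second_diagonal_edges(1)] subsetD[OF G_subset_B8 second_diagonal_edges(2)]
  ultimately show "{inner_hexagon i, inner_hexagon (Suc i mod 6)} \<in> B8"
    using six[OF \<open>i < 6\<close>] by (elim disjE; simp add: inner_hexagon_def insert_commute del: G.simps)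
qed

lemma even_vertex_Oct: assumes "k < 4" shows "even_vertex (Oct (2 * k))"
proof -
  have "(Oct 0, Oct m) \<in> {(u, w). {u, w} \<in> B8} ^^ m" if "m < 8" for m
    using that
  proof (induction m)
    case (Suc m)
    then have "{Oct m, Oct (Suc m)} \<in> B8" using Oct_edge_B8[of m] by simp
    then show ?case using Suc by auto
  qed simp
  from this[of "2 * k"] show ?thesis using assms unfolding even_vertex_def by auto
qed

section \<open>Coordinates on the Weyl fan\<close>

lemma less_6_cases:
  assumes "i < (6::nat)" shows "i = 0 \<or> i = 1 \<or> i = 2 \<or> i = 3 \<or> i = 4 \<or> i = 5"
  using assms by auto

text \<open>
  The coordinates of a point of the model plane with respect to \<open>fan_ray i\<close> and
  \<open>fan_ray (Suc i)\<close>.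
\<close>

definition first_coord :: "nat \<Rightarrow> real ^ 3 \<Rightarrow> real" where
  "first_coord i a = (a $ ([2, 1, 1, 3, 3, 2] ! i) - a $ ([3, 3, 2, 2, 1, 1] ! i)) / 3"

definition second_coord :: "nat \<Rightarrow> real ^ 3 \<Rightarrow> real" where
  "second_coord i a = (a $ ([1, 3, 3, 2, 2, 1] ! i) - a $ ([2, 2, 1, 1, 3, 3] ! i)) / 3"

lemmas coord_simps = first_coord_def second_coord_def

lemma fan_ray_Suc: "fan_ray (Suc i) = fan_ray (Suc i mod 6)"
  by (simp add: fan_ray_def)

lemma model_plane_iff: "a \<in> model_plane \<longleftrightarrow> a $ 1 + a $ 2 + a $ 3 = 0"
  by (simp add: model_plane_def sum_3)

lemma sector_coords:
  assumes "i < 6"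
  shows "first_coord i (s *\<^sub>R fan_ray i + t *\<^sub>R fan_ray (Suc i)) = s"
    "second_coord i (s *\<^sub>R fan_ray i + t *\<^sub>R fan_ray (Suc i)) = t"
    "s *\<^sub>R fan_ray i + t *\<^sub>R fan_ray (Suc i) \<in> model_plane"
    "a \<in> model_plane \<Longrightarrow> first_coord i a *\<^sub>R fan_ray i + second_coord i a *\<^sub>R fan_ray (Suc i) = a"
  using less_6_cases[OF assms]
  by (elim disjE; simp add: coord_simps model_plane_iff fan_ray_def vec_eq_iff forall_3 field_simps;
      linarith?)+

lemma sector_exists:
  obtains i where "i < 6" "first_coord i a \<ge> 0" "second_coord i a \<ge> 0"
proof -
  have "\<exists>i\<in>{0, 1, 2, 3, 4, 5}. first_coord i a \<ge> 0 \<and> second_coord i a \<ge> 0"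
    by (simp add: coord_simps) linarith
  then obtain i where "i \<in> {0, 1, 2, 3, 4, 5::nat}" "first_coord i a \<ge> 0" "second_coord i a \<ge> 0"
    by blast
  then show ?thesis by (intro that[of i]) auto
qed

text \<open>Each coordinate is a third of a difference of two components. The bound lets a ball
  around an interior point of a sector stay in that sector.\<close>

lemma coord_diff_le:
  assumes "\<And>k. \<bar>a $ k - b $ k\<bar> \<le> r"
  shows "\<bar>first_coord i a - first_coord i b\<bar> \<le> r" "\<bar>second_coord i a - second_coord i b\<bar> \<le> r"
proof -
  have "\<bar>(a $ p - a $ q) / 3 - (b $ p - b $ q) / 3\<bar> \<le> r" for p q
  proof -
    have eq: "(a $ p - a $ q) / 3 - (b $ p - b $ q) / 3 = ((a $ p - b $ p) - (a $ q - b $ q)) / 3"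
      by (simp add: diff_divide_distrib)
    moreover have "\<bar>(a $ p - b $ p) - (a $ q - b $ q)\<bar> \<le> r + r"
      using abs_triangle_ineq4[of "a $ p - b $ p" "a $ q - b $ q"] assms[of p] assms[of q] by linarith
    moreover have "r \<ge> 0" using abs_ge_zero assms[of p] by (rule order.trans)
    ultimately show ?thesis unfolding eq abs_divide by simp
  qed
  then show "\<bar>first_coord i a - first_coord i b\<bar> \<le> r" "\<bar>second_coord i a - second_coord i b\<bar> \<le> r"
    unfolding first_coord_def second_coord_def by blast+
qed

text \<open>The tent function of the fan: linear on every sector, 1 at \<open>fan_ray i\<close> and
  0 on the other five rays. Such functions glue the sectorwise prescriptions of a chart, which
  overlap along rays, into one formula.\<close>

definition hat :: "nat \<Rightarrow> real ^ 3 \<Rightarrow> real" where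
  "hat i a = [max 0 ((min (a $ 1) (a $ 2) - a $ 3) / 3), max 0 ((a $ 1 - max (a $ 2) (a $ 3)) / 3),
     max 0 ((min (a $ 1) (a $ 3) - a $ 2) / 3), max 0 ((a $ 3 - max (a $ 1) (a $ 2)) / 3),
     max 0 ((min (a $ 2) (a $ 3) - a $ 1) / 3), max 0 ((a $ 2 - max (a $ 1) (a $ 3)) / 3)] ! i"

lemma hat_sector:
  assumes "i < 6" "j < 6" "s \<ge> 0" "t \<ge> 0"
  shows "hat j (s *\<^sub>R fan_ray i + t *\<^sub>R fan_ray (Suc i)) =
    (if j = i then s else if j = Suc i mod 6 then t else 0)"
  using less_6_cases[OF assms(1)] less_6_cases[OF assms(2)]
  by (elim disjE; use assms(3,4) in \<open>simp add: hat_def fan_ray_def min_def max_def\<close>)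

definition cone_point :: "(nat \<Rightarrow> vert) \<Rightarrow> nat \<Rightarrow> real \<Rightarrow> real \<Rightarrow> vert \<Rightarrow> real" where
  "cone_point w i s t = cone_vertex (w i := s, w (Suc i mod 6) := t)"

definition is_chart :: "(real ^ 3 \<Rightarrow> (vert \<Rightarrow> real)) \<Rightarrow> (nat \<Rightarrow> vert) \<Rightarrow> (real ^ 3 \<Rightarrow> real ^ 3) \<Rightarrow> bool" where
  "is_chart f w \<tau> \<longleftrightarrow> \<tau> \<in> W_aff \<and> is_hexagon B8 w \<and> even_vertex (w 0) \<and>
     (\<forall>i<6. \<forall>s\<ge>0. \<forall>t\<ge>0. f (\<tau> (s *\<^sub>R fan_ray i + t *\<^sub>R fan_ray (Suc i))) = cone_point w i s t)"

lemma B_phi_atlas_iff: "f \<in> B_phi_atlas \<longleftrightarrow> (\<exists>w \<tau>. is_chart f w \<tau>)"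
  unfolding B_phi_atlas_def is_chart_def cone_point_def by blast

section \<open>Existence and injectivity of charts\<close>

lemma hexagon_inj: "is_hexagon E w \<Longrightarrow> i < 6 \<Longrightarrow> j < 6 \<Longrightarrow> w i = w j \<longleftrightarrow> i = j"
  by (auto simp: is_hexagon_def inj_on_def)

lemma Suc_mod_6_neq: "i < 6 \<Longrightarrow> Suc i mod 6 \<noteq> i" for i :: nat
  by (auto simp: mod_Suc)

lemma cone_point_apply:
  assumes "is_hexagon E w" "i < 6" "j < 6"
  shows "cone_point w i s t (w j) = (if j = i then s else if j = Suc i mod 6 then t else 0)"
  using assms hexagon_inj[OF assms(1)] Suc_mod_6_neq[of i]
  by (auto simp: cone_point_def cone_vertex_def)

lemma cone_point_outside:
  "v \<noteq> w i \<Longrightarrow> v \<noteq> w (Suc i mod 6) \<Longrightarrow> cone_point w i s t v = 0"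
  by (simp add: cone_point_def cone_vertex_def)

lemma W_aff_id: "(\<lambda>a. a) \<in> W_aff"
  unfolding W_aff_def model_plane_def
  by (intro CollectI exI[of _ "\<lambda>i. i"] exI[of _ 0]) (auto simp: vec_eq_iff bij_def)

lemma exists_chart:
  assumes "is_hexagon B8 w" "even_vertex (w 0)"
  obtains f where "is_chart f w (\<lambda>a. a)"
proof
  show "is_chart (\<lambda>a v. \<Sum>j<6. if v = w j then hat j a else 0) w (\<lambda>a. a)"
    unfolding is_chart_def
  proof (intro conjI allI impI assms W_aff_id ext)
    fix i s t v assume *: "i < (6::nat)" "s \<ge> (0::real)" "t \<ge> (0::real)"
    show "(\<Sum>j<6. if v = w j then hat j (s *\<^sub>R fan_ray i + t *\<^sub>R fan_ray (Suc i)) else 0) =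
        cone_point w i s t v"
    proof (cases "\<exists>k<6. v = w k")
      case True
      then obtain k where k: "k < 6" "v = w k" by blast
      have "(\<Sum>j<6. if v = w j then hat j (s *\<^sub>R fan_ray i + t *\<^sub>R fan_ray (Suc i)) else 0) =
          (\<Sum>j<6. if j = k then hat k (s *\<^sub>R fan_ray i + t *\<^sub>R fan_ray (Suc i)) else 0)"
        by (intro sum.cong) (use k hexagon_inj[OF assms(1) k(1)] in auto)
      also have "\<dots> = hat k (s *\<^sub>R fan_ray i + t *\<^sub>R fan_ray (Suc i))" using k(1) by simp
      finally show ?thesis
        using hat_sector[OF *(1) k(1) *(2,3)] cone_point_apply[OF assms(1) *(1) k(1)] k(2) by simp
    next
      case False
      then have "cone_point w i s t v = 0"
        by (intro cone_point_outside) (use *(1) in auto)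
      then show ?thesis using False by (auto intro!: sum.neutral)
    qed
  qed
qed

text \<open>The atlas only admits hexagons starting at a vertex of the class of
  \<open>Oct 0\<close>; a hexagon with such a vertex elsewhere is renumbered.\<close>

lemma exists_chart_rotated:
  assumes "is_hexagon B8 w" "even_vertex (w j)" "j < 6"
  obtains f where "is_chart f (\<lambda>i. w ((i + j) mod 6)) (\<lambda>a. a)"
proof (rule exists_chart)
  show "even_vertex (w ((0 + j) mod 6))" using assms by simp
  show "is_hexagon B8 (\<lambda>i. w ((i + j) mod 6))"
    unfolding is_hexagon_def
  proof (intro conjI allI impI)
    show "inj_on (\<lambda>i. w ((i + j) mod 6)) {..<6}"
    proof (rule inj_onI)
      fix i k assume *: "i \<in> {..<6::nat}" "k \<in> {..<6::nat}" "w ((i + j) mod 6) = w ((k + j) mod 6)"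
      then have "(i + j) mod 6 = (k + j) mod 6"
        using hexagon_inj[OF assms(1), of "(i + j) mod 6" "(k + j) mod 6"] by simp
      then show "i = k"
        using assms(3) *(1,2) by (auto simp: mod_if[of "_ + j" 6] split: if_splits)
    qed
    fix i :: nat assume "i < 6"
    have "{w ((i + j) mod 6), w (Suc ((i + j) mod 6) mod 6)} \<in> B8"
      using assms(1) unfolding is_hexagon_def by (elim conjE allE[of _ "(i + j) mod 6"]) simp
    moreover have "(Suc i mod 6 + j) mod 6 = Suc ((i + j) mod 6) mod 6" by (simp add: mod_simps)
    ultimately show "{w ((i + j) mod 6), w ((Suc i mod 6 + j) mod 6)} \<in> B8" by simp
  qed
qed (rule that)

text \<open>Undoing an affine Weyl element only permutes and translates components. Differences of
  components, and hence both distances and differences of sheets, survive the change of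
  coordinates.\<close>

lemma W_aff_components:
  assumes "\<tau> \<in> W_aff"
  obtains \<pi> c where "bij \<pi>" "c \<in> model_plane" "\<And>a k. a $ k = \<tau> a $ \<pi> k - c $ \<pi> k"
    "\<And>b. b \<in> model_plane \<Longrightarrow> \<exists>a\<in>model_plane. \<tau> a = b"
    "\<And>a. a \<in> model_plane \<Longrightarrow> \<tau> a \<in> model_plane"
proof -
  obtain \<sigma> c where \<sigma>: "bij \<sigma>" "c \<in> model_plane" "\<tau> = (\<lambda>a. (\<chi> i. a $ (\<sigma> i)) + c)"
    using assms by (auto simp: W_aff_def)
  have perm: "(\<Sum>i\<in>UNIV. a $ (\<pi> i)) = (\<Sum>i\<in>UNIV. a $ i)" if "bij \<pi>" for a :: "real ^ 3" and \<pi>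
    using that by (rule sum.reindex_bij_betw)
  have inv: "bij (inv \<sigma>)" using \<sigma>(1) by (rule bij_imp_bij_inv)
  have cancel: "\<sigma> (inv \<sigma> k) = k" "inv \<sigma> (\<sigma> k) = k" for k
    using \<sigma>(1) by (simp_all add: bij_is_surj surj_f_inv_f bij_is_inj inv_f_f)
  show ?thesis
  proof
    show "bij (inv \<sigma>)" "c \<in> model_plane" by fact+
    show "a $ k = \<tau> a $ inv \<sigma> k - c $ inv \<sigma> k" for a k by (simp add: \<sigma>(3) cancel)
    show "\<exists>a\<in>model_plane. \<tau> a = b" if "b \<in> model_plane" for b
    proof
      show "\<tau> (\<chi> k. (b - c) $ inv \<sigma> k) = b" by (simp add: \<sigma>(3) vec_eq_iff cancel)
      show "(\<chi> k. (b - c) $ inv \<sigma> k) \<in> model_plane"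
        using that \<sigma>(2) perm[OF inv, of "b - c"] by (simp add: model_plane_def sum_subtractf)
    qed
    show "\<tau> a \<in> model_plane" if "a \<in> model_plane" for a
      using that \<sigma>(2) perm[OF \<sigma>(1), of a] by (simp add: model_plane_def \<sigma>(3) sum.distrib)
  qed
qed

lemma chart_value:
  assumes "is_chart f w \<tau>" "a \<in> model_plane" "i < 6" "first_coord i a \<ge> 0" "second_coord i a \<ge> 0"
  shows "f (\<tau> a) = cone_point w i (first_coord i a) (second_coord i a)"
  using assms sector_coords(4)[OF assms(3,2)] unfolding is_chart_def by metis

text \<open>The values of the chart at the six vertices, used as weights of the fan rays, recover
  the point by one formula valid in all sectors.\<close>

lemma chart_inj:
  assumes "is_chart f w \<tau>" "a \<in> model_plane" "b \<in> model_plane" "f (\<tau> a) = f (\<tau> b)"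
  shows "a = b"
proof -
  have hex: "is_hexagon B8 w" using assms(1) by (simp add: is_chart_def)
  have "(\<Sum>k<6. f (\<tau> a) (w k) *\<^sub>R fan_ray k) = a" if a: "a \<in> model_plane" for a
  proof -
    obtain i where i: "i < 6" "first_coord i a \<ge> 0" "second_coord i a \<ge> 0" by (rule sector_exists)
    have m: "Suc i mod 6 < 6" by simp
    have "(\<Sum>k<6. f (\<tau> a) (w k) *\<^sub>R fan_ray k) =
       (\<Sum>k<6. (if k = i then first_coord i a *\<^sub>R fan_ray i else 0) +
          (if k = Suc i mod 6 then second_coord i a *\<^sub>R fan_ray (Suc i mod 6) else 0))"
      unfolding chart_value[OF assms(1) a i]
      by (intro sum.cong) (use cone_point_apply[OF hex i(1)] Suc_mod_6_neq[OF i(1)] in auto)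
    also have "\<dots> = first_coord i a *\<^sub>R fan_ray i + second_coord i a *\<^sub>R fan_ray (Suc i)"
      using i(1) m by (simp add: sum.distrib fan_ray_Suc[of i])
    finally show ?thesis using sector_coords(4)[OF i(1) a] by simp
  qed
  then show ?thesis using assms(2-4) by metis
qed

section \<open>Singular points of the cone\<close>

lemma chart_vertex_values:
  assumes "is_chart f w \<tau>" "a \<in> model_plane"
  obtains i where "i < 6" "\<And>v. f (\<tau> a) v \<noteq> 0 \<Longrightarrow> v = w i \<or> v = w (Suc i mod 6)"
proof -
  obtain i where i: "i < 6" "first_coord i a \<ge> 0" "second_coord i a \<ge> 0" by (rule sector_exists)
  then show ?thesis
    using that[of i] chart_value[OF assms i] cone_point_outside by metis
qed

definition has_edge :: "(nat \<Rightarrow> vert) \<Rightarrow> vert \<Rightarrow> vert \<Rightarrow> bool" where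
  "has_edge w u v \<longleftrightarrow> (\<exists>i<6. {u, v} = {w i, w (Suc i mod 6)})"

lemma has_edge_commute: "has_edge w u v \<longleftrightarrow> has_edge w v u"
  by (simp add: has_edge_def insert_commute)

lemma hexagon_degree:
  assumes "is_hexagon E w" "has_edge w v a" "has_edge w v b" "has_edge w v c"
  shows "a = b \<or> a = c \<or> b = c"
proof -
  have nbr: "\<exists>i<6. v = w i \<and> (x = w (Suc i mod 6) \<or> (\<exists>j<6. i = Suc j mod 6 \<and> x = w j))"
    if x: "has_edge w v x" for x
  proof -
    obtain j where j: "j < 6" "{v, x} = {w j, w (Suc j mod 6)}" using x by (auto simp: has_edge_def)
    then have "v = w j \<and> x = w (Suc j mod 6) \<or> v = w (Suc j mod 6) \<and> x = w j"
      by (simp add: doubleton_eq_iff)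
    moreover have "Suc j mod 6 < 6" by simp
    ultimately show ?thesis using j(1) by blast
  qed
  from nbr[OF assms(2)] obtain i where i: "i < 6" "v = w i" by blast
  \<comment> \<open>The predecessor of \<open>i\<close> modulo 6, with 0 treated apart because
    subtraction of naturals truncates.\<close>
  define p where "p = (if i = 0 then 5 else i - 1)"
  have "x = w (Suc i mod 6) \<or> x = w p" if x: "has_edge w v x" for x
  proof -
    obtain k where k: "k < 6" "v = w k" "x = w (Suc k mod 6) \<or> (\<exists>j<6. k = Suc j mod 6 \<and> x = w j)"
      using nbr[OF x] by blast
    have "k = i" using hexagon_inj[OF assms(1) k(1) i(1)] k(2) i(2) by simp
    moreover have "j = p" if "j < 6" "i = Suc j mod 6" for j
      using that by (auto simp: p_def mod_Suc split: if_splits)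
    ultimately show ?thesis using k(3) by blast
  qed
  then show ?thesis using assms(2-4) by metis
qed

text \<open>Every ball around a point of the ray of \<open>v\<close> enters the interior of each
  sector at that ray which lies in an admissible hexagon: one moves from the point in the direction
  of the sum of the two bounding rays.\<close>

lemma sector_ball_point:
  assumes hex: "is_hexagon B8 w" "\<exists>j<6. even_vertex (w j)" and edge: "has_edge w v a"
    and z: "\<And>x. x \<noteq> v \<Longrightarrow> z x = 0" "z v \<ge> 0" and "\<epsilon> > 0"
  obtains y where "y \<in> building_ball B_phi_atlas z \<epsilon>" "y v > 0" "y a > 0"
proof -
  obtain j where j: "j < 6" "even_vertex (w j)" using hex(2) by blast
  define w' where "w' = (\<lambda>i. w ((i + j) mod 6))"
  obtain f where f: "is_chart f w' (\<lambda>a. a)"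
    using exists_chart_rotated[OF hex(1) j(2,1)] unfolding w'_def by blast
  then have hex': "is_hexagon B8 w'" by (simp add: is_chart_def)
  have "has_edge w' v a"
  proof -
    obtain i where i: "i < 6" "{v, a} = {w i, w (Suc i mod 6)}" using edge by (auto simp: has_edge_def)
    define k where "k = (i + (6 - j)) mod 6"
    have "(k + j) mod 6 = i" using i(1) j(1) by (simp add: k_def mod_simps)
    moreover have "(Suc k mod 6 + j) mod 6 = Suc ((k + j) mod 6) mod 6" by (simp add: mod_simps)
    ultimately have "{v, a} = {w' k, w' (Suc k mod 6)}" using i(2) by (simp add: w'_def)
    moreover have "k < 6" by (simp add: k_def)
    ultimately show ?thesis by (auto simp: has_edge_def)
  qed
  then obtain i where i: "i < 6" "{v, a} = {w' i, w' (Suc i mod 6)}" by (auto simp: has_edge_def)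
  define r where "r = z v"
  define b d where "b = (if v = w' i then r *\<^sub>R fan_ray i + 0 *\<^sub>R fan_ray (Suc i)
      else 0 *\<^sub>R fan_ray i + r *\<^sub>R fan_ray (Suc i))"
    and "d = fan_ray i + fan_ray (Suc i)"
  \<comment> \<open>The summand 1 makes the displacement strictly shorter than
    \<open>\<epsilon>\<close> and avoids a zero denominator.\<close>
  define \<delta> where "\<delta> = \<epsilon> / (norm d + 1)"
  have \<delta>: "\<delta> > 0" using \<open>\<epsilon> > 0\<close> norm_ge_zero[of d] by (simp add: \<delta>_def add_nonneg_pos)
  have va: "v \<noteq> a \<and> (v = w' i \<and> a = w' (Suc i mod 6) \<or> v = w' (Suc i mod 6) \<and> a = w' i)"
    using i(2) hexagon_inj[OF hex' i(1), of "Suc i mod 6"] Suc_mod_6_neq[OF i(1)]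
    by (auto simp: doubleton_eq_iff)
  have r: "r \<ge> 0" using z(2) by (simp add: r_def)
  have fapp: "f (s *\<^sub>R fan_ray i + t *\<^sub>R fan_ray (Suc i)) = cone_point w' i s t"
    if "s \<ge> 0" "t \<ge> 0" for s t
    using f i(1) that by (simp add: is_chart_def)
  have fz: "f b = z"
  proof
    fix x
    have "f b = (if v = w' i then cone_point w' i r 0 else cone_point w' i 0 r)"
      unfolding b_def if_distrib[of f] fapp[OF r order.refl] fapp[OF order.refl r] ..
    then show "f b x = z x"
      using va z(1)[of x] by (auto simp: cone_point_def cone_vertex_def r_def)
  qed
  have bd: "b + \<delta> *\<^sub>R d = (if v = w' i then (r + \<delta>) *\<^sub>R fan_ray i + \<delta> *\<^sub>R fan_ray (Suc i)
      else \<delta> *\<^sub>R fan_ray i + (r + \<delta>) *\<^sub>R fan_ray (Suc i))"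
    by (simp add: b_def d_def scaleR_add_right scaleR_add_left)
  then have fbd: "f (b + \<delta> *\<^sub>R d) = (if v = w' i then cone_point w' i (r + \<delta>) \<delta> else cone_point w' i \<delta> (r + \<delta>))"
    using r \<delta> by (simp add: fapp)
  have "b \<in> model_plane" "b + \<delta> *\<^sub>R d \<in> model_plane"
    unfolding bd by (simp_all only: b_def sector_coords(3)[OF i(1)] if_cancel split: if_split) simp_all
  moreover have "dist b (b + \<delta> *\<^sub>R d) < \<epsilon>"
  proof -
    have "dist b (b + \<delta> *\<^sub>R d) = \<delta> * norm d" using \<delta> by (simp add: dist_norm)
    also have "\<dots> < \<delta> * (norm d + 1)" using \<delta> by simp
    also have "\<dots> = \<epsilon>" using norm_ge_zero[of d] by (simp add: \<delta>_def add_nonneg_eq_0_iff)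
    finally show ?thesis .
  qed
  moreover have "f \<in> B_phi_atlas" using f B_phi_atlas_iff by blast
  ultimately have "f (b + \<delta> *\<^sub>R d) \<in> building_ball B_phi_atlas z \<epsilon>"
    unfolding building_ball_def using fz by blast
  moreover have "f (b + \<delta> *\<^sub>R d) v > 0" "f (b + \<delta> *\<^sub>R d) a > 0"
    unfolding fbd using va r \<delta> by (auto simp: cone_point_def cone_vertex_def)
  ultimately show ?thesis using that by blast
qed

lemma has_edge_of_values:
  assumes "is_hexagon E w" "i < 6" "\<And>x. y x \<noteq> (0::real) \<Longrightarrow> x = w i \<or> x = w (Suc i mod 6)"
    "y u > 0" "y v > 0" "u \<noteq> v"
  shows "has_edge w u v"
proof -
  have "u = w i \<or> u = w (Suc i mod 6)" "v = w i \<or> v = w (Suc i mod 6)" using assms(3-5) by auto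
  then have "{u, v} = {w i, w (Suc i mod 6)}" using assms(6) by auto
  then show ?thesis using assms(2) by (auto simp: has_edge_def)
qed

text \<open>If one apartment contained a ball around \<open>z\<close>, it would contain interior
  points of three sectors along the ray, and its hexagon would have three edges at \<open>v\<close>.
  As \<open>z v\<close> may be 0, the cone vertex is included.\<close>

lemma ray_singular:
  assumes z: "z \<in> B_phi" "\<And>x. x \<noteq> v \<Longrightarrow> z x = 0" "z v \<ge> 0"
    and hex: "\<And>a. a \<in> A \<Longrightarrow> \<exists>w. is_hexagon B8 w \<and> (\<exists>j<6. even_vertex (w j)) \<and> has_edge w v a"
    and abc: "a \<in> A" "b \<in> A" "c \<in> A" "a \<noteq> b" "a \<noteq> c" "b \<noteq> c" "v \<notin> A"
  shows "z \<in> singular_set B_phi B_phi_atlas"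
proof -
  have False if \<epsilon>: "\<epsilon> > 0" and f: "f \<in> B_phi_atlas"
    and sub: "building_ball B_phi_atlas z \<epsilon> \<subseteq> f ` model_plane" for \<epsilon> f
  proof -
    obtain w \<tau> where chart: "is_chart f w \<tau>" using f B_phi_atlas_iff by blast
    then have hw: "is_hexagon B8 w" by (simp add: is_chart_def)
    have "has_edge w v x" if x: "x \<in> A" for x
    proof -
      obtain w' where w': "is_hexagon B8 w'" "\<exists>j<6. even_vertex (w' j)" "has_edge w' v x"
        using hex[OF x] by blast
      obtain y where y: "y \<in> building_ball B_phi_atlas z \<epsilon>" "y v > 0" "y x > 0"
        using sector_ball_point[OF w', of z \<epsilon>] z(2,3) \<epsilon> by metis
      obtain q where q: "q \<in> model_plane" "y = f q" using y(1) sub by blast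
      have "\<tau> \<in> W_aff" using chart by (simp add: is_chart_def)
      then obtain q' where q': "q' \<in> model_plane" "\<tau> q' = q" using q(1) by (metis W_aff_components)
      obtain i where "i < 6" "\<And>u. f (\<tau> q') u \<noteq> 0 \<Longrightarrow> u = w i \<or> u = w (Suc i mod 6)"
        using chart_vertex_values[OF chart q'(1)] by blast
      then show ?thesis
        using y(2,3) x abc(7) q(2) q'(2) by (intro has_edge_of_values[OF hw, of i y]) auto
    qed
    then show False using hexagon_degree[OF hw, of v a b c] abc by blast
  qed
  then show ?thesis using z(1) by (auto simp: singular_set_def)
qed

text \<open>The ball is taken through all charts at once. Its radius is the smaller positive
  coordinate of \<open>z\<close>, so in any chart through \<open>z\<close> the coordinates of a
  nearby point stay nonnegative; the point remains in the closed sector, which the given chart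
  covers.\<close>

lemma sector_interior_nonsingular:
  assumes chart: "is_chart f w \<tau>" and edge: "has_edge w u v" and uv: "u \<noteq> v"
    and z: "z u > 0" "z v > 0" "\<And>x. x \<noteq> u \<Longrightarrow> x \<noteq> v \<Longrightarrow> z x = 0"
  shows "z \<notin> singular_set B_phi B_phi_atlas"
proof -
  define \<epsilon> where "\<epsilon> = min (z u) (z v)"
  have \<epsilon>: "\<epsilon> > 0" using z by (simp add: \<epsilon>_def)
  obtain i where i: "i < 6" "{u, v} = {w i, w (Suc i mod 6)}" using edge by (auto simp: has_edge_def)
  have \<tau>: "\<tau> \<in> W_aff" using chart by (simp add: is_chart_def)
  have "building_ball B_phi_atlas z \<epsilon> \<subseteq> f ` model_plane"
  proof
    fix y assume "y \<in> building_ball B_phi_atlas z \<epsilon>"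
    then obtain f' a b where y: "y = f' b" "f' \<in> B_phi_atlas" "a \<in> model_plane" "b \<in> model_plane"
      "f' a = z" "dist a b < \<epsilon>" by (auto simp: building_ball_def)
    obtain w' \<tau>' where chart': "is_chart f' w' \<tau>'" using y(2) B_phi_atlas_iff by blast
    then have hw': "is_hexagon B8 w'" and \<tau>': "\<tau>' \<in> W_aff" by (auto simp: is_chart_def)
    obtain \<pi> c where \<pi>: "\<And>a k. a $ k = \<tau>' a $ \<pi> k - c $ \<pi> k"
      "\<And>b. b \<in> model_plane \<Longrightarrow> \<exists>a\<in>model_plane. \<tau>' a = b"
      using W_aff_components[OF \<tau>'] by metis
    obtain a' where a': "a' \<in> model_plane" "\<tau>' a' = a" using \<pi>(2) y(3) by blast
    obtain b' where b': "b' \<in> model_plane" "\<tau>' b' = b" using \<pi>(2) y(4) by blast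
    obtain j where j: "j < 6" "first_coord j a' \<ge> 0" "second_coord j a' \<ge> 0" by (rule sector_exists)
    have za: "z = cone_point w' j (first_coord j a') (second_coord j a')"
      using chart_value[OF chart' a'(1) j] a'(2) y(5) by simp
    \<comment> \<open>Two positive values of \<open>z\<close> force the sector that contains it in
      the other chart to belong to the same edge.\<close>
    have e: "{u, v} = {w' j, w' (Suc j mod 6)}"
    proof -
      have "u = w' j \<or> u = w' (Suc j mod 6)" "v = w' j \<or> v = w' (Suc j mod 6)"
        using z(1,2) cone_point_outside[of _ w' j "first_coord j a'" "second_coord j a'"]
        unfolding za by (metis less_irrefl)+
      then show ?thesis using uv by auto
    qed
    have vals: "z (w' j) = first_coord j a'" "z (w' (Suc j mod 6)) = second_coord j a'"
      using cone_point_apply[OF hw' j(1), of j] cone_point_apply[OF hw' j(1), of "Suc j mod 6"]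
        j(1) Suc_mod_6_neq[OF j(1)] unfolding za by simp_all
    have ge: "first_coord j a' \<ge> \<epsilon>" "second_coord j a' \<ge> \<epsilon>"
      using e unfolding vals[symmetric] \<epsilon>_def by (auto simp: doubleton_eq_iff)
    have "\<bar>a' $ k - b' $ k\<bar> \<le> dist a b" for k
    proof -
      have "a' $ k - b' $ k = (a - b) $ \<pi> k" using \<pi>(1)[of a' k] \<pi>(1)[of b' k] a'(2) b'(2) by simp
      then show ?thesis using component_le_norm_cart[of "a - b" "\<pi> k"] by (simp add: dist_norm)
    qed
    then have "\<bar>first_coord j a' - first_coord j b'\<bar> \<le> dist a b" "\<bar>second_coord j a' - second_coord j b'\<bar> \<le> dist a b"
      by (rule coord_diff_le)+
    then have pos: "first_coord j b' \<ge> 0" "second_coord j b' \<ge> 0"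
      using ge y(6) by linarith+
    have yv: "y = cone_point w' j (first_coord j b') (second_coord j b')"
      using chart_value[OF chart' b'(1) j(1) pos] b'(2) y(1) by simp
    define s t where "s = y (w i)" and "t = y (w (Suc i mod 6))"
    have y0: "y x \<ge> 0" for x unfolding yv using pos by (auto simp: cone_point_def cone_vertex_def)
    have "y = cone_point w i s t"
    proof
      fix x
      have "w i \<noteq> w (Suc i mod 6)" using i(2) uv by auto
      moreover have "y x = 0" if "x \<noteq> u" "x \<noteq> v"
        unfolding yv using that e by (intro cone_point_outside) auto
      ultimately show "y x = cone_point w i s t x"
        using i(2) by (auto simp: cone_point_def cone_vertex_def s_def t_def doubleton_eq_iff)
    qed
    then have "y = f (\<tau> (s *\<^sub>R fan_ray i + t *\<^sub>R fan_ray (Suc i)))"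
      using chart i(1) y0 by (simp add: is_chart_def s_def t_def)
    moreover have "\<tau> (s *\<^sub>R fan_ray i + t *\<^sub>R fan_ray (Suc i)) \<in> model_plane"
      using W_aff_components[OF \<tau>] sector_coords(3)[OF i(1)] by metis
    ultimately show "y \<in> f ` model_plane" by blast
  qed
  moreover have "f \<in> B_phi_atlas" using chart B_phi_atlas_iff by blast
  ultimately show ?thesis using \<epsilon> by (auto simp: singular_set_def)
qed

section \<open>The rays met by the network are singular\<close>

lemma outer_hexagon_even:
  assumes "k < 8" shows "\<exists>j<6. even_vertex (outer_hexagon k j)"
proof -
  have ev: "even_vertex (Oct 0)" "even_vertex (Oct 2)" "even_vertex (Oct 4)" "even_vertex (Oct 6)"
    using even_vertex_Oct[of 0] even_vertex_Oct[of 1] even_vertex_Oct[of 2] even_vertex_Oct[of 3] by simp_all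
  note ev
  moreover have "even_vertex (Oct (Suc (Suc 0)))" using ev(2) by (simp add: numeral_2_eq_2)
  moreover have "k = 0 \<or> k = 1 \<or> k = 2 \<or> k = 3 \<or> k = 4 \<or> k = 5 \<or> k = 6 \<or> k = 7" using assms by auto
  ultimately have "even_vertex (outer_hexagon k 0) \<or> even_vertex (outer_hexagon k 1)"
    by (elim disjE; simp add: outer_hexagon_def)
  moreover have "(0::nat) < 6" "(1::nat) < 6" by simp_all
  ultimately show ?thesis by blast
qed

lemma outer_hexagon_edges:
  assumes "k < 8"
  shows "has_edge (outer_hexagon k) (Oct k) (Oct (Suc k mod 8))"
    "has_edge (outer_hexagon k) (Oct k) (diagonal k)"
    "has_edge (outer_hexagon k) (Oct ((k + 4) mod 8)) (Oct ((k + 3) mod 8))"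
    "has_edge (outer_hexagon k) (Oct ((k + 4) mod 8)) (diagonal k)"
proof -
  have e: "has_edge (outer_hexagon k) (outer_hexagon k i) (outer_hexagon k (Suc i mod 6))" if "i < 6" for i
    using that by (auto simp: has_edge_def)
  show "has_edge (outer_hexagon k) (Oct k) (Oct (Suc k mod 8))"
    using e[of 0] assms by (simp add: outer_hexagon_def)
  show "has_edge (outer_hexagon k) (Oct k) (diagonal k)"
    using e[of 5] assms by (simp add: outer_hexagon_def has_edge_commute)
  show "has_edge (outer_hexagon k) (Oct ((k + 4) mod 8)) (Oct ((k + 3) mod 8))"
    using e[of 3] by (simp add: outer_hexagon_def has_edge_commute)
  show "has_edge (outer_hexagon k) (Oct ((k + 4) mod 8)) (diagonal k)"
    using e[of 4] by (simp add: outer_hexagon_def)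
qed

text \<open>The three neighbours are the two adjacent octagon vertices and the diagonal. Two of them
  appear in the hexagon starting at \<open>Oct k\<close>, the third in the one starting at the
  opposite vertex and running towards \<open>Oct k\<close>.\<close>

lemma Oct_ray_singular:
  assumes "k < 8" "z \<in> B_phi" "\<And>x. x \<noteq> Oct k \<Longrightarrow> z x = 0" "z (Oct k) \<ge> 0"
  shows "z \<in> singular_set B_phi B_phi_atlas"
proof -
  define m where "m = (k + 4) mod 8"
  have m: "m < 8" "(m + 4) mod 8 = k" "(m + 3) mod 8 = (k + 7) mod 8"
    using assms(1) by (simp_all add: m_def mod_simps add.commute)
  have ne: "Suc k mod 8 \<noteq> (k + 7) mod 8" "Suc k mod 8 \<noteq> k" "(k + 7) mod 8 \<noteq> k"
    using assms(1) by presburger+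
  show ?thesis
  proof (rule ray_singular[where A = "{Oct (Suc k mod 8), diagonal k, Oct ((k + 7) mod 8)}"
        and a = "Oct (Suc k mod 8)" and b = "diagonal k" and c = "Oct ((k + 7) mod 8)", OF assms(2-4)])
    fix a assume "a \<in> {Oct (Suc k mod 8), diagonal k, Oct ((k + 7) mod 8)}"
    then show "\<exists>w. is_hexagon B8 w \<and> (\<exists>j<6. even_vertex (w j)) \<and> has_edge w (Oct k) a"
      using is_hexagon_outer[OF assms(1)] outer_hexagon_even[OF assms(1)] outer_hexagon_edges(1,2)[OF assms(1)]
        is_hexagon_outer[OF m(1)] outer_hexagon_even[OF m(1)] outer_hexagon_edges(3)[OF m(1)] m(2,3)
      by auto
  qed (use ne in \<open>auto simp: diagonal_def\<close>)
qed

text \<open>This ray receives the backward collision line. Its third sector comes from the vertex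
  added in the second step of the construction.\<close>

lemma diagonal_ray_singular:
  assumes "z \<in> B_phi" "\<And>x. x \<noteq> diagonal 0 \<Longrightarrow> z x = 0" "z (diagonal 0) \<ge> 0"
  shows "z \<in> singular_set B_phi B_phi_atlas"
proof (rule ray_singular[where A = "{Oct 0, Oct 4, second_diagonal}"
      and a = "Oct 0" and b = "Oct 4" and c = "second_diagonal", OF assms])
  have "even_vertex (inner_hexagon 0)"
    using even_vertex_Oct[of 0] by (simp add: inner_hexagon_def)
  then have ev: "\<exists>j<6. even_vertex (inner_hexagon j)" by (intro exI[of _ 0]) simp
  have "{diagonal 0, second_diagonal} = {inner_hexagon 4, inner_hexagon (Suc 4 mod 6)}"
    by (simp add: inner_hexagon_def insert_commute)
  then have inner: "has_edge inner_hexagon (diagonal 0) second_diagonal"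
    unfolding has_edge_def by (intro exI[of _ 4]) simp
  have outer: "has_edge (outer_hexagon 0) (diagonal 0) (Oct 0)" "has_edge (outer_hexagon 0) (diagonal 0) (Oct 4)"
    using outer_hexagon_edges(2,4)[of 0] by (simp_all add: has_edge_commute)
  fix a assume "a \<in> {Oct 0, Oct 4, second_diagonal}"
  then show "\<exists>w. is_hexagon B8 w \<and> (\<exists>j<6. even_vertex (w j)) \<and> has_edge w (diagonal 0) a"
    using is_hexagon_outer[of 0] outer_hexagon_even[of 0] outer is_hexagon_inner ev inner by auto
qed (auto simp: diagonal_def second_diagonal_def)

section \<open>Distinct sheets and functions without critical points\<close>

lemma root_of_cubic_pair:
  assumes "(q::complex)^2 + r * q + r^2 = 3" "r \<in> sheets x" shows "q \<in> sheets x"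
proof -
  have "q^3 - 3 * q + x = (q - r) * (q^2 + r * q + r^2 - 3) + (r^3 - 3 * r + x)"
    by (simp add: algebra_simps power2_eq_square power3_eq_cube)
  also have "\<dots> = 0" using assms by (simp add: sheets_def)
  finally show ?thesis by (simp add: sheets_def)
qed

text \<open>A coincidence would leave at most two values for the sheets, whereas the cubic has three
  roots except at the branch points.\<close>

lemma three_sheets:
  assumes p: "range (\<lambda>i::3. p i) = sheets x" and x: "x \<noteq> 2" "x \<noteq> -2" and ij: "i \<noteq> j"
  shows "p i \<noteq> p j"
proof
  assume eq: "p i = p j"
  define r where "r = p i"
  \<comment> \<open>Dividing the cubic by its root \<open>r\<close> leaves
    \<open>q^2 + r * q + r^2 - 3\<close>, whose discriminant is \<open>12 - 3 * r^2\<close>. It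
    vanishes for \<open>r^2 = 4\<close>, and \<open>r\<close> is itself a root of the quotient for
    \<open>r^2 = 1\<close>; both cases give \<open>x = 2\<close> or \<open>x = -2\<close>.\<close>
  define d where "d = csqrt (12 - 3 * r^2)"
  have d: "d^2 = 12 - 3 * r^2" by (simp add: d_def)
  have r: "r \<in> sheets x" using p by (auto simp: r_def)
  then have xr: "x = 3 * r - r^3" by (simp add: sheets_def algebra_simps eq_neg_iff_add_eq_0)
  define q1 q2 where "q1 = (- r + d) / 2" and "q2 = (- r - d) / 2"
  have "q1^2 + r * q1 + r^2 = (d^2 + 3 * r^2) / 4" "q2^2 + r * q2 + r^2 = (d^2 + 3 * r^2) / 4"
    by (simp_all add: q1_def q2_def field_simps power2_eq_square)
  then have q: "q1^2 + r * q1 + r^2 = 3" "q2^2 + r * q2 + r^2 = 3" by (simp_all add: d)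
  have r2: "r^2 \<noteq> 1"
  proof
    assume "r^2 = 1"
    then have "r = 1 \<or> r = -1" by (simp add: power2_eq_1_iff)
    then show False using xr x by auto
  qed
  have r4: "r^2 \<noteq> 4"
  proof
    assume "r^2 = 4"
    then have "r^2 = 2^2" by simp
    then have "r = 2 \<or> r = -2" by (simp only: power2_eq_iff)
    then show False using xr x by auto
  qed
  have nr: "q \<noteq> r" if "q^2 + r * q + r^2 = 3" for q
  proof
    assume "q = r"
    then have "3 * r^2 = 3" using that by (simp add: power2_eq_square)
    then show False using r2 by simp
  qed
  have "d \<noteq> 0" using d r4 by auto
  then have "q1 \<noteq> q2" by (auto simp: q1_def q2_def)
  moreover have "q1 \<noteq> r" "q2 \<noteq> r" using nr q by blast+
  ultimately have "card {r, q1, q2} = 3" by simp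
  moreover have "{r, q1, q2} \<subseteq> range p" using r q root_of_cubic_pair[OF _ r] p by auto
  moreover have "p k \<in> p ` (UNIV - {j})" for k
  proof (cases "k = j")
    case True
    then show ?thesis using eq ij by (intro image_eqI[of _ _ i]) simp_all
  qed simp
  then have "range p = p ` (UNIV - {j})" by blast
  then have "card (range p) \<le> card (UNIV - {j})" by (metis card_image_le finite)
  moreover have "card (UNIV - {j}) = 2" by simp
  moreover have "finite (range p)" by simp
  ultimately show False using card_mono[of "range p" "{r, q1, q2}"] by simp
qed

text \<open>Testing the functional on \<open>cnj c\<close> yields the squared modulus of
  \<open>c\<close>.\<close>

lemma Re_mult_eq_0:
  assumes "(\<lambda>v. Re (c * v)) = (\<lambda>v. 0)" shows "c = 0"
  using fun_cong[OF assms, of "cnj c"] by (simp add: complex_neq_0 flip: complex_norm_square add: complex_eq_iff sum_squares_eq_zero_iff power2_eq_square)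

text \<open>A function with nowhere vanishing derivative is not constant on an open set. The
  conclusion is again an open set, so several such conditions can be imposed in turn.\<close>

lemma open_ne_constant:
  fixes D :: "complex \<Rightarrow> real"
  assumes "open V" "V \<noteq> {}" "\<And>y. y \<in> V \<Longrightarrow> (D has_derivative (\<lambda>v. Re (c y * v))) (at y)"
    "\<And>y. y \<in> V \<Longrightarrow> c y \<noteq> 0"
  obtains V' where "open V'" "V' \<noteq> {}" "V' \<subseteq> V" "\<And>y. y \<in> V' \<Longrightarrow> D y \<noteq> d"
proof -
  have "continuous_on V D"
    using assms(3) has_derivative_continuous continuous_at_imp_continuous_on by blast
  then have "open (V \<inter> D -` (- {d}))" by (rule continuous_open_preimage[OF _ assms(1)]) auto
  moreover have "V \<inter> D -` (- {d}) \<noteq> {}"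
  proof
    assume empty: "V \<inter> D -` (- {d}) = {}"
    obtain y where y: "y \<in> V" using assms(2) by blast
    have "D z = d" if "z \<in> V" for z using empty that by auto
    then have "(\<lambda>v. Re (c y * v)) = (\<lambda>v. 0)"
      using y by (intro differential_zero_maxmin[OF y assms(1) assms(3)[OF y]]) simp
    then show False using Re_mult_eq_0 assms(4)[OF y] by blast
  qed
  ultimately show ?thesis using that by blast
qed

section \<open>Harmonic maps\<close>

text \<open>Sector coordinates are roots up to the factor 1/3. Along a harmonic map their derivative
  is governed by the difference of two distinct sheets, hence does not vanish off the branch
  points.\<close>

lemma coord_difference:
  assumes "i < 6"
  shows "\<exists>p q. p \<noteq> q \<and> (\<forall>a. first_coord i a = (a $ p - a $ q) / 3)"
    "\<exists>p q. p \<noteq> q \<and> (\<forall>a. second_coord i a = (a $ p - a $ q) / 3)"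
proof -
  have "(1::3) \<noteq> 2" "(1::3) \<noteq> 3" "(2::3) \<noteq> 3" by simp_all
  then have "[2, 1, 1, 3, 3, 2::3] ! i \<noteq> [3, 3, 2, 2, 1, 1] ! i" "[1, 3, 3, 2, 2, 1::3] ! i \<noteq> [2, 2, 1, 1, 3, 3] ! i"
    using less_6_cases[OF assms] by (elim disjE; simp add: coord_simps)+
  then show "\<exists>p q. p \<noteq> q \<and> (\<forall>a. first_coord i a = (a $ p - a $ q) / 3)"
    "\<exists>p q. p \<noteq> q \<and> (\<forall>a. second_coord i a = (a $ p - a $ q) / 3)"
    unfolding first_coord_def second_coord_def by blast+
qed

text \<open>
  As the three sheets are distinct, some point near \<open>x\<close> is mapped off all walls of the chart, so
  the given sector is a chamber of its apartment.  The two coordinates in it are, up to constants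
  and a factor, real parts of primitives of \<open>(p\<^sub>k - p\<^sub>l) dx\<close>; they have no critical point, hence do
  not attain their lower bound 0.
\<close>

lemma regular_in_open_region:
  assumes harm: "harmonic_phi_map B_phi B_phi_atlas h"
    and C: "open C" "x \<in> C" "x \<noteq> 2" "x \<noteq> -2" and uv: "u \<noteq> v" "h ` C \<subseteq> sector u v"
  shows "h x \<notin> singular_set B_phi B_phi_atlas"
proof -
  have "x \<notin> {b_left, b_right}" using C(3,4) by (simp add: b_left_def b_right_def)
  with harm obtain U f g and p :: "3 \<Rightarrow> complex \<Rightarrow> complex" where
    "open U \<and> x \<in> U \<and> f \<in> B_phi_atlas \<and> (\<forall>y\<in>U. g y \<in> model_plane \<and> f (g y) = h y) \<and>
      (\<forall>i. p i holomorphic_on U) \<and> (\<forall>y\<in>U. range (\<lambda>i. p i y) = sheets y) \<and>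
      (\<forall>i. \<forall>y\<in>U. ((\<lambda>z. g z $ i) has_derivative (\<lambda>v. Re (p i y * v))) (at y))"
    unfolding harmonic_phi_map_def by (elim conjE allE[of _ x] impE; (elim exE)?; simp)
  then have U: "open U" "x \<in> U" "f \<in> B_phi_atlas"
    and fg: "\<And>y. y \<in> U \<Longrightarrow> g y \<in> model_plane \<and> f (g y) = h y"
    and sh: "\<And>y. y \<in> U \<Longrightarrow> range (\<lambda>i. p i y) = sheets y"
    and der: "\<And>i y. y \<in> U \<Longrightarrow> ((\<lambda>z. g z $ i) has_derivative (\<lambda>v. Re (p i y * v))) (at y)"
    by simp_all
  \<comment> \<open>Removing 2 and -2 makes the three sheets distinct at every point of
    \<open>V\<close>, not only at \<open>x\<close>.\<close>
  define V where "V = U \<inter> C \<inter> - {2, -2}"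
  have V: "open V" "x \<in> V" using U C unfolding V_def by (auto intro!: open_Int open_Compl finite_imp_closed)
  have VU: "y \<in> U" "y \<in> C" "y \<noteq> 2" "y \<noteq> -2" if "y \<in> V" for y using that by (auto simp: V_def)
  obtain w \<tau> where chart: "is_chart f w \<tau>" using U(3) B_phi_atlas_iff by blast
  then have \<tau>: "\<tau> \<in> W_aff" and hex: "is_hexagon B8 w" by (auto simp: is_chart_def)
  obtain \<pi> c where \<pi>: "bij \<pi>" "\<And>a k. a $ k = \<tau> a $ \<pi> k - c $ \<pi> k"
    "\<And>b. b \<in> model_plane \<Longrightarrow> \<exists>a\<in>model_plane. \<tau> a = b"
    using W_aff_components[OF \<tau>] by metis
  define \<gamma> where "\<gamma> = (\<lambda>y. SOME a. a \<in> model_plane \<and> \<tau> a = g y)"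
  have \<gamma>: "\<gamma> y \<in> model_plane" "\<tau> (\<gamma> y) = g y" if "y \<in> V" for y
  proof -
    have "\<exists>a. a \<in> model_plane \<and> \<tau> a = g y" using \<pi>(3)[of "g y"] fg[OF VU(1)[OF that]] by blast
    from someI_ex[OF this] show "\<gamma> y \<in> model_plane" "\<tau> (\<gamma> y) = g y" by (simp_all add: \<gamma>_def)
  qed
  \<comment> \<open>Written through \<open>g\<close>, whose derivative is known, because
    \<open>\<gamma>\<close> is obtained pointwise by choice. On \<open>V\<close> this is the
    difference of two components of \<open>\<gamma>\<close>, so its zero sets are the walls of the
    fan.\<close>
  define D where "D = (\<lambda>k l y. (g y $ \<pi> k - c $ \<pi> k) - (g y $ \<pi> l - c $ \<pi> l))"
  have D: "D k l y = \<gamma> y $ k - \<gamma> y $ l" if "y \<in> V" for k l y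
    using \<pi>(2)[of "\<gamma> y" k] \<pi>(2)[of "\<gamma> y" l] \<gamma>(2)[OF that] by (simp add: D_def)
  have dD: "(D k l has_derivative (\<lambda>v. Re ((p (\<pi> k) y - p (\<pi> l) y) * v))) (at y)" if "y \<in> V" for k l y
  proof -
    have "(D k l has_derivative (\<lambda>v. (Re (p (\<pi> k) y * v) - 0) - (Re (p (\<pi> l) y * v) - 0))) (at y)"
      unfolding D_def by (intro has_derivative_diff has_derivative_const der VU(1)[OF that])
    then show ?thesis by (simp add: left_diff_distrib del: times_complex.sel)
  qed
  have nz: "p (\<pi> k) y - p (\<pi> l) y \<noteq> 0" if "y \<in> V" "k \<noteq> l" for k l y
    using three_sheets[OF sh, of y "\<pi> k" "\<pi> l"] VU[OF that(1)] \<pi>(1) that(2)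
    by (simp add: bij_is_inj inj_eq)
  have sec: "h y z = 0" if "y \<in> V" "z \<noteq> u" "z \<noteq> v" for y z
    using uv(2) VU(2)[OF that(1)] that(2,3) by (auto simp: sector_def)
  have nonneg: "h y z \<ge> 0" if "y \<in> V" for y z
    using uv(2) VU(2)[OF that(1)] by (auto simp: sector_def)
  have one: "(1::3) \<noteq> 2" "(1::3) \<noteq> 3" "(2::3) \<noteq> 3" by simp_all
  \<comment> \<open>Three successive shrinkings avoid the three families of walls.\<close>
  obtain V1 where V1: "open V1" "V1 \<noteq> {}" "V1 \<subseteq> V" "\<And>y. y \<in> V1 \<Longrightarrow> D 1 2 y \<noteq> 0"
    by (rule open_ne_constant[OF V(1) _ dD nz[OF _ one(1)]]) (use V(2) in auto)
  obtain V2 where V2: "open V2" "V2 \<noteq> {}" "V2 \<subseteq> V1" "\<And>y. y \<in> V2 \<Longrightarrow> D 1 3 y \<noteq> 0"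
    by (rule open_ne_constant[OF V1(1,2) dD nz[OF _ one(2)]]) (use V1(3) in auto)
  obtain V3 where V3: "V3 \<noteq> {}" "V3 \<subseteq> V2" "\<And>y. y \<in> V3 \<Longrightarrow> D 2 3 y \<noteq> 0"
    by (rule open_ne_constant[OF V2(1,2) dD nz[OF _ one(3)]]) (use V1(3) V2(3) in auto)
  obtain y where y3: "y \<in> V3" using V3(1) by blast
  then have y: "y \<in> V" using V1(3) V2(3) V3(2) by blast
  have "\<gamma> y $ 1 \<noteq> \<gamma> y $ 2" "\<gamma> y $ 1 \<noteq> \<gamma> y $ 3" "\<gamma> y $ 2 \<noteq> \<gamma> y $ 3"
    using V1(4)[of y] V2(4)[of y] V3(3)[of y] y3 V2(3) V3(2) D[OF y] by auto
  then have comp: "k \<noteq> l \<Longrightarrow> \<gamma> y $ k \<noteq> \<gamma> y $ l" for k l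
    using exhaust_3[of k] exhaust_3[of l] by metis
  obtain i where i: "i < 6" "first_coord i (\<gamma> y) \<ge> 0" "second_coord i (\<gamma> y) \<ge> 0" by (rule sector_exists)
  obtain k l where kl: "k \<noteq> l" "\<And>a. first_coord i a = (a $ k - a $ l) / 3"
    using coord_difference(1)[OF i(1)] by blast
  obtain k' l' where kl': "k' \<noteq> l'" "\<And>a. second_coord i a = (a $ k' - a $ l') / 3"
    using coord_difference(2)[OF i(1)] by blast
  have "first_coord i (\<gamma> y) \<noteq> 0" "second_coord i (\<gamma> y) \<noteq> 0"
    unfolding kl(2) kl'(2) using comp[OF kl(1)] comp[OF kl'(1)] by simp_all
  moreover have hy: "h y = cone_point w i (first_coord i (\<gamma> y)) (second_coord i (\<gamma> y))"
    using chart_value[OF chart \<gamma>(1)[OF y] i] \<gamma>(2)[OF y] fg[OF VU(1)[OF y]] by simp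
  ultimately have "h y (w i) \<noteq> 0" "h y (w (Suc i mod 6)) \<noteq> 0"
    using cone_point_apply[OF hex i(1), of i] cone_point_apply[OF hex i(1), of "Suc i mod 6"]
      i(1) Suc_mod_6_neq[OF i(1)] by simp_all
  then have "w i = u \<or> w i = v" "w (Suc i mod 6) = u \<or> w (Suc i mod 6) = v"
    using sec[OF y] by blast+
  moreover have wne: "w i \<noteq> w (Suc i mod 6)"
    using hexagon_inj[OF hex i(1), of "Suc i mod 6"] Suc_mod_6_neq[OF i(1)] by simp
  ultimately have e: "{u, v} = {w i, w (Suc i mod 6)}" by auto
  \<comment> \<open>The values of \<open>h y\<close> on the edge, placed in sector \<open>i\<close>
    of the fan, have the same image under the chart as \<open>\<gamma> y\<close>. By injectivity all
    of \<open>V\<close> lies in this one sector.\<close>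
  have coords: "first_coord i (\<gamma> y) = h y (w i)" "second_coord i (\<gamma> y) = h y (w (Suc i mod 6))"
    if y: "y \<in> V" for y
  proof -
    define s t where "s = h y (w i)" and "t = h y (w (Suc i mod 6))"
    have "h y = cone_point w i s t"
    proof
      fix z
      have "z \<noteq> w i \<Longrightarrow> z \<noteq> w (Suc i mod 6) \<Longrightarrow> h y z = 0" using sec[OF y] e by blast
      then show "h y z = cone_point w i s t z"
        using wne by (auto simp: cone_point_def cone_vertex_def s_def t_def)
    qed
    moreover have "f (\<tau> (s *\<^sub>R fan_ray i + t *\<^sub>R fan_ray (Suc i))) = cone_point w i s t"
      using chart i(1) nonneg[OF y] by (simp add: is_chart_def s_def t_def)
    ultimately have "f (\<tau> (\<gamma> y)) = f (\<tau> (s *\<^sub>R fan_ray i + t *\<^sub>R fan_ray (Suc i)))"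
      using \<gamma>(2)[OF y] fg[OF VU(1)[OF y]] by simp
    then have "\<gamma> y = s *\<^sub>R fan_ray i + t *\<^sub>R fan_ray (Suc i)"
      by (rule chart_inj[OF chart \<gamma>(1)[OF y] sector_coords(3)[OF i(1)]])
    then show "first_coord i (\<gamma> y) = h y (w i)" "second_coord i (\<gamma> y) = h y (w (Suc i mod 6))"
      using sector_coords(1,2)[OF i(1)] by (simp_all add: s_def t_def)
  qed
  \<comment> \<open>A zero at \<open>x\<close> would be an interior minimum of a nonnegative
    function, so its derivative would vanish there, against the distinctness of the sheets.\<close>
  have pos: "D k l x > 0" if kl: "k \<noteq> l" "\<And>y. y \<in> V \<Longrightarrow> D k l y \<ge> 0" for k l
  proof (rule ccontr)
    assume "\<not> D k l x > 0"
    then have "D k l x = 0" using kl(2)[OF V(2)] by simp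
    then have "(\<lambda>v. Re ((p (\<pi> k) x - p (\<pi> l) x) * v)) = (\<lambda>v. 0)"
      using kl(2) by (intro differential_zero_maxmin[OF V(2,1) dD[OF V(2)]]) auto
    then show False using Re_mult_eq_0 nz[OF V(2) kl(1)] by blast
  qed
  have "h x (w i) > 0" "h x (w (Suc i mod 6)) > 0"
  proof -
    have eq: "h y (w i) = D k l y / 3" if "y \<in> V" for y
      unfolding D[OF that] coords(1)[OF that, symmetric] kl(2) ..
    have "D k l y \<ge> 0" if "y \<in> V" for y using eq[OF that] nonneg[OF that, of "w i"] by simp
    then have "D k l x > 0" by (rule pos[OF kl(1)])
    then show "h x (w i) > 0" using eq[OF V(2)] by simp
  next
    have eq: "h y (w (Suc i mod 6)) = D k' l' y / 3" if "y \<in> V" for y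
      unfolding D[OF that] coords(2)[OF that, symmetric] kl'(2) ..
    have "D k' l' y \<ge> 0" if "y \<in> V" for y using eq[OF that] nonneg[OF that, of "w (Suc i mod 6)"] by simp
    then have "D k' l' x > 0" by (rule pos[OF kl'(1)])
    then show "h x (w (Suc i mod 6)) > 0" using eq[OF V(2)] by simp
  qed
  then have "h x u > 0" "h x v > 0" using e by (auto simp: doubleton_eq_iff)
  moreover have "has_edge w u v" using e i(1) by (auto simp: has_edge_def)
  ultimately show ?thesis
    using sector_interior_nonsingular[OF chart _ uv(1)] sec[OF V(2)] by blast
qed

lemma sector_commute: "sector u v = sector v u"
  by (simp add: sector_def insert_commute)

lemma sector_Int_ray:
  assumes "z \<in> sector a b" "z \<in> sector a c" "b \<noteq> c"
  shows "\<And>x. x \<noteq> a \<Longrightarrow> z x = 0" "z a \<ge> 0"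
  using assms by (auto simp: sector_def)

lemma is_h_phi_closure_cell:
  assumes h: "is_h_phi h"
  shows "k < 8 \<Longrightarrow> x \<in> closure (cell k) \<Longrightarrow> h x \<in> sector (Oct k) (Oct (Suc k mod 8))"
    "x \<in> closure (cell 8) \<Longrightarrow> h x \<in> sector (Oct 4) (diagonal 0)"
    "x \<in> closure (cell 9) \<Longrightarrow> h x \<in> sector (Oct 0) (diagonal 0)"
proof -
  have d: "diagonal 0 = Mid (Upair (Oct 0) (Oct 4))" by (simp add: diagonal_def)
  show "k < 8 \<Longrightarrow> x \<in> closure (cell k) \<Longrightarrow> h x \<in> sector (Oct k) (Oct (Suc k mod 8))"
    using h is_outer_region_cell[of k] unfolding is_h_phi_def by blast
  show "x \<in> closure (cell 8) \<Longrightarrow> h x \<in> sector (Oct 4) (diagonal 0)"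
    using h inner_cells(1) unfolding is_h_phi_def d by blast
  show "x \<in> closure (cell 9) \<Longrightarrow> h x \<in> sector (Oct 0) (diagonal 0)"
    using h inner_cells(2) unfolding is_h_phi_def d by blast
qed

lemma singular_on_network:
  assumes h: "is_h_phi h" and x: "x \<in> W_bnr_ext"
  shows "h x \<in> singular_set B_phi B_phi_atlas"
proof -
  have "range h \<subseteq> B_phi" using h unfolding is_h_phi_def harmonic_phi_map_def by (elim conjE)
  then have hx: "h x \<in> B_phi" by blast
  have Oct_ray: "h x \<in> singular_set B_phi B_phi_atlas"
    if "k < 8" "h x \<in> sector (Oct k) b" "h x \<in> sector (Oct k) c" "b \<noteq> c" for k b c
    using Oct_ray_singular[OF that(1) hx] sector_Int_ray[OF that(2-4)] by blast
  have diagonal_ray: "h x \<in> singular_set B_phi B_phi_atlas"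
    if "h x \<in> sector (diagonal 0) b" "h x \<in> sector (diagonal 0) c" "b \<noteq> c" for b c
    using diagonal_ray_singular[OF hx] sector_Int_ray[OF that] by blast
  have ne: "Oct i \<noteq> diagonal 0" for i by (simp add: diagonal_def)
  have outer: "h x \<in> sector (Oct k) (Oct j)" if "x \<in> closure (cell k)" "k < 8" "Suc k mod 8 = j" for k j
    using is_h_phi_closure_cell(1)[OF h that(2,1)] that(3) by simp
  have s: "x \<in> closure (cell 0) \<Longrightarrow> h x \<in> sector (Oct 0) (Oct 1)"
    "x \<in> closure (cell 1) \<Longrightarrow> h x \<in> sector (Oct 1) (Oct 2)"
    "x \<in> closure (cell 2) \<Longrightarrow> h x \<in> sector (Oct 2) (Oct 3)"
    "x \<in> closure (cell 3) \<Longrightarrow> h x \<in> sector (Oct 3) (Oct 4)"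
    "x \<in> closure (cell 4) \<Longrightarrow> h x \<in> sector (Oct 4) (Oct 5)"
    "x \<in> closure (cell 5) \<Longrightarrow> h x \<in> sector (Oct 5) (Oct 6)"
    "x \<in> closure (cell 6) \<Longrightarrow> h x \<in> sector (Oct 6) (Oct 7)"
    "x \<in> closure (cell 7) \<Longrightarrow> h x \<in> sector (Oct 7) (Oct 0)"
    "x \<in> closure (cell 8) \<Longrightarrow> h x \<in> sector (Oct 4) (diagonal 0)"
    "x \<in> closure (cell 9) \<Longrightarrow> h x \<in> sector (Oct 0) (diagonal 0)"
    by (rule outer is_h_phi_closure_cell(2,3)[OF h]; simp)+
  have t: "x \<in> closure (cell k) \<Longrightarrow> h x \<in> sector b a"
    if "x \<in> closure (cell k) \<Longrightarrow> h x \<in> sector a b" for k a b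
    using that by (simp add: sector_commute)
  obtain i j where ij: "x \<in> closure (cell i)" "x \<in> closure (cell j)"
    "(i, j) \<in> {(7, 0), (0, 1), (1, 2), (2, 3), (3, 4), (4, 5), (5, 6), (6, 7),
      (0, 9), (7, 9), (3, 8), (4, 8), (8, 9)}"
    using W_bnr_ext_closures[OF x] by blast
  then consider "x \<in> closure (cell 7)" "x \<in> closure (cell 0)"
    | "x \<in> closure (cell 0)" "x \<in> closure (cell 1)"
    | "x \<in> closure (cell 1)" "x \<in> closure (cell 2)"
    | "x \<in> closure (cell 2)" "x \<in> closure (cell 3)"
    | "x \<in> closure (cell 3)" "x \<in> closure (cell 4)"
    | "x \<in> closure (cell 4)" "x \<in> closure (cell 5)"
    | "x \<in> closure (cell 5)" "x \<in> closure (cell 6)"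
    | "x \<in> closure (cell 6)" "x \<in> closure (cell 7)"
    | "x \<in> closure (cell 0)" "x \<in> closure (cell 9)"
    | "x \<in> closure (cell 7)" "x \<in> closure (cell 9)"
    | "x \<in> closure (cell 3)" "x \<in> closure (cell 8)"
    | "x \<in> closure (cell 4)" "x \<in> closure (cell 8)"
    | "x \<in> closure (cell 8)" "x \<in> closure (cell 9)"
    by auto
  then show ?thesis
  proof cases
    case 1
    then show ?thesis
      by (intro Oct_ray[of 0 "Oct 7" "Oct 1"] t[OF s(8)] s(1)) (simp_all add: ne)
  next
    case 2
    then show ?thesis
      by (intro Oct_ray[of 1 "Oct 0" "Oct 2"] t[OF s(1)] s(2)) (simp_all add: ne)
  next
    case 3
    then show ?thesis
      by (intro Oct_ray[of 2 "Oct 1" "Oct 3"] t[OF s(2)] s(3)) (simp_all add: ne)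
  next
    case 4
    then show ?thesis
      by (intro Oct_ray[of 3 "Oct 2" "Oct 4"] t[OF s(3)] s(4)) (simp_all add: ne)
  next
    case 5
    then show ?thesis
      by (intro Oct_ray[of 4 "Oct 3" "Oct 5"] t[OF s(4)] s(5)) (simp_all add: ne)
  next
    case 6
    then show ?thesis
      by (intro Oct_ray[of 5 "Oct 4" "Oct 6"] t[OF s(5)] s(6)) (simp_all add: ne)
  next
    case 7
    then show ?thesis
      by (intro Oct_ray[of 6 "Oct 5" "Oct 7"] t[OF s(6)] s(7)) (simp_all add: ne)
  next
    case 8
    then show ?thesis
      by (intro Oct_ray[of 7 "Oct 6" "Oct 0"] t[OF s(7)] s(8)) (simp_all add: ne)
  next
    case 9
    then show ?thesis
      by (intro Oct_ray[of 0 "Oct 1" "diagonal 0"] s(1) s(10)) (simp_all add: ne)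
  next
    case 10
    then show ?thesis
      by (intro Oct_ray[of 0 "Oct 7" "diagonal 0"] t[OF s(8)] s(10)) (simp_all add: ne)
  next
    case 11
    then show ?thesis
      by (intro Oct_ray[of 4 "Oct 3" "diagonal 0"] t[OF s(4)] s(9)) (simp_all add: ne)
  next
    case 12
    then show ?thesis
      by (intro Oct_ray[of 4 "Oct 5" "diagonal 0"] s(5) s(9)) (simp_all add: ne)
  next
    case 13
    then show ?thesis by (intro diagonal_ray[of "Oct 4" "Oct 0"] t[OF s(9)] t[OF s(10)]) simp_all
  qed
qed

lemma regular_off_network:
  assumes h: "is_h_phi h" and x: "x \<notin> W_bnr_ext"
  shows "h x \<notin> singular_set B_phi B_phi_atlas"
proof -
  obtain i where i: "i < 10" "x \<in> cell i" using x cells_cover by blast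
  \<comment> \<open>The branch points lie on the network, so no cell contains them and local charts
    are available throughout a cell.\<close>
  have two: "2 \<in> W_bnr_ext" "-2 \<in> W_bnr_ext"
  proof -
    have "confocal 0 0 \<in> W_bnr_ext" "confocal 0 pi \<in> W_bnr_ext" unfolding W_bnr_ext_eq by blast+
    moreover have "confocal 0 0 = 2" "confocal 0 pi = -2" by (simp_all add: complex_eq_iff)
    ultimately show "2 \<in> W_bnr_ext" "-2 \<in> W_bnr_ext" by simp_all
  qed
  have "\<exists>u v. u \<noteq> v \<and> h ` cell i \<subseteq> sector u v"
  proof -
    consider "i < 8" | "i = 8" | "i = 9" using i(1) by linarith
    then show ?thesis
    proof cases
      case 1
      have "Oct i \<noteq> Oct (Suc i mod 8)" using 1 by (auto simp: mod_Suc)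
      moreover have "h ` cell i \<subseteq> sector (Oct i) (Oct (Suc i mod 8))"
        using is_h_phi_closure_cell(1)[OF h 1] closure_subset by blast
      ultimately show ?thesis by blast
    next
      case 2
      have "Oct 4 \<noteq> diagonal 0" by (simp add: diagonal_def)
      moreover have "h ` cell i \<subseteq> sector (Oct 4) (diagonal 0)"
        using is_h_phi_closure_cell(2)[OF h] closure_subset unfolding 2 by blast
      ultimately show ?thesis by blast
    next
      case 3
      have "Oct 0 \<noteq> diagonal 0" by (simp add: diagonal_def)
      moreover have "h ` cell i \<subseteq> sector (Oct 0) (diagonal 0)"
        using is_h_phi_closure_cell(3)[OF h] closure_subset unfolding 3 by blast
      ultimately show ?thesis by blast
    qed
  qed
  then obtain u v where "u \<noteq> v" "h ` cell i \<subseteq> sector u v" by blast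
  moreover have "harmonic_phi_map B_phi B_phi_atlas h" using h unfolding is_h_phi_def by blast
  ultimately show ?thesis
    using regular_in_open_region[of h "cell i" x u v] open_connected_cell(1)[OF i(1)] i(2) x two by blast
qed

theorem proposition5p24:
  fixes h :: "complex \<Rightarrow> (vert \<Rightarrow> real)"
  assumes "is_h_phi h"
  shows "W_bnr \<subseteq> h -` singular_set B_phi B_phi_atlas \<and>
         h -` singular_set B_phi B_phi_atlas = W_bnr_ext"
proof -
  have "h -` singular_set B_phi B_phi_atlas = W_bnr_ext"
    using singular_on_network[OF assms] regular_off_network[OF assms] by blast
  then show ?thesis by (auto simp: W_bnr_ext_def)
qed

end
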